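(* Let $R$ be an ordinary standard differential ring of finite differential type that satisfies property S3. Suppose that either $\operatorname{type}^{\Delta}R=0$ or $\dim^{\Delta}R<\infty$. Then $R$ is a J-ring.
   Context: All rings are commutative with identity. A differential ring is a ring with finitely many pairwise commuting derivations; it is ordinary if it has exactly one distinguished derivation. An ideal is differential if it is stable under the derivations; $\operatorname{Spec}^{\Delta}R$ is the set of differential prime ideals of $R$, assumed nonempty. $R\{z_1,\dots,z_n\}$ is the ring of differential polynomials in $n$ differential indeterminates over $R$; for an ideal $\mathfrak a$ of $R$, $\mathfrak a\{z_1,\dots,z_n\}$ is the ideal of differential polynomials with all coefficients in $\mathfrak a$. $R$ is standard if for every differential prime $\mathfrak p$ of $R$ the residue field $R_{\mathfrak p}/\mathfrak pR_{\mathfrak p}$ has characteristic zero. A differential prime $\mathfrak p$ of $R\{z_1,\dots,z_n\}$ is a differential upper to a differential prime $\mathfrak q$ of $R$ if $\mathfrak p\cap R=\mathfrak q$ and $\mathfrak p\ne\mathfrak q\{z_1,\dots,z_n\}$. Property S3: for every integer $n>0$ and all differential primes $\mathfrak q_1\subset\mathfrak q_2$ of $R$ there is no differential prime $\mathfrak p$ of $R\{z_1,\dots,z_n\}$ such that $\mathfrak p$ is a differential upper to $\mathfrak q_1$ and $\mathfrak p\subset\mathfrak q_2\{z_1,\dots,z_n\}$. Gap measure: for $X\subseteq\operatorname{Spec}^{\Delta}R$ there is a unique function $\mu$ with values in $\mathbb Z\cup\{\infty\}$ on pairs $(\mathfrak p,\mathfrak p')$ of elements of $X$ with $\mathfrak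 p\supseteq\mathfrak p'$ such that: (1) $\mu(\mathfrak p,\mathfrak p')\ge 0$; (2) $\mu(\mathfrak p,\mathfrak p')=0$ iff $\mathfrak p=\mathfrak p'$ or there is no infinite strictly descending chain $\mathfrak p=\mathfrak p_0\supsetneq\mathfrak p_1\supsetneq\cdots\supseteq\mathfrak p'$ in $X$; (3) for an integer $d>0$, $\mu(\mathfrak p,\mathfrak p')\ge d$ iff $\mathfrak p\ne\mathfrak p'$ and there is an infinite strictly descending sequence $\mathfrak p=\mathfrak p_0\supsetneq\mathfrak p_1\supsetneq\cdots\supseteq\mathfrak p'$ in $X$ (all terms containing $\mathfrak p'$) with $\mu(\mathfrak p_{i-1},\mathfrak p_i)\ge d-1$ for all $i\ge 1$. The differential type $\operatorname{type}^{\Delta}R$ is the supremum of all $\mu(\mathfrak p,\mathfrak p')$ with $\mathfrak p\supseteq\mathfrak p'$ in $X=\operatorname{Spec}^{\Delta}R$. The differential dimension $\dim^{\Delta}R$ is the supremum of the integers $k\ge 0$ such that there is a chain $\mathfrak p_0\supsetneq\cdots\supsetneq\mathfrak p_k$ in $\operatorname{Spec}^{\Delta}R$ with $\mu(\mathfrak p_{i-1},\mathfrak p_i)=\operatorname{type}^{\Delta}R$ for $i=1,\dots,k$. J-ring: a differential ring $R$ with $m$ derivations and finite differential type $t$ is a J-ring if for every $n>0$ one has $\operatorname{type}^{\Delta}R\{z_1,\dots,z_n\}=\max(t,m)$ and: (i) $\dim^{\Delta}R\{z_1,\dots,z_n\}=n$ if $t<m$; (ii) $\dim^{\Delta}R<\infty$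 and $\dim^{\Delta}R\{z_1,\dots,z_n\}=n+\dim^{\Delta}R$ if $t=m$; (iii) $\dim^{\Delta}R<\infty$ and $\dim^{\Delta}R\{z_1,\dots,z_n\}=\dim^{\Delta}R$ if $t>m$. (Here $m=1$.) *)

theory Defs
  imports
    "HOL-Library.Cardinality"
    "HOL-Library.Extended_Nat"
    "HOL-Library.Poly_Mapping"
    "HOL-Algebra.Algebra"
    "HOL-Algebra.Algebraic_Closure_Type"
begin

section \<open>Differential rings\<close>

definition derivation :: "('a, 'b) ring_scheme \<Rightarrow> ('a \<Rightarrow> 'a) \<Rightarrow> bool" where
  "derivation R d \<longleftrightarrow>
     d \<in> carrier R \<rightarrow> carrier R \<and>
     (\<forall>x\<in>carrier R. \<forall>y\<in>carrier R. d (x \<oplus>\<^bsub>R\<^esub> y) = d x \<oplus>\<^bsub>R\<^esub> d y) \<and>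
     (\<forall>x\<in>carrier R. \<forall>y\<in>carrier R.
        d (x \<otimes>\<^bsub>R\<^esub> y) = (x \<otimes>\<^bsub>R\<^esub> d y) \<oplus>\<^bsub>R\<^esub> (d x \<otimes>\<^bsub>R\<^esub> y))"

text \<open>The distinguished derivations form a family indexed by a finite type \<open>'d\<close>, so that
  \<open>m = CARD('d)\<close> is their number; the ring is ordinary if \<open>CARD('d) = 1\<close>.\<close>

definition differential_ring ::
    "('a, 'b) ring_scheme \<Rightarrow> ('d::finite \<Rightarrow> 'a \<Rightarrow> 'a) \<Rightarrow> bool" where
  "differential_ring R D \<longleftrightarrow>
     cring R \<and> (\<forall>i. derivation R (D i)) \<and>
     (\<forall>i j. \<forall>x\<in>carrier R. D i (D j x) = D j (D i x))"

definition diff_spec ::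
    "('a, 'b) ring_scheme \<Rightarrow> ('d::finite \<Rightarrow> 'a \<Rightarrow> 'a) \<Rightarrow> 'a set set" where
  "diff_spec R D = {P. primeideal P R \<and> (\<forall>i. \<forall>x\<in>P. D i x \<in> P)}"


section \<open>Localization at a prime and standard differential rings\<close>

definition frac_rel :: "('a, 'b) ring_scheme \<Rightarrow> 'a set \<Rightarrow> (('a \<times> 'a) \<times> ('a \<times> 'a)) set" where
  "frac_rel R P = {((a, s), (b, t)).
     a \<in> carrier R \<and> s \<in> carrier R - P \<and> b \<in> carrier R \<and> t \<in> carrier R - P \<and>
     (\<exists>u \<in> carrier R - P. u \<otimes>\<^bsub>R\<^esub> (a \<otimes>\<^bsub>R\<^esub> t) = u \<otimes>\<^bsub>R\<^esub> (b \<otimes>\<^bsub>R\<^esub> s))}"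

definition loc_frac :: "('a, 'b) ring_scheme \<Rightarrow> 'a set \<Rightarrow> 'a \<Rightarrow> 'a \<Rightarrow> ('a \<times> 'a) set" where
  "loc_frac R P a s = frac_rel R P `` {(a, s)}"

definition localization :: "('a, 'b) ring_scheme \<Rightarrow> 'a set \<Rightarrow> ('a \<times> 'a) set ring" where
  "localization R P = \<lparr>
     carrier = (carrier R \<times> (carrier R - P)) // frac_rel R P,
     monoid.mult = (\<lambda>A B. \<Union>x\<in>A. \<Union>y\<in>B.
              loc_frac R P (fst x \<otimes>\<^bsub>R\<^esub> fst y) (snd x \<otimes>\<^bsub>R\<^esub> snd y)),
     one = loc_frac R P \<one>\<^bsub>R\<^esub> \<one>\<^bsub>R\<^esub>,
     ring.zero = loc_frac R P \<zero>\<^bsub>R\<^esub> \<one>\<^bsub>R\<^esub>,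
     add = (\<lambda>A B. \<Union>x\<in>A. \<Union>y\<in>B.
              loc_frac R P ((fst x \<otimes>\<^bsub>R\<^esub> snd y) \<oplus>\<^bsub>R\<^esub> (fst y \<otimes>\<^bsub>R\<^esub> snd x))
                (snd x \<otimes>\<^bsub>R\<^esub> snd y)) \<rparr>"

context primeideal
begin

lemma mult_compl: "s \<in> carrier R - I \<Longrightarrow> t \<in> carrier R - I \<Longrightarrow> s \<otimes> t \<in> carrier R - I"
  using I_prime by auto

lemma one_compl: "\<one> \<in> carrier R - I"
  using I_notcarr one_imp_carrier by auto

lemma equiv_frac_rel: "equiv (carrier R \<times> (carrier R - I)) (frac_rel R I)"
proof (rule equivI)
  show "frac_rel R I \<subseteq> (carrier R \<times> (carrier R - I)) \<times> (carrier R \<times> (carrier R - I))"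
    by (auto simp: frac_rel_def)
  show "refl_on (carrier R \<times> (carrier R - I)) (frac_rel R I)"
    using one_compl by (auto simp: frac_rel_def refl_on_def)
  show "sym (frac_rel R I)"
  proof (rule symI)
    fix x y assume "(x, y) \<in> frac_rel R I"
    then obtain u where "u \<in> carrier R - I" "u \<otimes> (fst x \<otimes> snd y) = u \<otimes> (fst y \<otimes> snd x)"
      by (auto simp: frac_rel_def)
    with \<open>(x, y) \<in> frac_rel R I\<close> show "(y, x) \<in> frac_rel R I"
      by (auto simp: frac_rel_def intro!: bexI[of _ u])
  qed
  show "trans (frac_rel R I)"
  proof (rule transI)
    fix x y z assume A: "(x, y) \<in> frac_rel R I" and B: "(y, z) \<in> frac_rel R I"
    obtain a s b t c r where [simp]: "x = (a, s)" "y = (b, t)" "z = (c, r)"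
      by (cases x; cases y; cases z) auto
    from A obtain u where u: "u \<in> carrier R - I" "u \<otimes> (a \<otimes> t) = u \<otimes> (b \<otimes> s)"
      by (auto simp: frac_rel_def)
    from B obtain v where v: "v \<in> carrier R - I" "v \<otimes> (b \<otimes> r) = v \<otimes> (c \<otimes> t)"
      by (auto simp: frac_rel_def)
    have mem: "a \<in> carrier R" "b \<in> carrier R" "c \<in> carrier R"
      "s \<in> carrier R - I" "t \<in> carrier R - I" "r \<in> carrier R - I"
      using A B by (auto simp: frac_rel_def)
    note m = mem[simplified] u(1)[simplified] v(1)[simplified]
    have "(u \<otimes> v \<otimes> t) \<otimes> (a \<otimes> r) = (v \<otimes> r) \<otimes> (u \<otimes> (a \<otimes> t))"
      using m by (simp add: m_ac)
    also have "\<dots> = (u \<otimes> s) \<otimes> (v \<otimes> (b \<otimes> r))"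
      unfolding u(2) using m by (simp add: m_ac)
    also have "\<dots> = (u \<otimes> v \<otimes> t) \<otimes> (c \<otimes> s)"
      unfolding v(2) using m by (simp add: m_ac)
    finally show "(x, z) \<in> frac_rel R I"
      using mem mult_compl u(1) v(1) by (auto simp: frac_rel_def intro!: bexI[of _ "u \<otimes> v \<otimes> t"])
  qed
qed

lemma frac_eq_iff:
  assumes "a \<in> carrier R" "b \<in> carrier R" "s \<in> carrier R - I" "t \<in> carrier R - I"
  shows "loc_frac R I a s = loc_frac R I b t \<longleftrightarrow>
           (\<exists>u \<in> carrier R - I. u \<otimes> (a \<otimes> t) = u \<otimes> (b \<otimes> s))"
proof -
  have "loc_frac R I a s = loc_frac R I b t \<longleftrightarrow> ((a, s), (b, t)) \<in> frac_rel R I"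
    unfolding loc_frac_def using eq_equiv_class_iff[OF equiv_frac_rel] assms by auto
  then show ?thesis
    using assms by (auto simp: frac_rel_def)
qed

lemma frac_closed [simp]:
  "a \<in> carrier R \<Longrightarrow> s \<in> carrier R - I \<Longrightarrow> loc_frac R I a s \<in> carrier (localization R I)"
  by (auto simp: localization_def loc_frac_def intro!: quotientI)

lemma carrier_localizationE:
  assumes "A \<in> carrier (localization R I)"
  obtains a s where "a \<in> carrier R" "s \<in> carrier R - I" "A = loc_frac R I a s"
  using assms by (auto simp: localization_def loc_frac_def elim!: quotientE)

lemma localization_mult:
  assumes "a \<in> carrier R" "b \<in> carrier R" "s \<in> carrier R - I" "t \<in> carrier R - I"
  shows "loc_frac R I a s \<otimes>\<^bsub>localization R I\<^esub> loc_frac R I b t = loc_frac R I (a \<otimes> b) (s \<otimes> t)"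
proof -
  have *: "loc_frac R I (a' \<otimes> b') (s' \<otimes> t') = loc_frac R I (a \<otimes> b) (s \<otimes> t)"
    if "(a', s') \<in> loc_frac R I a s" "(b', t') \<in> loc_frac R I b t" for a' s' b' t'
  proof -
    from that obtain u v where
      u: "u \<in> carrier R - I" "u \<otimes> (a \<otimes> s') = u \<otimes> (a' \<otimes> s)" and
      v: "v \<in> carrier R - I" "v \<otimes> (b \<otimes> t') = v \<otimes> (b' \<otimes> t)" and
      mem: "a' \<in> carrier R" "b' \<in> carrier R" "s' \<in> carrier R - I" "t' \<in> carrier R - I"
      by (auto simp: loc_frac_def frac_rel_def)
    note m = mem[simplified] u(1)[simplified] v(1)[simplified] assms[simplified]
    have "(u \<otimes> v) \<otimes> ((a' \<otimes> b') \<otimes> (s \<otimes> t)) = (u \<otimes> (a' \<otimes> s)) \<otimes> (v \<otimes> (b' \<otimes> t))"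
      using m by (simp add: m_ac)
    also have "\<dots> = (u \<otimes> v) \<otimes> ((a \<otimes> b) \<otimes> (s' \<otimes> t'))"
      unfolding u(2)[symmetric] v(2)[symmetric] using m by (simp add: m_ac)
    finally show ?thesis
      using mem assms u(1) v(1) mult_compl by (subst frac_eq_iff) blast+
  qed
  have ne: "(a, s) \<in> loc_frac R I a s" "(b, t) \<in> loc_frac R I b t"
    using assms equiv_class_self[OF equiv_frac_rel] by (auto simp: loc_frac_def)
  have "(\<Union>x \<in> loc_frac R I a s. \<Union>y \<in> loc_frac R I b t.
           loc_frac R I (fst x \<otimes> fst y) (snd x \<otimes> snd y)) = loc_frac R I (a \<otimes> b) (s \<otimes> t)" (is "?L = _")
  proof -
    have "?L = (\<Union>x \<in> loc_frac R I a s. \<Union>y \<in> loc_frac R I b t. loc_frac R I (a \<otimes> b) (s \<otimes> t))"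
      by (intro SUP_cong refl) (use * in \<open>simp add: split_paired_all\<close>)
    then show ?thesis using ne by auto
  qed
  then show ?thesis by (simp add: localization_def)
qed

lemma localization_add:
  assumes "a \<in> carrier R" "b \<in> carrier R" "s \<in> carrier R - I" "t \<in> carrier R - I"
  shows "loc_frac R I a s \<oplus>\<^bsub>localization R I\<^esub> loc_frac R I b t =
           loc_frac R I ((a \<otimes> t) \<oplus> (b \<otimes> s)) (s \<otimes> t)"
proof -
  have *: "loc_frac R I ((a' \<otimes> t') \<oplus> (b' \<otimes> s')) (s' \<otimes> t') =
           loc_frac R I ((a \<otimes> t) \<oplus> (b \<otimes> s)) (s \<otimes> t)"
    if "(a', s') \<in> loc_frac R I a s" "(b', t') \<in> loc_frac R I b t" for a' s' b' t'
  proof -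
    from that obtain u v where
      u: "u \<in> carrier R - I" "u \<otimes> (a \<otimes> s') = u \<otimes> (a' \<otimes> s)" and
      v: "v \<in> carrier R - I" "v \<otimes> (b \<otimes> t') = v \<otimes> (b' \<otimes> t)" and
      mem: "a' \<in> carrier R" "b' \<in> carrier R" "s' \<in> carrier R - I" "t' \<in> carrier R - I"
      by (auto simp: loc_frac_def frac_rel_def)
    note m = mem[simplified] u(1)[simplified] v(1)[simplified] assms[simplified]
    have "(u \<otimes> v) \<otimes> (((a' \<otimes> t') \<oplus> (b' \<otimes> s')) \<otimes> (s \<otimes> t)) =
            (u \<otimes> (a' \<otimes> s)) \<otimes> (v \<otimes> (t \<otimes> t')) \<oplus> (v \<otimes> (b' \<otimes> t)) \<otimes> (u \<otimes> (s \<otimes> s'))"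
      using m by (simp add: m_ac l_distr r_distr)
    also have "\<dots> = (u \<otimes> v) \<otimes> (((a \<otimes> t) \<oplus> (b \<otimes> s)) \<otimes> (s' \<otimes> t'))"
      unfolding u(2)[symmetric] v(2)[symmetric] using m by (simp add: m_ac l_distr r_distr)
    finally have e: "(u \<otimes> v) \<otimes> (((a' \<otimes> t') \<oplus> (b' \<otimes> s')) \<otimes> (s \<otimes> t)) =
      (u \<otimes> v) \<otimes> (((a \<otimes> t) \<oplus> (b \<otimes> s)) \<otimes> (s' \<otimes> t'))" .
    have "u \<otimes> v \<in> carrier R - I" "s \<otimes> t \<in> carrier R - I" "s' \<otimes> t' \<in> carrier R - I"
      using mem assms u(1) v(1) mult_compl by blast+
    moreover have "a' \<otimes> t' \<oplus> b' \<otimes> s' \<in> carrier R" "a \<otimes> t \<oplus> b \<otimes> s \<in> carrier R"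
      using m by auto
    ultimately show ?thesis
      using e frac_eq_iff by blast
  qed
  have ne: "(a, s) \<in> loc_frac R I a s" "(b, t) \<in> loc_frac R I b t"
    using assms equiv_class_self[OF equiv_frac_rel] by (auto simp: loc_frac_def)
  have "(\<Union>x \<in> loc_frac R I a s. \<Union>y \<in> loc_frac R I b t.
           loc_frac R I ((fst x \<otimes> snd y) \<oplus> (fst y \<otimes> snd x)) (snd x \<otimes> snd y)) =
        loc_frac R I ((a \<otimes> t) \<oplus> (b \<otimes> s)) (s \<otimes> t)" (is "?L = _")
  proof -
    have "?L = (\<Union>x \<in> loc_frac R I a s. \<Union>y \<in> loc_frac R I b t. loc_frac R I ((a \<otimes> t) \<oplus> (b \<otimes> s)) (s \<otimes> t))"
      by (intro SUP_cong refl) (use * in \<open>simp add: split_paired_all\<close>)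
    then show ?thesis using ne by auto
  qed
  then show ?thesis by (simp add: localization_def)
qed

lemma frac_eqI:
  assumes "a \<in> carrier R" "b \<in> carrier R" "s \<in> carrier R - I" "t \<in> carrier R - I"
    and "a \<otimes> t = b \<otimes> s"
  shows "loc_frac R I a s = loc_frac R I b t"
  using assms one_compl by (subst frac_eq_iff) auto

lemma cring_localization: "cring (localization R I)"
proof -
  let ?L = "localization R I"
  have one: "\<one>\<^bsub>?L\<^esub> = loc_frac R I \<one> \<one>" and zero: "\<zero>\<^bsub>?L\<^esub> = loc_frac R I \<zero> \<one>"
    by (simp_all add: localization_def)
  have mc: "s \<otimes> t \<in> carrier R" "s \<otimes> t \<notin> I"
    if "s \<in> carrier R" "s \<notin> I" "t \<in> carrier R" "t \<notin> I" for s t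
    using mult_compl that by auto
  have oc: "\<one> \<notin> I" using one_compl by auto
  note simps = one zero localization_add localization_mult mc oc
  show ?thesis
  proof (intro cringI abelian_groupI comm_monoidI)
    fix x y assume "x \<in> carrier ?L" "y \<in> carrier ?L"
    then show "x \<oplus>\<^bsub>?L\<^esub> y \<in> carrier ?L" "x \<otimes>\<^bsub>?L\<^esub> y \<in> carrier ?L"
      by (auto elim!: carrier_localizationE simp: simps)
  next
    show "\<zero>\<^bsub>?L\<^esub> \<in> carrier ?L" "\<one>\<^bsub>?L\<^esub> \<in> carrier ?L" by (auto simp: simps)
  next
    fix x y z assume "x \<in> carrier ?L" "y \<in> carrier ?L" "z \<in> carrier ?L"
    then obtain a s b t c r where m: "a \<in> carrier R" "s \<in> carrier R - I" "b \<in> carrier R"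
      "t \<in> carrier R - I" "c \<in> carrier R" "r \<in> carrier R - I" and
      e: "x = loc_frac R I a s" "y = loc_frac R I b t" "z = loc_frac R I c r"
      by (elim carrier_localizationE)
    show "x \<oplus>\<^bsub>?L\<^esub> y \<oplus>\<^bsub>?L\<^esub> z = x \<oplus>\<^bsub>?L\<^esub> (y \<oplus>\<^bsub>?L\<^esub> z)"
      "x \<otimes>\<^bsub>?L\<^esub> y \<otimes>\<^bsub>?L\<^esub> z = x \<otimes>\<^bsub>?L\<^esub> (y \<otimes>\<^bsub>?L\<^esub> z)"
      using m unfolding e by (auto simp: simps m_ac a_ac l_distr r_distr)
    show "(x \<oplus>\<^bsub>?L\<^esub> y) \<otimes>\<^bsub>?L\<^esub> z = x \<otimes>\<^bsub>?L\<^esub> z \<oplus>\<^bsub>?L\<^esub> y \<otimes>\<^bsub>?L\<^esub> z"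
      using m unfolding e
      by (simp add: simps) (rule frac_eqI, simp_all add: mc m_ac a_ac l_distr r_distr)
  next
    fix x y assume "x \<in> carrier ?L" "y \<in> carrier ?L"
    then obtain a s b t where m: "a \<in> carrier R" "s \<in> carrier R - I" "b \<in> carrier R"
      "t \<in> carrier R - I" and e: "x = loc_frac R I a s" "y = loc_frac R I b t"
      by (elim carrier_localizationE)
    show "x \<oplus>\<^bsub>?L\<^esub> y = y \<oplus>\<^bsub>?L\<^esub> x" "x \<otimes>\<^bsub>?L\<^esub> y = y \<otimes>\<^bsub>?L\<^esub> x"
      using m unfolding e by (auto simp: simps m_ac a_ac)
  next
    fix x assume "x \<in> carrier ?L"
    then obtain a s where m: "a \<in> carrier R" "s \<in> carrier R - I" and e: "x = loc_frac R I a s"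
      by (elim carrier_localizationE)
    show "\<zero>\<^bsub>?L\<^esub> \<oplus>\<^bsub>?L\<^esub> x = x" "\<one>\<^bsub>?L\<^esub> \<otimes>\<^bsub>?L\<^esub> x = x"
      using m unfolding e by (auto simp: simps)
    have "loc_frac R I (\<ominus> a) s \<oplus>\<^bsub>?L\<^esub> x = \<zero>\<^bsub>?L\<^esub>"
      using m unfolding e
      by (simp add: simps l_minus l_neg) (rule frac_eqI, simp_all add: mc oc)
    then show "\<exists>y\<in>carrier ?L. y \<oplus>\<^bsub>?L\<^esub> x = \<zero>\<^bsub>?L\<^esub>"
      using m by (intro bexI[of _ "loc_frac R I (\<ominus> a) s"]) auto
  qed
qed

end

text \<open>\<open>R\<^sub>P / P R\<^sub>P\<close>, where \<open>P R\<^sub>P\<close> is the ideal of \<open>R\<^sub>P\<close> generated by the image of \<open>P\<close>.\<close>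

definition residue_field :: "('a, 'b) ring_scheme \<Rightarrow> 'a set \<Rightarrow> ('a \<times> 'a) set set ring" where
  "residue_field R P =
     localization R P Quot
       (Idl\<^bsub>localization R P\<^esub> ((\<lambda>a. loc_frac R P a \<one>\<^bsub>R\<^esub>) ` P))"

definition char_zero :: "('a, 'b) ring_scheme \<Rightarrow> bool" where
  "char_zero K \<longleftrightarrow> (\<forall>n::nat. n > 0 \<longrightarrow> add_pow K n \<one>\<^bsub>K\<^esub> \<noteq> \<zero>\<^bsub>K\<^esub>)"

definition standard :: "('a, 'b) ring_scheme \<Rightarrow> ('d::finite \<Rightarrow> 'a \<Rightarrow> 'a) \<Rightarrow> bool" where
  "standard R D \<longleftrightarrow> (\<forall>P\<in>diff_spec R D. char_zero (residue_field R P))"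


section \<open>Differential polynomials\<close>

text \<open>The variable \<open>(j, \<theta>)\<close> stands for the derivative
  \<open>(\<Prod>i. \<delta>\<^sub>i ^ \<theta> i) z\<^sub>j\<close> of the \<open>j\<close>-th differential indeterminate. The type contains
  infinitely many differential indeterminates; \<open>R{z\<^sub>1,\<dots>,z\<^sub>n}\<close> is a subring.
  The coefficient ring \<open>R\<close> is a type of class \<^class>\<open>comm_ring_1\<close>, regarded as a ring
  record through \<^const>\<open>ring_of_type_algebra\<close>.\<close>

type_synonym 'd dvar = "nat \<times> ('d \<Rightarrow> nat)"
type_synonym ('a, 'd) dpoly = "('d dvar \<Rightarrow>\<^sub>0 nat) \<Rightarrow>\<^sub>0 'a"

definition shift :: "'d \<Rightarrow> 'd dvar \<Rightarrow> 'd dvar" where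
  "shift i v = (fst v, (snd v)(i := Suc (snd v i)))"

definition monom_deriv :: "'d \<Rightarrow> ('d dvar \<Rightarrow>\<^sub>0 nat) \<Rightarrow> ('a::comm_ring_1, 'd) dpoly" where
  "monom_deriv i m = (\<Sum>v\<in>Poly_Mapping.keys m.
     Poly_Mapping.single (m - Poly_Mapping.single v 1 + Poly_Mapping.single (shift i v) 1)
       (of_nat (Poly_Mapping.lookup m v)))"

text \<open>The extension of \<open>D i\<close> to differential polynomials: \<open>c m\<close> is mapped to
  \<open>(D i c) m + c (\<delta>\<^sub>i m)\<close>, and \<open>\<delta>\<^sub>i\<close> raises the \<open>i\<close>-th exponent of a variable.\<close>

definition dpoly_deriv ::
    "('d \<Rightarrow> 'a \<Rightarrow> 'a) \<Rightarrow> 'd \<Rightarrow> ('a::comm_ring_1, 'd) dpoly \<Rightarrow> ('a, 'd) dpoly" where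
  "dpoly_deriv D i f = (\<Sum>m\<in>Poly_Mapping.keys f.
     Poly_Mapping.single m (D i (Poly_Mapping.lookup f m)) +
     Poly_Mapping.single 0 (Poly_Mapping.lookup f m) * monom_deriv i m)"

definition dpoly_ring :: "nat \<Rightarrow> ('a::comm_ring_1, 'd) dpoly ring" where
  "dpoly_ring n =
     ring_of_type_algebra\<lparr>carrier := {f. \<forall>m\<in>Poly_Mapping.keys f. \<forall>v\<in>Poly_Mapping.keys m. fst v \<in> {1..n}}\<rparr>"

lemma derivation_ring_of_type_algebra:
  "derivation (ring_of_type_algebra :: 'a::comm_ring_1 ring) d \<longleftrightarrow>
     (\<forall>x y. d (x + y) = d x + d y) \<and> (\<forall>x y. d (x * y) = x * d y + d x * y)"
  by (simp add: derivation_def ring_of_type_algebra_def)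

lemma poly_mapping_add_induct:
  fixes f :: "'x \<Rightarrow>\<^sub>0 'y::comm_monoid_add"
  assumes "\<And>k c. P (Poly_Mapping.single k c)" "\<And>f g. P f \<Longrightarrow> P g \<Longrightarrow> P (f + g)"
  shows "P f"
proof -
  have "P (\<Sum>k\<in>K. Poly_Mapping.single k (Poly_Mapping.lookup f k))" if "finite K" for K
    using that assms(1)[of undefined 0] by induction (auto intro: assms)
  moreover have "f = (\<Sum>k\<in>Poly_Mapping.keys f. Poly_Mapping.single k (Poly_Mapping.lookup f k))"
    by (rule poly_mapping_eqI)
       (auto simp: lookup_sum lookup_single when_def in_keys_iff if_distrib sum.delta' cong: if_cong)
  ultimately show ?thesis by (metis finite_keys)
qed

lemma monom_deriv_superset:
  assumes "finite K" "Poly_Mapping.keys m \<subseteq> K"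
  shows "monom_deriv i m = (\<Sum>v\<in>K.
     Poly_Mapping.single (m - Poly_Mapping.single v 1 + Poly_Mapping.single (shift i v) 1)
       (of_nat (Poly_Mapping.lookup m v)))"
  unfolding monom_deriv_def using assms by (intro sum.mono_neutral_left) (auto simp: in_keys_iff)

lemma monom_deriv_0 [simp]: "monom_deriv i 0 = 0"
  by (simp add: monom_deriv_def)

lemma monom_deriv_var [simp]:
  "monom_deriv i (Poly_Mapping.single v 1) =
     Poly_Mapping.single (Poly_Mapping.single (shift i v) 1) 1"
  by (simp add: monom_deriv_def)

lemma monom_deriv_add:
  "monom_deriv i (m + m') =
     Poly_Mapping.single m 1 * monom_deriv i m' + monom_deriv i m * Poly_Mapping.single m' 1"
proof -
  let ?K = "Poly_Mapping.keys m \<union> Poly_Mapping.keys m'"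
  let ?s = "\<lambda>m v. m - Poly_Mapping.single v 1 + Poly_Mapping.single (shift i v) (1::nat)"
  have sub: "m + m' - Poly_Mapping.single v 1 = m + (m' - Poly_Mapping.single v 1)"
    if "Poly_Mapping.lookup m' v > 0" for m m' :: "'a dvar \<Rightarrow>\<^sub>0 nat" and v
    using that by (intro poly_mapping_eqI)
      (auto simp: lookup_add lookup_minus lookup_single when_def)
  have s: "?s (m + m') v = m + ?s m' v" if "Poly_Mapping.lookup m' v > 0" for m m' v
    using sub[OF that, of m] by (simp add: add.assoc)
  have "Poly_Mapping.single (?s (m + m') v) (of_nat (Poly_Mapping.lookup (m + m') v)) =
      Poly_Mapping.single (m + ?s m' v) (of_nat (Poly_Mapping.lookup m' v) :: 'b) +
      Poly_Mapping.single (?s m v + m') (of_nat (Poly_Mapping.lookup m v))" for v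
  proof -
    have "Poly_Mapping.single (?s (m + m') v) (of_nat (Poly_Mapping.lookup m' v) :: 'b) =
        Poly_Mapping.single (m + ?s m' v) (of_nat (Poly_Mapping.lookup m' v))"
      by (cases "Poly_Mapping.lookup m' v > 0") (simp_all only: s, simp_all)
    moreover have "Poly_Mapping.single (?s (m + m') v) (of_nat (Poly_Mapping.lookup m v) :: 'b) =
        Poly_Mapping.single (?s m v + m') (of_nat (Poly_Mapping.lookup m v))"
      using s[of m v m']
      by (cases "Poly_Mapping.lookup m v > 0") (simp_all add: add.commute)
    ultimately show ?thesis
      by (simp add: lookup_add single_add add_ac)
  qed
  moreover have "monom_deriv i (m + m') =
      (\<Sum>v\<in>?K. Poly_Mapping.single (?s (m + m') v) (of_nat (Poly_Mapping.lookup (m + m') v) :: 'b))"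
    using keys_add[of m m'] by (intro monom_deriv_superset) auto
  ultimately show ?thesis
    by (simp add: monom_deriv_superset[of ?K m] monom_deriv_superset[of ?K m'] sum.distrib
        sum_distrib_left sum_distrib_right mult_single del: One_nat_def)
qed

lemma keys_monom_deriv:
  assumes "k \<in> Poly_Mapping.keys (monom_deriv i m :: ('a::comm_ring_1, 'd) dpoly)" "v \<in> Poly_Mapping.keys k"
  shows "\<exists>w\<in>Poly_Mapping.keys m. fst w = fst v"
proof -
  from assms(1) obtain u where u: "u \<in> Poly_Mapping.keys m"
    and k: "k = m - Poly_Mapping.single u 1 + Poly_Mapping.single (shift i u) 1"
    unfolding monom_deriv_def by (auto dest!: subsetD[OF keys_sum] split: if_splits)
  have "v \<in> Poly_Mapping.keys m \<or> v = shift i u"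
    using assms(2) unfolding k
    by (auto simp: in_keys_iff lookup_add lookup_minus lookup_single when_def split: if_splits)
  then show ?thesis using u by (auto simp: shift_def)
qed

lemma carrier_dpoly_ring:
  "carrier (dpoly_ring n) =
     {f. \<forall>m\<in>Poly_Mapping.keys f. \<forall>v\<in>Poly_Mapping.keys m. fst v \<in> {1..n}}"
  by (simp add: dpoly_ring_def)

lemma dpoly_ring_simps [simp]:
  "f \<oplus>\<^bsub>dpoly_ring n\<^esub> g = f + g" "f \<otimes>\<^bsub>dpoly_ring n\<^esub> g = f * g"
  "\<zero>\<^bsub>dpoly_ring n\<^esub> = 0" "\<one>\<^bsub>dpoly_ring n\<^esub> = 1"
  by (simp_all add: dpoly_ring_def ring_of_type_algebra_def)

lemma dpoly_add_closed:
  "f \<in> carrier (dpoly_ring n) \<Longrightarrow> g \<in> carrier (dpoly_ring n) \<Longrightarrow> f + g \<in> carrier (dpoly_ring n)"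
  using keys_add[of f g] unfolding carrier_dpoly_ring by blast

lemma dpoly_mult_closed:
  assumes "f \<in> carrier (dpoly_ring n)" "g \<in> carrier (dpoly_ring n)"
  shows "f * g \<in> carrier (dpoly_ring n)"
  unfolding carrier_dpoly_ring
proof safe
  fix m v w assume "m \<in> Poly_Mapping.keys (f * g)" and v: "(v, w) \<in> Poly_Mapping.keys m"
  then obtain a b where "m = a + b" "a \<in> Poly_Mapping.keys f" "b \<in> Poly_Mapping.keys g"
    using keys_mult[of f g] by blast
  then show "fst (v, w) \<in> {1..n}"
    using v keys_add[of a b] assms unfolding carrier_dpoly_ring by blast
qed

lemma dpoly_sum_closed:
  "(\<And>a. a \<in> A \<Longrightarrow> F a \<in> carrier (dpoly_ring n)) \<Longrightarrow> sum F A \<in> carrier (dpoly_ring n)"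
  by (induction A rule: infinite_finite_induct) (simp_all add: dpoly_add_closed, simp_all add: carrier_dpoly_ring)

lemma cring_dpoly_ring: "cring (dpoly_ring n :: ('a::comm_ring_1, 'd) dpoly ring)"
proof (intro cringI abelian_groupI comm_monoidI)
  fix f :: "('a::comm_ring_1, 'd) dpoly" assume "f \<in> carrier (dpoly_ring n)"
  then show "\<exists>g\<in>carrier (dpoly_ring n). g \<oplus>\<^bsub>dpoly_ring n\<^esub> f = \<zero>\<^bsub>dpoly_ring n\<^esub>"
    by (intro bexI[of _ "- f"]) (auto simp: carrier_dpoly_ring)
next
  show "\<zero>\<^bsub>dpoly_ring n\<^esub> \<in> carrier (dpoly_ring n)" "\<one>\<^bsub>dpoly_ring n\<^esub> \<in> carrier (dpoly_ring n)"
    by (simp_all add: carrier_dpoly_ring)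
qed (simp_all add: dpoly_add_closed dpoly_mult_closed add_ac mult_ac distrib_right distrib_left)

context
  fixes D :: "'d::finite \<Rightarrow> 'a::comm_ring_1 \<Rightarrow> 'a"
  assumes D: "differential_ring ring_of_type_algebra D"
begin

lemma D_add: "D i (x + y) = D i x + D i y"
  and D_mult: "D i (x * y) = x * D i y + D i x * y"
  and D_commute: "D i (D j x) = D j (D i x)"
  using D by (simp_all add: differential_ring_def derivation_ring_of_type_algebra)
    (simp add: ring_of_type_algebra_def)

lemma D_0: "D i 0 = 0"
  using D_add[of i 0 0] by simp

lemma D_1: "D i 1 = 0"
  using D_mult[of i 1 1] by simp

lemma dpoly_deriv_superset:
  assumes "finite M" "Poly_Mapping.keys f \<subseteq> M"
  shows "dpoly_deriv D i f = (\<Sum>m\<in>M.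
     Poly_Mapping.single m (D i (Poly_Mapping.lookup f m)) +
     Poly_Mapping.single 0 (Poly_Mapping.lookup f m) * monom_deriv i m)"
  unfolding dpoly_deriv_def using assms
  by (intro sum.mono_neutral_left) (auto simp: in_keys_iff D_0)

lemma dpoly_deriv_single:
  "dpoly_deriv D i (Poly_Mapping.single m c) =
     Poly_Mapping.single m (D i c) + Poly_Mapping.single 0 c * monom_deriv i m"
  by (subst dpoly_deriv_superset[of "{m}"]) auto

lemma dpoly_deriv_const [simp]:
  "dpoly_deriv D i (Poly_Mapping.single 0 c) = Poly_Mapping.single 0 (D i c)"
  by (simp add: dpoly_deriv_single)

lemma dpoly_deriv_var [simp]:
  "dpoly_deriv D i (Poly_Mapping.single (Poly_Mapping.single v 1) 1) =
     Poly_Mapping.single (Poly_Mapping.single (shift i v) 1) 1"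
  using monom_deriv_var[of i v] by (simp add: dpoly_deriv_single D_1 del: One_nat_def monom_deriv_var)

lemma dpoly_deriv_add: "dpoly_deriv D i (f + g) = dpoly_deriv D i f + dpoly_deriv D i g"
proof -
  let ?M = "Poly_Mapping.keys f \<union> Poly_Mapping.keys g"
  have "dpoly_deriv D i (f + g) = (\<Sum>m\<in>?M.
     Poly_Mapping.single m (D i (Poly_Mapping.lookup (f + g) m)) +
     Poly_Mapping.single 0 (Poly_Mapping.lookup (f + g) m) * monom_deriv i m)"
    using keys_add[of f g] by (intro dpoly_deriv_superset) auto
  then show ?thesis
    by (simp add: dpoly_deriv_superset[of ?M f] dpoly_deriv_superset[of ?M g] sum.distrib
        lookup_add D_add single_add algebra_simps)
qed

lemma dpoly_deriv_mult:
  "dpoly_deriv D i (f * g) = f * dpoly_deriv D i g + dpoly_deriv D i f * g"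
proof (induction f rule: poly_mapping_add_induct)
  case (1 m c)
  show ?case
  proof (induction g rule: poly_mapping_add_induct)
    case (1 m' c')
    let ?C = "Poly_Mapping.single 0 :: 'a \<Rightarrow> ('a, 'd) dpoly" and ?M = "\<lambda>m. Poly_Mapping.single m (1::'a)"
    have s: "Poly_Mapping.single m c = ?C c * ?M m" for m c
      by (simp add: mult_single)
    have C: "?C (x * y) = ?C x * ?C y" "?C (x + y) = ?C x + ?C y" for x y
      by (simp_all add: mult_single single_add)
    have M: "?M (m + m') = ?M m * ?M m'"
      by (simp add: mult_single)
    have e: "dpoly_deriv D i (Poly_Mapping.single m c) = ?C (D i c) * ?M m + ?C c * monom_deriv i m" for m c
      unfolding dpoly_deriv_single by (subst s) simp
    have "dpoly_deriv D i (Poly_Mapping.single m c * Poly_Mapping.single m' c') =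
        dpoly_deriv D i (Poly_Mapping.single (m + m') (c * c'))"
      by (simp add: mult_single)
    also have "\<dots> = ?C c * ?M m * (?C (D i c') * ?M m' + ?C c' * monom_deriv i m') +
        (?C (D i c) * ?M m + ?C c * monom_deriv i m) * (?C c' * ?M m')"
      unfolding e D_mult C M monom_deriv_add by (simp add: distrib_left distrib_right mult_ac add_ac)
    finally show ?case
      unfolding e s[of m c, symmetric] s[of m' c', symmetric] .
  next
    case (2 f g)
    then show ?case by (simp add: dpoly_deriv_add algebra_simps)
  qed
next
  case (2 f g)
  then show ?case by (simp add: dpoly_deriv_add algebra_simps)
qed

lemma dpoly_deriv_commute: "dpoly_deriv D i (dpoly_deriv D j f) = dpoly_deriv D j (dpoly_deriv D i f)"
proof -
  define P where "P = (\<lambda>f. dpoly_deriv D i (dpoly_deriv D j f) = dpoly_deriv D j (dpoly_deriv D i f))"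
  have add: "P (f + g)" if "P f" "P g" for f g
    using that by (simp add: P_def dpoly_deriv_add)
  have mult: "P (f * g)" if "P f" "P g" for f g
    using that by (simp add: P_def dpoly_deriv_add dpoly_deriv_mult algebra_simps)
  have const: "P (Poly_Mapping.single 0 c)" for c
    by (simp add: P_def D_commute)
  have var: "P (Poly_Mapping.single (Poly_Mapping.single v 1) 1)" for v
    by (cases "i = j")
       (auto simp: P_def shift_def fun_upd_twist simp del: One_nat_def)
  have monom: "P (Poly_Mapping.single m 1)" for m
  proof (induction m rule: poly_mapping_add_induct)
    case (1 v k)
    show ?case
    proof (induction k)
      case 0
      then show ?case using const[of 1] by simp
    next
      case (Suc k)
      have "Poly_Mapping.single (Poly_Mapping.single v (Suc k)) (1::'a) =
          Poly_Mapping.single (Poly_Mapping.single v 1) 1 * Poly_Mapping.single (Poly_Mapping.single v k) 1"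
        by (simp add: mult_single single_add[symmetric])
      then show ?case using mult[OF var Suc] by simp
    qed
  next
    case (2 m m')
    then show ?case using mult[OF 2] by (simp add: mult_single)
  qed
  have "P f"
  proof (induction f rule: poly_mapping_add_induct)
    case (1 m c)
    then show ?case using mult[OF const[of c] monom[of m]] by (simp add: mult_single)
  qed (rule add)
  then show ?thesis by (simp add: P_def)
qed

lemma dpoly_deriv_closed:
  assumes "f \<in> carrier (dpoly_ring n)"
  shows "dpoly_deriv D i f \<in> carrier (dpoly_ring n)"
  unfolding dpoly_deriv_def
proof (intro dpoly_sum_closed dpoly_add_closed dpoly_mult_closed)
  fix m assume m: "m \<in> Poly_Mapping.keys f"
  show "Poly_Mapping.single m (D i (Poly_Mapping.lookup f m)) \<in> carrier (dpoly_ring n)"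
    using assms m by (auto simp: carrier_dpoly_ring)
  show "Poly_Mapping.single 0 (Poly_Mapping.lookup f m) \<in> carrier (dpoly_ring n)"
    by (auto simp: carrier_dpoly_ring)
  show "(monom_deriv i m :: ('a, 'd) dpoly) \<in> carrier (dpoly_ring n)"
    unfolding carrier_dpoly_ring
  proof safe
    fix k v w assume "k \<in> Poly_Mapping.keys (monom_deriv i m :: ('a, 'd) dpoly)" "(v, w) \<in> Poly_Mapping.keys k"
    then obtain u where "u \<in> Poly_Mapping.keys m" "fst u = fst (v, w)"
      by (meson keys_monom_deriv)
    then show "fst (v, w) \<in> {1..n}"
      using assms m unfolding carrier_dpoly_ring by force
  qed
qed

lemma differential_ring_dpoly_ring: "differential_ring (dpoly_ring n) (dpoly_deriv D)"
  by (auto simp: differential_ring_def derivation_def cring_dpoly_ring dpoly_deriv_closed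
      dpoly_deriv_add dpoly_deriv_mult dpoly_deriv_commute)

end

definition dpoly_ext :: "nat \<Rightarrow> 'a set \<Rightarrow> ('a::comm_ring_1, 'd) dpoly set" where
  "dpoly_ext n I = {f \<in> carrier (dpoly_ring n). \<forall>m. Poly_Mapping.lookup f m \<in> I}"

definition contraction :: "('a::comm_ring_1, 'd) dpoly set \<Rightarrow> 'a set" where
  "contraction P = {c. Poly_Mapping.single 0 c \<in> P}"

definition diff_upper ::
    "nat \<Rightarrow> ('d::finite \<Rightarrow> 'a \<Rightarrow> 'a) \<Rightarrow> ('a::comm_ring_1, 'd) dpoly set \<Rightarrow> 'a set \<Rightarrow> bool" where
  "diff_upper n D P Q \<longleftrightarrow>
     P \<in> diff_spec (dpoly_ring n) (dpoly_deriv D) \<and>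
     Q \<in> diff_spec ring_of_type_algebra D \<and>
     contraction P = Q \<and> P \<noteq> dpoly_ext n Q"

definition property_S3 :: "('d::finite \<Rightarrow> 'a::comm_ring_1 \<Rightarrow> 'a) \<Rightarrow> bool" where
  "property_S3 D \<longleftrightarrow>
     (\<forall>n>0. \<forall>Q1\<in>diff_spec ring_of_type_algebra D. \<forall>Q2\<in>diff_spec ring_of_type_algebra D.
        Q1 \<subset> Q2 \<longrightarrow>
        \<not> (\<exists>P\<in>diff_spec (dpoly_ring n) (dpoly_deriv D).
             diff_upper n D P Q1 \<and> P \<subset> dpoly_ext n Q2))"


section \<open>Gap measure, differential type and differential dimension\<close>

definition desc_chain :: "'a set set \<Rightarrow> 'a set \<Rightarrow> 'a set \<Rightarrow> (nat \<Rightarrow> 'a set) \<Rightarrow> bool" where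
  "desc_chain S P P' c \<longleftrightarrow>
     c 0 = P \<and> (\<forall>i. c i \<in> S \<and> c (Suc i) \<subset> c i \<and> P' \<subseteq> c i)"

text \<open>Nonnegativity is built into the type \<^typ>\<open>enat\<close>. Values of \<open>\<mu>\<close> at pairs that are not
  of the form \<open>P \<supseteq> P'\<close> with both members in \<open>S\<close> are irrelevant; on those that are,
  \<open>\<mu>\<close> exists and is unique (lemmas \<open>gap_measure\<close> and \<open>is_gap_measure_unique\<close>).\<close>

definition is_gap_measure :: "'a set set \<Rightarrow> ('a set \<Rightarrow> 'a set \<Rightarrow> enat) \<Rightarrow> bool" where
  "is_gap_measure S \<mu> \<longleftrightarrow>
     (\<forall>P\<in>S. \<forall>P'\<in>S. P' \<subseteq> P \<longrightarrow>
        (\<mu> P P' = 0 \<longleftrightarrow> P = P' \<or> \<not> (\<exists>c. desc_chain S P P' c)) \<and>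
        (\<forall>d::nat. d > 0 \<longrightarrow>
           (\<mu> P P' \<ge> enat d \<longleftrightarrow>
              P \<noteq> P' \<and>
              (\<exists>c. desc_chain S P P' c \<and> (\<forall>i. \<mu> (c i) (c (Suc i)) \<ge> enat (d - 1))))))"

definition gap_measure :: "'a set set \<Rightarrow> 'a set \<Rightarrow> 'a set \<Rightarrow> enat" where
  "gap_measure S = (SOME \<mu>. is_gap_measure S \<mu>)"

lemma enat_eqI_ge:
  assumes "\<And>d. x \<ge> enat d \<longleftrightarrow> y \<ge> enat d"
  shows "x = y"
proof (cases x)
  case (enat a)
  with assms[of a] assms[of "Suc a"] show ?thesis by (cases y) auto
next
  case infinity
  show ?thesis
  proof (cases y)
    case (enat b)
    with infinity assms[of "Suc b"] show ?thesis by auto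
  qed (use infinity in simp)
qed

lemma is_gap_measure_unique:
  assumes "is_gap_measure S \<mu>" "is_gap_measure S \<nu>" "P \<in> S" "P' \<in> S" "P' \<subseteq> P"
  shows "\<mu> P P' = \<nu> P P'"
proof -
  have step: "\<mu> P P' \<ge> enat d \<longleftrightarrow> \<nu> P P' \<ge> enat d" if "P \<in> S" "P' \<in> S" "P' \<subseteq> P" for d P P'
    using that
  proof (induction d arbitrary: P P')
    case 0
    then show ?case by (simp add: zero_enat_def[symmetric])
  next
    case (Suc d)
    have "\<mu> (c i) (c (Suc i)) \<ge> enat d \<longleftrightarrow> \<nu> (c i) (c (Suc i)) \<ge> enat d"
      if "desc_chain S P P' c" for c i
      using that by (intro Suc.IH) (auto simp: desc_chain_def)
    then have "(\<exists>c. desc_chain S P P' c \<and> (\<forall>i. \<mu> (c i) (c (Suc i)) \<ge> enat d)) \<longleftrightarrow>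
               (\<exists>c. desc_chain S P P' c \<and> (\<forall>i. \<nu> (c i) (c (Suc i)) \<ge> enat d))"
      by blast
    then show ?case
      using assms(1,2) Suc.prems unfolding is_gap_measure_def
      by (metis diff_Suc_1 zero_less_Suc)
  qed
  show ?thesis
    using step[OF assms(3-5)] by (rule enat_eqI_ge)
qed

primrec gap_ge :: "'a set set \<Rightarrow> nat \<Rightarrow> 'a set \<Rightarrow> 'a set \<Rightarrow> bool" where
  "gap_ge S 0 P P' \<longleftrightarrow> True"
| "gap_ge S (Suc d) P P' \<longleftrightarrow>
     P \<noteq> P' \<and> (\<exists>c. desc_chain S P P' c \<and> (\<forall>i. gap_ge S d (c i) (c (Suc i))))"

lemma gap_ge_mono: "d \<le> e \<Longrightarrow> gap_ge S e P P' \<Longrightarrow> gap_ge S d P P'"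
proof (induction d arbitrary: e P P')
  case (Suc d)
  then obtain e' where "e = Suc e'" "d \<le> e'" by (cases e) auto
  with Suc show ?case by (simp, meson)
qed simp

lemma ex_gap_measure: "\<exists>\<mu>. is_gap_measure S \<mu>"
proof -
  define \<mu> where "\<mu> P P' = (SUP d\<in>{d. gap_ge S d P P'}. enat d)" for P P'
  have ge: "\<mu> P P' \<ge> enat d \<longleftrightarrow> gap_ge S d P P'" for P P' d
  proof
    assume *: "\<mu> P P' \<ge> enat d"
    show "gap_ge S d P P'"
    proof (rule ccontr)
      assume n: "\<not> gap_ge S d P P'"
      then have "d > 0" by (cases d) auto
      have "e \<le> d - 1" if "gap_ge S e P P'" for e
        using n gap_ge_mono[OF _ that, of d] by (cases "d \<le> e") auto
      then have "\<mu> P P' \<le> enat (d - 1)"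
        unfolding \<mu>_def by (intro SUP_least) auto
      with * \<open>d > 0\<close> show False by (auto dest: order_trans)
    qed
  next
    assume "gap_ge S d P P'"
    then show "\<mu> P P' \<ge> enat d" unfolding \<mu>_def by (intro SUP_upper) auto
  qed
  have "\<mu> P P' = 0 \<longleftrightarrow> \<not> gap_ge S 1 P P'" for P P'
    unfolding ge[symmetric] by (cases "\<mu> P P'") (auto simp: zero_enat_def)
  then have "is_gap_measure S \<mu>"
    unfolding is_gap_measure_def ge
  proof (intro ballI impI conjI allI)
    fix P P' and d :: nat assume "d > 0"
    then obtain e where "d = Suc e" using gr0_conv_Suc by blast
    then show "gap_ge S d P P' \<longleftrightarrow> P \<noteq> P' \<and>
        (\<exists>c. desc_chain S P P' c \<and> (\<forall>i. gap_ge S (d - 1) (c i) (c (Suc i))))"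
      by simp
  qed simp
  then show ?thesis by blast
qed

lemma gap_measure: "is_gap_measure S (gap_measure S)"
  unfolding gap_measure_def using ex_gap_measure by (rule someI_ex)

definition diff_type :: "('a, 'b) ring_scheme \<Rightarrow> ('d::finite \<Rightarrow> 'a \<Rightarrow> 'a) \<Rightarrow> enat" where
  "diff_type R D =
     Sup {gap_measure (diff_spec R D) P P' | P P'.
            P \<in> diff_spec R D \<and> P' \<in> diff_spec R D \<and> P' \<subseteq> P}"

definition diff_dim :: "('a, 'b) ring_scheme \<Rightarrow> ('d::finite \<Rightarrow> 'a \<Rightarrow> 'a) \<Rightarrow> enat" where
  "diff_dim R D =
     Sup {enat k | k. \<exists>c :: nat \<Rightarrow> 'a set.
            (\<forall>i\<le>k. c i \<in> diff_spec R D) \<and>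
            (\<forall>i<k. c (Suc i) \<subset> c i \<and>
                   gap_measure (diff_spec R D) (c i) (c (Suc i)) = diff_type R D)}"


section \<open>J-rings\<close>

definition J_ring :: "('d::finite \<Rightarrow> 'a::comm_ring_1 \<Rightarrow> 'a) \<Rightarrow> bool" where
  "J_ring D \<longleftrightarrow>
     (let R = ring_of_type_algebra;
          m = enat CARD('d);
          t = diff_type R D
      in differential_ring R D \<and> diff_spec R D \<noteq> {} \<and> t \<noteq> \<infinity> \<and>
         (\<forall>n>0.
            diff_type (dpoly_ring n) (dpoly_deriv D) = max t m \<and>
            (t < m \<longrightarrow> diff_dim (dpoly_ring n) (dpoly_deriv D) = enat n) \<and>
            (t = m \<longrightarrow> diff_dim R D \<noteq> \<infinity> \<and>
               diff_dim (dpoly_ring n) (dpoly_deriv D) = enat n + diff_dim R D) \<and>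
            (t > m \<longrightarrow> diff_dim R D \<noteq> \<infinity> \<and>
               diff_dim (dpoly_ring n) (dpoly_deriv D) = diff_dim R D)))"

end

theory Submission
  imports Defs
begin

text \<open>
  Write \<open>S = R{z\<^sub>1,\<dots>,z\<^sub>n}\<close> and \<open>q\<close> for the contraction to \<open>R\<close> of a differential prime \<open>P\<close> of
  \<open>S\<close>. The differential transcendence degree of \<open>P\<close> is the largest number of indeterminates that
  are differentially independent modulo \<open>P\<close> over \<open>R/q\<close>. It lies between \<open>0\<close> and \<open>n\<close>. By
  property S3, independence modulo \<open>P\<close> implies independence modulo every smaller \<open>P'\<close>, even if
  \<open>P'\<close> has a smaller contraction (\<open>diff_indep_antimono\<close>). So the degree can
  only grow when one descends in the differential spectrum of \<open>S\<close>, and it grows at most \<open>n\<close> times.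

  The heart of the proof is that an infinite strictly descending chain in \<open>S\<close> from \<open>P\<close> to \<open>P'\<close>
  forces the degree to grow or the contractions to form such a chain in \<open>R\<close>
  (\<open>ex_desc_chain_contraction\<close>). Otherwise there is an infinite chain over one and the same \<open>q\<close>
  whose members and whose intersection have the same degree. With \<open>T\<close> a maximal independent set
  of indeterminates, every other \<open>z\<^sub>j\<close> is differentially algebraic over \<open>T\<close> modulo the
  intersection. With only one derivation and in characteristic zero, the derivatives of \<open>z\<^sub>j\<close> from
  the order of such a relation on are algebraic over lower ones
  (\<open>algebraic_mod_above_relation_order\<close>). So only finitely many variables outside \<open>T\<close> can be
  transcendental over the preceding variables modulo a member of the chain. On the other hand the
  set of these transcendental variables distinguishes any two members of the chain
  (\<open>eq_if_same_transcendental_vars\<close>), so the chain is finite after all. This replaces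
  dimension polynomials and the theory of transcendence degrees.

  Iterating this, a gap measure \<open>d \<ge> 2\<close> in \<open>S\<close> forces one in \<open>R\<close>, and a gap measure \<open>1\<close> in
  \<open>S\<close> forces one in \<open>R\<close> or an increase of the degree (\<open>gap_ge_contraction\<close>). This bounds type
  and dimension of \<open>S\<close> from above. The lower bounds come from the extensions to \<open>S\<close> of chains in
  \<open>R\<close>, which keep their gaps, and from the primes generated by \<open>q\<close> and derivatives of
  indeterminates (\<open>ex_gap_chain_dpoly\<close>).
\<close>

section \<open>Gaps in families of sets\<close>

lemma gap_measure_ge_iff_gap_ge:
  assumes "P \<in> S" "P' \<in> S" "P' \<subseteq> P"
  shows "enat d \<le> gap_measure S P P' \<longleftrightarrow> gap_ge S d P P'"
  using assms
proof (induction d arbitrary: P P')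
  case 0
  then show ?case by (simp add: zero_enat_def[symmetric])
next
  case (Suc d)
  have "(enat d \<le> gap_measure S (c i) (c (Suc i))) = gap_ge S d (c i) (c (Suc i))"
    if "desc_chain S P P' c" for c i
    using that by (intro Suc.IH) (auto simp: desc_chain_def)
  moreover have "enat (Suc d) \<le> gap_measure S P P' \<longleftrightarrow> P \<noteq> P' \<and>
      (\<exists>c. desc_chain S P P' c \<and> (\<forall>i. enat d \<le> gap_measure S (c i) (c (Suc i))))"
    using gap_measure[of S] Suc.prems unfolding is_gap_measure_def
    by (metis diff_Suc_1 zero_less_Suc)
  ultimately show ?case
    by (simp, blast)
qed

lemma desc_chain_ne: "desc_chain S P P' c \<Longrightarrow> P \<noteq> P'"
  unfolding desc_chain_def by (metis psubsetE)

text \<open>Putting \<open>Q\<close> in place of the first member of a chain lengthens only the first step, whose gap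
  remains large by induction.\<close>

lemma gap_ge_extend_top:
  assumes "gap_ge S d P P'" "P \<subseteq> Q" "Q \<in> S"
  shows "gap_ge S d Q P'"
  using assms
proof (induction d arbitrary: P P' Q)
  case (Suc d)
  then obtain c where c: "desc_chain S P P' c" "\<And>i. gap_ge S d (c i) (c (Suc i))"
    by auto
  define e where "e i = (if i = 0 then Q else c i)" for i
  have "c (Suc 0) \<subset> Q"
    using c(1) Suc.prems(2) unfolding desc_chain_def by (metis psubset_subset_trans)
  moreover have "P' \<subseteq> Q"
    using c(1) Suc.prems(2) unfolding desc_chain_def by blast
  ultimately have e: "desc_chain S Q P' e"
    using c(1) Suc.prems(3) unfolding desc_chain_def e_def by auto
  have "gap_ge S d (e i) (e (Suc i))" for i
  proof (cases i)
    case 0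
    have "gap_ge S d P (c (Suc 0))"
      using c unfolding desc_chain_def by metis
    then show ?thesis
      using Suc.IH[OF _ Suc.prems(2,3)] by (simp add: 0 e_def)
  qed (use c(2) in \<open>simp add: e_def\<close>)
  then show ?case
    using e desc_chain_ne[OF e] by auto
qed simp

lemma gap_ge_Suc_imp_psubset: "gap_ge S (Suc d) P P' \<Longrightarrow> P' \<subset> P"
  unfolding gap_ge.simps desc_chain_def by blast

lemma gap_ge_1_iff: "gap_ge S 1 P P' \<longleftrightarrow> (\<exists>c. desc_chain S P P' c)"
  using desc_chain_ne[of S P P'] by auto

text \<open>Omitting the repetitions from a weakly descending sequence that never becomes constant
  leaves a strictly descending one.\<close>

lemma ex_desc_chain_of_not_eventually_const:
  fixes c :: "nat \<Rightarrow> 'a set"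
  assumes in_S: "\<And>i. c i \<in> S" and anti: "\<And>i. c (Suc i) \<subseteq> c i" and lower: "\<And>i. P' \<subseteq> c i"
    and ne: "\<And>N. \<exists>i\<ge>N. c i \<noteq> c N"
  shows "\<exists>e. desc_chain S (c 0) P' e"
proof -
  have dec: "c j \<subseteq> c i" if "i \<le> j" for i j
    using lift_Suc_antimono_le[of c, OF anti that] by simp
  have "\<exists>j. c j \<subset> c i" for i
    using ne[of i] dec by blast
  then obtain s where s: "c (s i) \<subset> c i" for i
    by metis
  define e where "e i = c ((s ^^ i) 0)" for i
  have "desc_chain S (c 0) P' e"
    unfolding desc_chain_def e_def using in_S lower s by simp
  then show ?thesis by blast
qed


section \<open>Differential type and dimension through gaps\<close>

text \<open>A chain as in the definition of the differential dimension, with gaps at least \<open>g\<close> instead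
  of gaps equal to the type; for \<open>g\<close> the type itself, this is the same.\<close>

definition gap_chain :: "'a set set \<Rightarrow> nat \<Rightarrow> nat \<Rightarrow> (nat \<Rightarrow> 'a set) \<Rightarrow> bool" where
  "gap_chain S g k c \<longleftrightarrow>
     (\<forall>i\<le>k. c i \<in> S) \<and> (\<forall>i<k. c (Suc i) \<subset> c i \<and> gap_ge S g (c i) (c (Suc i)))"

lemma diff_type_le_iff:
  "diff_type R D \<le> enat t \<longleftrightarrow>
     (\<forall>P\<in>diff_spec R D. \<forall>P'\<in>diff_spec R D. P' \<subseteq> P \<longrightarrow> \<not> gap_ge (diff_spec R D) (Suc t) P P')"
proof -
  have "gap_measure (diff_spec R D) P P' \<le> enat t \<longleftrightarrow> \<not> gap_ge (diff_spec R D) (Suc t) P P'"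
    if "P \<in> diff_spec R D" "P' \<in> diff_spec R D" "P' \<subseteq> P" for P P'
    using gap_measure_ge_iff_gap_ge[OF that, of "Suc t"] by (metis Suc_ile_eq not_le)
  then show ?thesis
    unfolding diff_type_def Sup_le_iff by blast
qed

lemma diff_type_geI:
  assumes "P \<in> diff_spec R D" "P' \<in> diff_spec R D" "P' \<subseteq> P" "gap_ge (diff_spec R D) d P P'"
  shows "enat d \<le> diff_type R D"
proof -
  have "enat d \<le> gap_measure (diff_spec R D) P P'"
    using gap_measure_ge_iff_gap_ge[OF assms(1-3)] assms(4) by blast
  also have "\<dots> \<le> diff_type R D"
    unfolding diff_type_def using assms(1-3) by (intro Sup_upper) blast
  finally show ?thesis .
qed

lemma diff_type_geE:
  assumes "enat d \<le> diff_type R D" "diff_spec R D \<noteq> {}"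
  obtains P P' where "P \<in> diff_spec R D" "P' \<in> diff_spec R D" "P' \<subseteq> P"
    "gap_ge (diff_spec R D) d P P'"
proof (cases d)
  case 0
  then show ?thesis using assms(2) that by auto
next
  case (Suc e)
  then have "\<not> diff_type R D \<le> enat e"
    using assms(1) by (metis Suc_ile_eq not_le)
  then show ?thesis
    using that Suc unfolding diff_type_le_iff by blast
qed

lemma diff_dim_eq_gap_chain:
  assumes "diff_type R D = enat t"
  shows "diff_dim R D = Sup {enat k | k. \<exists>c. gap_chain (diff_spec R D) t k c}"
proof -
  have "gap_measure (diff_spec R D) P P' = enat t \<longleftrightarrow> gap_ge (diff_spec R D) t P P'"
    if "P \<in> diff_spec R D" "P' \<in> diff_spec R D" "P' \<subseteq> P" for P P'
  proof -
    have "gap_measure (diff_spec R D) P P' \<le> enat t"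
      unfolding assms[symmetric] diff_type_def using that by (intro Sup_upper) blast
    then show ?thesis
      using gap_measure_ge_iff_gap_ge[OF that, of t] by auto
  qed
  then have "(\<forall>i\<le>k. c i \<in> diff_spec R D) \<and> (\<forall>i<k. c (Suc i) \<subset> c i \<and>
        gap_measure (diff_spec R D) (c i) (c (Suc i)) = diff_type R D) \<longleftrightarrow>
      gap_chain (diff_spec R D) t k c" for k c
    unfolding gap_chain_def assms by (metis Suc_leI order.strict_implies_order psubsetE)
  then show ?thesis
    unfolding diff_dim_def by simp
qed

lemma gap_chain_le_diff_dim:
  assumes "diff_type R D = enat t" "gap_chain (diff_spec R D) t k c"
  shows "enat k \<le> diff_dim R D"
  unfolding diff_dim_eq_gap_chain[OF assms(1)] using assms(2) by (intro Sup_upper) blast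

lemma diff_dim_le:
  assumes "diff_type R D = enat t" "\<And>k c. gap_chain (diff_spec R D) t k c \<Longrightarrow> enat k \<le> b"
  shows "diff_dim R D \<le> b"
  unfolding diff_dim_eq_gap_chain[OF assms(1)] using assms(2) by (intro Sup_least) blast

lemma diff_dim_attained:
  assumes "diff_type R D = enat t" "diff_dim R D = enat k" "diff_spec R D \<noteq> {}"
  obtains c where "gap_chain (diff_spec R D) t k c"
proof -
  let ?A = "{enat k | k. \<exists>c. gap_chain (diff_spec R D) t k c}"
  obtain P where "P \<in> diff_spec R D" using assms(3) by blast
  then have "gap_chain (diff_spec R D) t 0 (\<lambda>_. P)"
    by (simp add: gap_chain_def)
  then have ne: "?A \<noteq> {}" by blast
  have S: "Sup ?A = enat k"
    using assms(2) diff_dim_eq_gap_chain[OF assms(1)] by simp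
  have "x \<le> enat k" if "x \<in> ?A" for x
    using Sup_upper[OF that] S by simp
  then have "finite ?A"
    by (intro finite_enat_bounded) auto
  then have "Sup ?A \<in> ?A"
    using ne by (simp add: Sup_enat_def Max_in del: mem_Collect_eq)
  then show ?thesis
    using that unfolding S by auto
qed


section \<open>Prime ideals and algebraic dependence in subrings\<close>

text \<open>Subrings of a ring type are mere sets here, because primes are compared on many subrings of
  one differential polynomial ring at the same time.\<close>

definition subring_set :: "'r::comm_ring_1 set \<Rightarrow> bool" where
  "subring_set B \<longleftrightarrow> 1 \<in> B \<and> (\<forall>x\<in>B. \<forall>y\<in>B. x - y \<in> B \<and> x * y \<in> B)"

lemma subring_setD:
  assumes "subring_set B"
  shows "0 \<in> B" "1 \<in> B" "x \<in> B \<Longrightarrow> y \<in> B \<Longrightarrow> x + y \<in> B" "x \<in> B \<Longrightarrow> y \<in> B \<Longrightarrow> x * y \<in> B"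
    "x \<in> B \<Longrightarrow> - x \<in> B" "x \<in> B \<Longrightarrow> y \<in> B \<Longrightarrow> x - y \<in> B"
proof -
  show one: "1 \<in> B" and diff: "x \<in> B \<Longrightarrow> y \<in> B \<Longrightarrow> x - y \<in> B" for x y
    using assms by (auto simp: subring_set_def)
  show zero: "0 \<in> B" using diff[OF one one] by simp
  show minus: "x \<in> B \<Longrightarrow> - x \<in> B" for x using diff[OF zero, of x] by simp
  show "x \<in> B \<Longrightarrow> y \<in> B \<Longrightarrow> x + y \<in> B" using diff[OF _ minus, of x y] by simp
  show "x \<in> B \<Longrightarrow> y \<in> B \<Longrightarrow> x * y \<in> B" using assms by (auto simp: subring_set_def)
qed

lemma subring_set_power: "subring_set B \<Longrightarrow> x \<in> B \<Longrightarrow> x ^ k \<in> B"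
  by (induction k) (auto simp: subring_setD)

lemma subring_set_of_nat: "subring_set B \<Longrightarrow> of_nat k \<in> B"
  by (induction k) (auto simp: subring_setD)

lemma subring_set_sum: "subring_set B \<Longrightarrow> (\<And>i. i \<in> I \<Longrightarrow> f i \<in> B) \<Longrightarrow> sum f I \<in> B"
  by (induction I rule: infinite_finite_induct) (auto simp: subring_setD)

definition prime_in :: "'r::comm_ring_1 set \<Rightarrow> 'r set \<Rightarrow> bool" where
  "prime_in C P \<longleftrightarrow>
     P \<subseteq> C \<and> 0 \<in> P \<and> 1 \<notin> P \<and> (\<forall>x\<in>P. \<forall>y\<in>P. x + y \<in> P) \<and> (\<forall>x\<in>C. \<forall>y\<in>P. x * y \<in> P) \<and>
     (\<forall>x\<in>C. \<forall>y\<in>C. x * y \<in> P \<longrightarrow> x \<in> P \<or> y \<in> P)"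

lemma prime_inD:
  assumes "prime_in C P"
  shows "x \<in> P \<Longrightarrow> x \<in> C" "0 \<in> P" "1 \<notin> P" "x \<in> P \<Longrightarrow> y \<in> P \<Longrightarrow> x + y \<in> P"
    "x \<in> C \<Longrightarrow> y \<in> P \<Longrightarrow> x * y \<in> P" "x \<in> P \<Longrightarrow> y \<in> C \<Longrightarrow> x * y \<in> P"
    "x \<in> C \<Longrightarrow> y \<in> C \<Longrightarrow> x * y \<in> P \<Longrightarrow> x \<in> P \<or> y \<in> P"
  using assms unfolding prime_in_def by (auto simp: mult.commute)

lemma prime_in_uminus: "subring_set C \<Longrightarrow> prime_in C P \<Longrightarrow> x \<in> P \<Longrightarrow> - x \<in> P"
  using prime_inD(5)[of C P "-1" x] by (simp add: subring_setD)

lemma prime_in_diff: "subring_set C \<Longrightarrow> prime_in C P \<Longrightarrow> x \<in> P \<Longrightarrow> y \<in> P \<Longrightarrow> x - y \<in> P"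
  using prime_inD(4)[of C P x "- y"] prime_in_uminus[of C P y] by simp

lemma prime_in_sum: "prime_in C P \<Longrightarrow> (\<And>i. i \<in> I \<Longrightarrow> f i \<in> P) \<Longrightarrow> sum f I \<in> P"
  by (induction I rule: infinite_finite_induct) (auto simp: prime_inD)

lemma prime_in_power:
  assumes "subring_set C" "prime_in C P" "x \<in> C" "x ^ k \<in> P"
  shows "x \<in> P"
  using assms(4)
proof (induction k)
  case (Suc k)
  then show ?case
    using prime_inD(7)[OF assms(2,3) subring_set_power[OF assms(1,3)]] by auto
qed (use prime_inD(3)[OF assms(2)] in auto)

lemma primeideal_iff_prime_in:
  assumes "subring_set C"
  shows "primeideal P (ring_of_type_algebra\<lparr>carrier := C\<rparr>) \<longleftrightarrow> prime_in C P"
proof -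
  let ?R = "ring_of_type_algebra\<lparr>carrier := C\<rparr>"
  note C = subring_setD[OF assms]
  interpret cring ?R
  proof (intro cringI abelian_groupI comm_monoidI)
    fix x assume "x \<in> carrier ?R"
    then show "\<exists>y\<in>carrier ?R. y \<oplus>\<^bsub>?R\<^esub> x = \<zero>\<^bsub>?R\<^esub>"
      by (intro bexI[of _ "- x"]) (auto simp: ring_of_type_algebra_def C)
  qed (auto simp: ring_of_type_algebra_def C algebra_simps)
  have inv: "inv\<^bsub>add_monoid ?R\<^esub> x = - x" if "x \<in> C" for x
  proof -
    have "\<ominus>\<^bsub>?R\<^esub> x = - x"
      using that by (intro minus_equality) (auto simp: ring_of_type_algebra_def C)
    then show ?thesis by (simp only: a_inv_def)
  qed
  show ?thesis
  proof
    assume "primeideal P ?R"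
    then interpret primeideal P ?R .
    show "prime_in C P"
      unfolding prime_in_def
    proof (intro conjI ballI impI)
      show "P \<subseteq> C" using a_subset by (simp add: ring_of_type_algebra_def)
      show "0 \<in> P" using additive_subgroup.zero_closed[OF additive_subgroup_axioms] by (simp add: ring_of_type_algebra_def)
      show "1 \<notin> P" using one_imp_carrier I_notcarr by (auto simp: ring_of_type_algebra_def)
      show "x + y \<in> P" if "x \<in> P" "y \<in> P" for x y using a_closed[OF that] by (simp add: ring_of_type_algebra_def)
      show "x * y \<in> P" if "x \<in> C" "y \<in> P" for x y using I_l_closed[of y x] that by (simp add: ring_of_type_algebra_def)
      show "x \<in> P \<or> y \<in> P" if "x \<in> C" "y \<in> C" "x * y \<in> P" for x y
        using I_prime[of x y] that by (simp add: ring_of_type_algebra_def)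
    qed
  next
    assume P: "prime_in C P"
    note D = prime_inD[OF P]
    have m: "- x \<in> P" if "x \<in> P" for x using prime_in_uminus[OF assms P that] .
    show "primeideal P ?R"
    proof (rule primeidealI[OF idealI])
      show "ring ?R" "cring ?R" by unfold_locales
      show "subgroup P (add_monoid ?R)"
        using inv m D by unfold_locales (auto simp: ring_of_type_algebra_def)
      show "carrier ?R \<noteq> P" using D(3) C(2) by (auto simp: ring_of_type_algebra_def)
    qed (use D in \<open>auto simp: ring_of_type_algebra_def\<close>)
  qed
qed

abbreviation (input) "cf \<equiv> Polynomial.coeff"
abbreviation (input) "dg \<equiv> Polynomial.degree"

definition coeffs_in :: "'r::comm_ring_1 set \<Rightarrow> 'r poly \<Rightarrow> bool" where
  "coeffs_in B g \<longleftrightarrow> (\<forall>k. cf g k \<in> B)"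

context
  fixes B :: "'r::comm_ring_1 set"
  assumes B: "subring_set B"
begin

lemma coeffs_in_diff: "coeffs_in B g \<Longrightarrow> coeffs_in B h \<Longrightarrow> coeffs_in B (g - h)"
  and coeffs_in_add: "coeffs_in B g \<Longrightarrow> coeffs_in B h \<Longrightarrow> coeffs_in B (g + h)"
  and coeffs_in_mult: "coeffs_in B g \<Longrightarrow> coeffs_in B h \<Longrightarrow> coeffs_in B (g * h)"
  and coeffs_in_smult: "c \<in> B \<Longrightarrow> coeffs_in B g \<Longrightarrow> coeffs_in B (Polynomial.smult c g)"
  and coeffs_in_monom: "c \<in> B \<Longrightarrow> coeffs_in B (Polynomial.monom c k)"
  and coeffs_in_sum: "(\<And>i. i \<in> I \<Longrightarrow> coeffs_in B (F i)) \<Longrightarrow> coeffs_in B (sum F I)"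
  and coeffs_in_0: "coeffs_in B 0"
  by (auto simp: coeffs_in_def subring_setD[OF B] coeff_mult Polynomial.coeff_sum
      intro!: subring_set_sum[OF B])

lemma poly_closed:
  assumes "coeffs_in B g" "B \<subseteq> C" "subring_set C" "x \<in> C"
  shows "poly g x \<in> C"
  unfolding poly_altdef using assms
  by (intro subring_set_sum subring_setD(4) subring_set_power) (auto simp: coeffs_in_def)

lemma degree_drop_lead:
  assumes "dg g > 0"
  shows "dg (g - Polynomial.monom (cf g (dg g)) (dg g)) < dg g"
  using assms by (intro degree_lessI) (auto simp: coeff_eq_0)

text \<open>Division with remainder that stays over the subring \<open>B\<close>, at the cost of a power of the leading
  coefficient of the divisor.\<close>

lemma pseudo_division:
  assumes h: "coeffs_in B h" "dg h > 0" and g: "coeffs_in B g"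
  shows "\<exists>k s r. coeffs_in B s \<and> coeffs_in B r \<and> Polynomial.smult (cf h (dg h) ^ k) g = s * h + r \<and>
           dg s \<le> dg g - dg h \<and> dg r < dg h"
  using g
proof (induction "dg g" arbitrary: g rule: less_induct)
  case less
  let ?c = "cf h (dg h)"
  have c: "?c \<in> B" using h by (simp add: coeffs_in_def)
  show ?case
  proof (cases "dg g < dg h")
    case True
    then show ?thesis
      using less.prems coeffs_in_0 by (intro exI[of _ 0] exI[of _ g]) auto
  next
    case False
    define e where "e = dg g - dg h"
    define m where "m = Polynomial.monom (cf g (dg g)) e"
    define g1 where "g1 = Polynomial.smult ?c g - m * h"
    have m: "coeffs_in B m"
      using less.prems by (auto simp: m_def coeffs_in_def subring_setD[OF B])
    have g1: "coeffs_in B g1"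
      unfolding g1_def by (intro coeffs_in_diff coeffs_in_smult coeffs_in_mult c m h less.prems)
    have "cf g1 k = 0" if "k \<ge> dg g" for k
    proof (cases "k = dg g")
      case True
      then show ?thesis
        using False h(2) by (simp add: g1_def m_def e_def coeff_monom_mult)
    next
      case k: False
      have "k - e > dg h" using that k False h(2) unfolding e_def by linarith
      then show ?thesis
        using that k by (simp add: g1_def m_def coeff_monom_mult coeff_eq_0)
    qed
    then have dg1: "dg g1 < dg g"
      using False h(2) by (intro degree_lessI) auto
    obtain k s r where s: "coeffs_in B s" "coeffs_in B r" "Polynomial.smult (?c ^ k) g1 = s * h + r"
        "dg s \<le> dg g1 - dg h" "dg r < dg h"
      using less.hyps[OF dg1 g1] by blast
    define s' where "s' = s + Polynomial.smult (?c ^ k) m"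
    have "Polynomial.smult (?c ^ Suc k) g = Polynomial.smult (?c ^ k) (g1 + m * h)"
      by (simp add: g1_def mult.commute)
    also have "\<dots> = s' * h + r"
      by (simp add: smult_add_right s(3) s'_def algebra_simps)
    finally have eq: "Polynomial.smult (?c ^ Suc k) g = s' * h + r" .
    have "coeffs_in B s'"
      unfolding s'_def by (intro coeffs_in_add coeffs_in_smult s m subring_set_power[OF B] c)
    moreover have "dg s' \<le> e"
      unfolding s'_def
    proof (rule degree_add_le)
      show "dg s \<le> e" using s(4) dg1 by (simp add: e_def)
      show "dg (Polynomial.smult (?c ^ k) m) \<le> e"
        unfolding m_def by (meson degree_monom_le degree_smult_le order_trans)
    qed
    ultimately show ?thesis
      using eq s unfolding e_def by blast
  qed
qed

end

text \<open>For a prime \<open>P\<close>, the residue class of \<open>x\<close> is algebraic over the image of \<open>B\<close>.\<close>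

definition algebraic_mod :: "'r::comm_ring_1 set \<Rightarrow> 'r set \<Rightarrow> 'r \<Rightarrow> bool" where
  "algebraic_mod B P x \<longleftrightarrow> (\<exists>g. coeffs_in B g \<and> (\<exists>k. cf g k \<notin> P) \<and> poly g x \<in> P)"

text \<open>The derivative of a univariate polynomial whose coefficient ring may have zero divisors.\<close>

definition formal_deriv :: "'r::comm_ring_1 poly \<Rightarrow> 'r poly" where
  "formal_deriv g = (\<Sum>k<dg g. Polynomial.monom (of_nat (Suc k) * cf g (Suc k)) k)"

lemma coeff_formal_deriv:
  "cf (formal_deriv g) k = (if k < dg g then of_nat (Suc k) * cf g (Suc k) else 0)"
  by (simp add: formal_deriv_def Polynomial.coeff_sum)

lemma derivation_poly:
  fixes d :: "'r::comm_ring_1 \<Rightarrow> 'r"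
  assumes add: "\<And>x y. d (x + y) = d x + d y" and mult: "\<And>x y. d (x * y) = x * d y + d x * y"
  shows "d (poly g x) = (\<Sum>i\<le>dg g. d (cf g i) * x ^ i) + poly (formal_deriv g) x * d x"
proof -
  have d0: "d 0 = 0" using add[of 0 0] by simp
  have d1: "d 1 = 0" using mult[of 1 1] by simp
  have dsum: "d (sum f I) = (\<Sum>i\<in>I. d (f i))" for f :: "nat \<Rightarrow> 'r" and I
    by (induction I rule: infinite_finite_induct) (auto simp: d0 add)
  have dpow: "d (x ^ Suc i) = of_nat (Suc i) * x ^ i * d x" for i
    by (induction i) (auto simp: d1 mult algebra_simps)
  have "d (poly g x) = (\<Sum>i\<le>dg g. d (cf g i) * x ^ i) + (\<Sum>i\<le>dg g. cf g i * d (x ^ i))"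
    unfolding poly_altdef dsum mult sum.distrib by simp
  also have "(\<Sum>i\<le>dg g. cf g i * d (x ^ i)) = (\<Sum>i<dg g. cf g (Suc i) * d (x ^ Suc i))"
    by (subst sum.atMost_shift) (simp add: d1)
  also have "\<dots> = poly (formal_deriv g) x * d x"
    unfolding dpow by (simp add: formal_deriv_def poly_sum poly_monom sum_distrib_left mult_ac)
  finally show ?thesis .
qed

context
  fixes B C P :: "'r::comm_ring_1 set" and x :: 'r
  assumes B: "subring_set B" and C: "subring_set C" and BC: "B \<subseteq> C" and x: "x \<in> C"
    and P: "prime_in C P"
begin

lemma poly_mem_prime:
  assumes "\<And>k. cf g k \<in> P"
  shows "poly g x \<in> P"
  unfolding poly_altdef using assms x
  by (intro prime_in_sum[OF P] prime_inD(6)[OF P] subring_set_power[OF C])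

text \<open>A leading coefficient in \<open>P\<close> could be dropped from a relation, so one of least degree has its
  leading coefficient outside \<open>P\<close>.\<close>

lemma minimal_relation:
  assumes "algebraic_mod B P x"
  obtains g where "coeffs_in B g" "poly g x \<in> P" "cf g (dg g) \<notin> P" "dg g > 0"
    "\<And>h k. coeffs_in B h \<Longrightarrow> poly h x \<in> P \<Longrightarrow> dg h < dg g \<Longrightarrow> cf h k \<in> P"
proof -
  define \<Phi> where "\<Phi> g \<longleftrightarrow> coeffs_in B g \<and> (\<exists>k. cf g k \<notin> P) \<and> poly g x \<in> P" for g
  have "\<exists>g. \<Phi> g" using assms by (auto simp: algebraic_mod_def \<Phi>_def)
  then obtain g where g: "\<Phi> g" and min: "\<And>h. \<Phi> h \<Longrightarrow> dg g \<le> dg h"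
    using ex_has_least_nat[of \<Phi> _ dg] by blast
  have min': "cf h k \<in> P" if "coeffs_in B h" "poly h x \<in> P" "dg h < dg g" for h k
    using min[of h] that by (auto simp: \<Phi>_def)
  have cg: "coeffs_in B g" and pg: "poly g x \<in> P" using g by (auto simp: \<Phi>_def)
  obtain k where k: "cf g k \<notin> P" using g by (auto simp: \<Phi>_def)
  have lc: "cf g (dg g) \<notin> P"
  proof
    assume lc: "cf g (dg g) \<in> P"
    have "k \<noteq> dg g" using lc k by auto
    moreover have "k \<le> dg g" using k prime_inD(2)[OF P] le_degree by metis
    ultimately have pos: "dg g > 0" by auto
    let ?h = "g - Polynomial.monom (cf g (dg g)) (dg g)"
    have "coeffs_in B ?h"
      using cg by (intro coeffs_in_diff[OF B] coeffs_in_monom[OF B]) (auto simp: coeffs_in_def)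
    moreover have "poly ?h x \<in> P"
      unfolding poly_diff poly_monom
      by (intro prime_in_diff[OF C P] pg prime_inD(6)[OF P] lc subring_set_power[OF C] x)
    ultimately have "cf ?h k \<in> P"
      using min' degree_drop_lead[OF B pos] by blast
    with k \<open>k \<noteq> dg g\<close> show False by simp
  qed
  have "dg g > 0"
  proof (rule ccontr)
    assume "\<not> dg g > 0"
    then have "poly g x = cf g (dg g)" by (simp add: poly_altdef)
    then show False using pg lc by simp
  qed
  then show ?thesis using that cg pg lc min' by blast
qed

text \<open>A relation of least degree is separable in characteristic zero: its derivative has smaller
  degree, and the leading coefficient of the derivative does not vanish.\<close>

lemma separant_nonzero:
  assumes g: "coeffs_in B g" "cf g (dg g) \<notin> P" "dg g > 0"
    and min: "\<And>h k. coeffs_in B h \<Longrightarrow> poly h x \<in> P \<Longrightarrow> dg h < dg g \<Longrightarrow> cf h k \<in> P"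
    and char0: "\<And>k. k > 0 \<Longrightarrow> of_nat k \<notin> P"
  shows "coeffs_in B (formal_deriv g)" "poly (formal_deriv g) x \<notin> P"
proof -
  show s: "coeffs_in B (formal_deriv g)"
    using g(1) unfolding coeffs_in_def coeff_formal_deriv
    by (auto intro!: subring_setD(4)[OF B] subring_setD(1)[OF B] simp del: of_nat_Suc
        simp: subring_set_of_nat[OF B])
  have "dg (formal_deriv g) < dg g"
    using g(3) by (intro degree_lessI) (auto simp: coeff_formal_deriv)
  moreover have "cf (formal_deriv g) (dg g - 1) = of_nat (dg g) * cf g (dg g)"
    using g(3) by (simp add: coeff_formal_deriv)
  moreover have "cf g (dg g) \<in> C" using g(1) BC by (auto simp: coeffs_in_def)
  then have "of_nat (dg g) * cf g (dg g) \<notin> P"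
    using prime_inD(7)[OF P subring_set_of_nat[OF C]] char0[OF g(3)] g(2) by blast
  ultimately show "poly (formal_deriv g) x \<notin> P"
    using min[OF s] by metis
qed

end

text \<open>Over the fraction field of \<open>B\<close> modulo the common trace, \<open>P'\<close> and \<open>P\<close> become primes of a
  univariate polynomial ring, where a nonzero prime is maximal. Without fractions: an element \<open>h\<close>
  of \<open>P\<close> outside \<open>P'\<close> of least degree would pseudo-divide the minimal relation \<open>g\<close> of \<open>P'\<close>, and
  both quotient and remainder would vanish modulo \<open>P'\<close> for degree reasons.\<close>

lemma prime_eq_if_same_trace:
  assumes B: "subring_set B" and C: "subring_set C" and BC: "B \<subseteq> C" and x: "x \<in> C"
    and P: "prime_in C P" and P': "prime_in C P'" and sub: "P' \<subseteq> P" and trace: "P \<inter> B \<subseteq> P'"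
    and alg: "algebraic_mod B P' x"
    and f: "coeffs_in B f" "poly f x \<in> P"
  shows "poly f x \<in> P'"
proof (rule ccontr)
  assume nf: "poly f x \<notin> P'"
  define Q where "Q p \<longleftrightarrow> coeffs_in B p \<and> poly p x \<in> P \<and> poly p x \<notin> P'" for p
  have "Q f" using f nf by (simp add: Q_def)
  then obtain h where h: "Q h" and minh: "\<And>p. Q p \<Longrightarrow> dg h \<le> dg p"
    using ex_has_least_nat[of Q _ dg] by blast
  have ch: "coeffs_in B h" and hP: "poly h x \<in> P" "poly h x \<notin> P'"
    using h by (auto simp: Q_def)
  have mem_B: "coeffs_in B p \<Longrightarrow> cf p k \<in> B" for p k by (simp add: coeffs_in_def)
  have hpos: "dg h > 0"
  proof (rule ccontr)
    assume "\<not> dg h > 0"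
    then have "poly h x = cf h 0" by (simp add: poly_altdef)
    then show False using hP trace mem_B[OF ch, of 0] by auto
  qed
  have lch: "cf h (dg h) \<notin> P'"
  proof
    assume lc: "cf h (dg h) \<in> P'"
    let ?h = "h - Polynomial.monom (cf h (dg h)) (dg h)"
    have m: "poly (Polynomial.monom (cf h (dg h)) (dg h)) x \<in> P'"
      unfolding poly_monom by (intro prime_inD(6)[OF P'] lc subring_set_power[OF C] x)
    have "coeffs_in B ?h"
      using ch by (intro coeffs_in_diff[OF B] coeffs_in_monom[OF B]) (auto simp: coeffs_in_def)
    moreover have "poly ?h x \<in> P"
      unfolding poly_diff using prime_in_diff[OF C P hP(1)] m sub by blast
    moreover have "poly ?h x \<notin> P'"
      using prime_inD(4)[OF P' _ m, of "poly ?h x"] hP(2) by auto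
    ultimately have "dg h \<le> dg ?h" using minh by (simp add: Q_def)
    then show False using degree_drop_lead[OF B hpos] by simp
  qed
  obtain g where g: "coeffs_in B g" "poly g x \<in> P'" "cf g (dg g) \<notin> P'" "dg g > 0"
    and ming: "\<And>p k. coeffs_in B p \<Longrightarrow> poly p x \<in> P' \<Longrightarrow> dg p < dg g \<Longrightarrow> cf p k \<in> P'"
    using minimal_relation[OF B C BC x P' alg] by blast
  \<comment> \<open>Reducing \<open>h\<close> modulo \<open>g\<close> shows that \<open>h\<close> has smaller degree than \<open>g\<close>.\<close>
  have "dg h < dg g"
  proof -
    obtain k s r where s: "coeffs_in B s" "coeffs_in B r" "dg r < dg g"
      "Polynomial.smult (cf g (dg g) ^ k) h = s * g + r"
      using pseudo_division[OF B g(1,4) ch] by blast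
    have "poly s x \<in> C" using poly_closed[OF B s(1) BC C x] .
    then have sg: "poly s x * poly g x \<in> P'" using prime_inD(5)[OF P'] g(2) by blast
    have lcC: "cf g (dg g) \<in> C" using mem_B[OF g(1)] BC by blast
    have hC: "poly h x \<in> C" using prime_inD(1)[OF P hP(1)] .
    have ev: "cf g (dg g) ^ k * poly h x = poly s x * poly g x + poly r x"
      using arg_cong[OF s(4), of "\<lambda>p. poly p x"] by simp
    have "poly r x = cf g (dg g) ^ k * poly h x - poly s x * poly g x" using ev by simp
    moreover have "\<dots> \<in> P"
      using prime_in_diff[OF C P prime_inD(5)[OF P subring_set_power[OF C lcC] hP(1)]] sg sub
      by blast
    ultimately have "poly r x \<in> P" by simp
    moreover have "poly r x \<notin> P'"
    proof
      assume "poly r x \<in> P'"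
      then have "cf g (dg g) ^ k * poly h x \<in> P'"
        unfolding ev using sg prime_inD(4)[OF P'] by blast
      then show False
        using prime_inD(7)[OF P' subring_set_power[OF C lcC] hC] hP(2) g(3)
          prime_in_power[OF C P' lcC] by blast
    qed
    ultimately show ?thesis using minh[of r] s by (simp add: Q_def)
  qed
  \<comment> \<open>Now \<open>g\<close> is divided by \<open>h\<close>. The remainder is in \<open>P'\<close> by the choice of \<open>h\<close>, and then so is the
    quotient. Both have smaller degree than the minimal relation \<open>g\<close>, so their coefficients are
    in \<open>P'\<close>, and with them the product of leading coefficients.\<close>
  obtain k s r where s: "coeffs_in B s" "coeffs_in B r" "dg r < dg h" "dg s \<le> dg g - dg h"
      "Polynomial.smult (cf h (dg h) ^ k) g = s * h + r"
    using pseudo_division[OF B ch hpos g(1)] by blast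
  have lcC: "cf h (dg h) \<in> C" "cf g (dg g) \<in> C" using mem_B[OF ch] mem_B[OF g(1)] BC by blast+
  have sC: "poly s x \<in> C" using poly_closed[OF B s(1) BC C x] .
  have ev: "cf h (dg h) ^ k * poly g x = poly s x * poly h x + poly r x"
    using arg_cong[OF s(5), of "\<lambda>p. poly p x"] by simp
  have lg: "cf h (dg h) ^ k * poly g x \<in> P'"
    by (intro prime_inD(5)[OF P'] subring_set_power[OF C] lcC g)
  have "poly r x = cf h (dg h) ^ k * poly g x - poly s x * poly h x" using ev by simp
  moreover have "\<dots> \<in> P"
    using prime_in_diff[OF C P _ prime_inD(5)[OF P sC hP(1)]] lg sub by blast
  ultimately have rP: "poly r x \<in> P'"
    using minh[of r] s by (auto simp: Q_def)
  have "poly s x * poly h x = cf h (dg h) ^ k * poly g x - poly r x" using ev by simp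
  then have "poly s x * poly h x \<in> P'"
    using prime_in_diff[OF C P' lg rP] by simp
  then have sP: "poly s x \<in> P'"
    using prime_inD(7)[OF P' sC prime_inD(1)[OF P hP(1)]] hP(2) by blast
  have "cf r i \<in> P'" for i
    using ming[OF s(2) rP] s(3) \<open>dg h < dg g\<close> by simp
  moreover have "cf s i \<in> P'" for i
    using ming[OF s(1) sP] s(4) hpos g(4) by simp
  then have "cf (s * h) i \<in> P'" for i
    unfolding coeff_mult using mem_B[OF ch] BC by (intro prime_in_sum[OF P'] prime_inD(6)[OF P']) auto
  ultimately have "cf (Polynomial.smult (cf h (dg h) ^ k) g) (dg g) \<in> P'"
    unfolding s(5) coeff_add using prime_inD(4)[OF P'] by blast
  then have "cf h (dg h) ^ k * cf g (dg g) \<in> P'" by simp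
  then show False
    using prime_inD(7)[OF P' subring_set_power[OF C lcC(1)] lcC(2)] g(3) lch
      prime_in_power[OF C P' lcC(1)] by blast
qed


section \<open>Polynomials in a set of variables\<close>

abbreviation dpoly_var :: "'v \<Rightarrow> (('v \<Rightarrow>\<^sub>0 nat) \<Rightarrow>\<^sub>0 'a::comm_ring_1)" where
  "dpoly_var v \<equiv> Poly_Mapping.single (Poly_Mapping.single v 1) 1"

definition polys :: "'v set \<Rightarrow> (('v \<Rightarrow>\<^sub>0 nat) \<Rightarrow>\<^sub>0 'a::comm_ring_1) set" where
  "polys V = {f. \<forall>m\<in>Poly_Mapping.keys f. Poly_Mapping.keys m \<subseteq> V}"

lemma polys_mono: "V \<subseteq> W \<Longrightarrow> polys V \<subseteq> polys W"
  unfolding polys_def by blast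

lemma single_in_polys: "Poly_Mapping.keys m \<subseteq> V \<Longrightarrow> Poly_Mapping.single m c \<in> polys V"
  by (auto simp: polys_def)

lemma const_in_polys: "Poly_Mapping.single 0 c \<in> polys V"
  by (intro single_in_polys) auto

lemma var_in_polys: "v \<in> V \<Longrightarrow> dpoly_var v \<in> polys V"
  by (intro single_in_polys) auto

lemma subring_polys: "subring_set (polys V :: (('v \<Rightarrow>\<^sub>0 nat) \<Rightarrow>\<^sub>0 'a::comm_ring_1) set)"
  unfolding subring_set_def
proof (intro conjI ballI)
  fix f g :: "('v \<Rightarrow>\<^sub>0 nat) \<Rightarrow>\<^sub>0 'a" assume f: "f \<in> polys V" "g \<in> polys V"
  show "f - g \<in> polys V"
    using f keys_diff[of f g] unfolding polys_def by blast
  show "f * g \<in> polys V"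
    unfolding polys_def
  proof safe
    fix m v assume "m \<in> Poly_Mapping.keys (f * g)" and v: "v \<in> Poly_Mapping.keys m"
    then obtain a b where "m = a + b" "a \<in> Poly_Mapping.keys f" "b \<in> Poly_Mapping.keys g"
      using keys_mult[of f g] by blast
    then show "v \<in> V"
      using v keys_add[of a b] f unfolding polys_def by blast
  qed
qed (auto simp: polys_def)

lemma poly_mapping_eq_sum_single:
  "f = (\<Sum>m\<in>Poly_Mapping.keys f. Poly_Mapping.single m (Poly_Mapping.lookup f m))"
  by (rule poly_mapping_eqI)
    (auto simp: lookup_sum lookup_single when_def in_keys_iff if_distrib sum.delta' cong: if_cong)

text \<open>A polynomial in one more variable \<open>v\<close> is a univariate polynomial evaluated at \<open>v\<close>; the
  type of univariate polynomials then supplies degrees and leading coefficients.\<close>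

lemma ex_univariate_of_polys_insert:
  fixes f :: "('v \<Rightarrow>\<^sub>0 nat) \<Rightarrow>\<^sub>0 'a::comm_ring_1"
  assumes "f \<in> polys (insert v V)"
  obtains p where "coeffs_in (polys V) p" "poly p (dpoly_var v) = f"
proof -
  let ?l = "\<lambda>m. Poly_Mapping.lookup m v"
  let ?r = "\<lambda>m. m - Poly_Mapping.single v (?l m)"
  define p where "p = (\<Sum>m\<in>Poly_Mapping.keys f.
    Polynomial.monom (Poly_Mapping.single (?r m) (Poly_Mapping.lookup f m)) (?l m))"
  have "Poly_Mapping.keys (?r m) \<subseteq> V" if "m \<in> Poly_Mapping.keys f" for m
  proof
    fix w assume "w \<in> Poly_Mapping.keys (?r m)"
    then have "w \<in> Poly_Mapping.keys m" "w \<noteq> v"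
      by (auto simp: in_keys_iff lookup_minus lookup_single when_def split: if_splits)
    then show "w \<in> V"
      using assms that by (auto simp: polys_def)
  qed
  then have "coeffs_in (polys V) p"
    unfolding p_def by (intro coeffs_in_sum[OF subring_polys] coeffs_in_monom[OF subring_polys] single_in_polys)
  moreover have pw: "dpoly_var v ^ k = Poly_Mapping.single (Poly_Mapping.single v k) (1::'a)" for k
  proof (induction k)
    case (Suc k)
    then show ?case by (simp add: mult_single flip: single_add)
  qed simp
  have "?r m + Poly_Mapping.single v (?l m) = m" for m :: "'v \<Rightarrow>\<^sub>0 nat"
    by (rule poly_mapping_eqI) (auto simp: lookup_add lookup_minus lookup_single when_def)
  then have "poly p (dpoly_var v) = f"
    unfolding p_def poly_sum poly_monom pw mult_single
    by (simp flip: poly_mapping_eq_sum_single)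
  ultimately show ?thesis using that by blast
qed

lemma dpoly_induct [case_names const var add mult]:
  fixes f :: "('v \<Rightarrow>\<^sub>0 nat) \<Rightarrow>\<^sub>0 'a::comm_ring_1"
  assumes const: "\<And>c. Q (Poly_Mapping.single 0 c)" and var: "\<And>v. Q (dpoly_var v)"
    and add: "\<And>f g. Q f \<Longrightarrow> Q g \<Longrightarrow> Q (f + g)" and mult: "\<And>f g. Q f \<Longrightarrow> Q g \<Longrightarrow> Q (f * g)"
  shows "Q f"
proof -
  have monom: "Q (Poly_Mapping.single m 1)" for m
  proof (induction m rule: poly_mapping_add_induct)
    case (1 v k)
    show ?case
    proof (induction k)
      case 0
      then show ?case using const[of 1] by simp
    next
      case (Suc k)
      have "Poly_Mapping.single (Poly_Mapping.single v (Suc k)) (1::'a) =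
          dpoly_var v * Poly_Mapping.single (Poly_Mapping.single v k) 1"
        by (simp add: mult_single flip: single_add)
      then show ?case using mult[OF var Suc] by simp
    qed
  next
    case (2 m m')
    then show ?case using mult[OF 2] by (simp add: mult_single)
  qed
  show ?thesis
  proof (induction f rule: poly_mapping_add_induct)
    case (1 m c)
    then show ?case using mult[OF const[of c] monom[of m]] by (simp add: mult_single)
  qed (rule add)
qed

section \<open>Polynomials with coefficients in an ideal\<close>

text \<open>The extension of \<open>I\<close> to polynomials in all variables, so that no bound on the number of
  indeterminates has to be carried along.\<close>

definition coeff_ideal :: "'a set \<Rightarrow> (('v \<Rightarrow>\<^sub>0 nat) \<Rightarrow>\<^sub>0 'a::comm_ring_1) set" where
  "coeff_ideal I = {f. \<forall>m. Poly_Mapping.lookup f m \<in> I}"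

lemma dpoly_ext_eq: "dpoly_ext n I = carrier (dpoly_ring n) \<inter> coeff_ideal I"
  by (auto simp: dpoly_ext_def coeff_ideal_def)

lemma coeff_ideal_sum:
  "prime_in UNIV I \<Longrightarrow> (\<And>i. i \<in> A \<Longrightarrow> f i \<in> coeff_ideal I) \<Longrightarrow> sum f A \<in> coeff_ideal I"
  by (auto simp: coeff_ideal_def lookup_sum prime_in_sum)

lemma lookup_mult_sum:
  fixes f g :: "'m::comm_monoid_add \<Rightarrow>\<^sub>0 'a::comm_ring_1"
  shows "Poly_Mapping.lookup (f * g) k =
    (\<Sum>a\<in>Poly_Mapping.keys f. \<Sum>b\<in>Poly_Mapping.keys g.
       if a + b = k then Poly_Mapping.lookup f a * Poly_Mapping.lookup g b else 0)"
proof -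
  have "f * g = (\<Sum>a\<in>Poly_Mapping.keys f. \<Sum>b\<in>Poly_Mapping.keys g.
      Poly_Mapping.single (a + b) (Poly_Mapping.lookup f a * Poly_Mapping.lookup g b))"
    by (subst poly_mapping_eq_sum_single[of f], subst poly_mapping_eq_sum_single[of g])
      (simp add: sum_product mult_single)
  then show ?thesis
    by (simp add: lookup_sum lookup_single when_def)
qed

lemma coeff_ideal_mult:
  fixes f g :: "('v \<Rightarrow>\<^sub>0 nat) \<Rightarrow>\<^sub>0 'a::comm_ring_1"
  assumes "prime_in UNIV I" "f \<in> coeff_ideal I"
  shows "f * g \<in> coeff_ideal I"
  unfolding coeff_ideal_def mem_Collect_eq lookup_mult_sum[of f g]
  using assms(2) prime_inD[OF assms(1)]
  by (intro allI prime_in_sum[OF assms(1)]) (auto simp: coeff_ideal_def)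


section \<open>Differential primes of a differential polynomial ring\<close>

abbreviation (input) vars :: "nat set \<Rightarrow> 'd dvar set" where
  "vars T \<equiv> {v. fst v \<in> T}"

lemma carrier_dpoly_ring_polys: "carrier (dpoly_ring n) = polys (vars {1..n})"
  unfolding carrier_dpoly_ring polys_def by auto

lemma subring_dpoly: "subring_set (carrier (dpoly_ring n))"
  unfolding carrier_dpoly_ring_polys by (rule subring_polys)

lemma diff_spec_dpoly_iff:
  "P \<in> diff_spec (dpoly_ring n) (dpoly_deriv D) \<longleftrightarrow>
     prime_in (carrier (dpoly_ring n)) P \<and> (\<forall>i. \<forall>f\<in>P. dpoly_deriv D i f \<in> P)"
  unfolding diff_spec_def using primeideal_iff_prime_in[OF subring_dpoly, of P n]
  by (simp add: dpoly_ring_def)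

lemma diff_spec_type_iff:
  "q \<in> diff_spec ring_of_type_algebra D \<longleftrightarrow> prime_in UNIV q \<and> (\<forall>i. \<forall>x\<in>q. D i x \<in> q)"
proof -
  have "ring_of_type_algebra\<lparr>carrier := UNIV\<rparr> = (ring_of_type_algebra :: 'a::comm_ring_1 ring)"
    by (simp add: ring_of_type_algebra_def)
  then show ?thesis
    unfolding diff_spec_def using primeideal_iff_prime_in[of UNIV q]
    by (simp add: subring_set_def)
qed

lemma contraction_mono: "P \<subseteq> Q \<Longrightarrow> contraction P \<subseteq> contraction Q"
  by (auto simp: contraction_def)

text \<open>The terms of such an \<open>f\<close> are multiples of constants in \<open>P\<close>.\<close>

lemma coeff_ideal_contraction_subset:
  assumes P: "prime_in (carrier (dpoly_ring n)) P"
    and f: "f \<in> carrier (dpoly_ring n)" "f \<in> coeff_ideal (contraction P)"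
  shows "f \<in> P"
proof -
  have "Poly_Mapping.single m (Poly_Mapping.lookup f m) \<in> P" if "m \<in> Poly_Mapping.keys f" for m
  proof -
    have "Poly_Mapping.single m 1 \<in> carrier (dpoly_ring n)"
      using f(1) that unfolding carrier_dpoly_ring_polys polys_def by auto
    moreover have "Poly_Mapping.single 0 (Poly_Mapping.lookup f m) \<in> P"
      using f(2) by (auto simp: coeff_ideal_def contraction_def)
    ultimately show ?thesis
      using prime_inD(5)[OF P] by (fastforce simp: mult_single)
  qed
  then show ?thesis
    by (subst poly_mapping_eq_sum_single) (rule prime_in_sum[OF P])
qed

text \<open>The indeterminates indexed by \<open>T\<close> are differentially algebraically independent modulo
  \<open>P\<close> over the residue ring of the contraction of \<open>P\<close>.\<close>

definition diff_indep :: "('a::comm_ring_1, 'd) dpoly set \<Rightarrow> nat set \<Rightarrow> bool" where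
  "diff_indep P T \<longleftrightarrow> P \<inter> polys (vars T) \<subseteq> coeff_ideal (contraction P)"

lemma diff_indep_empty:
  assumes "0 \<in> P"
  shows "diff_indep P {}"
  unfolding diff_indep_def
proof
  fix f assume f: "f \<in> P \<inter> polys (vars {})"
  then have k: "m = 0" if "m \<in> Poly_Mapping.keys f" for m
    using that by (auto simp: polys_def)
  have eq: "f = Poly_Mapping.single 0 (Poly_Mapping.lookup f 0)"
    using k by (intro poly_mapping_eqI) (auto simp: lookup_single when_def in_keys_iff)
  have "Poly_Mapping.single 0 (Poly_Mapping.lookup f m) \<in> P" for m
  proof (cases "m = 0")
    case True
    then have "Poly_Mapping.single 0 (Poly_Mapping.lookup f m) = f" by (simp flip: eq)
    then show ?thesis using f by simp
  next
    case False
    then have "Poly_Mapping.lookup f m = 0" using k by (auto simp: in_keys_iff)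
    then show ?thesis using assms by simp
  qed
  then show "f \<in> coeff_ideal (contraction P)"
    by (auto simp: coeff_ideal_def contraction_def)
qed


lemma diff_indep_antimono_same_contraction:
  assumes "P' \<subseteq> P" "contraction P' = contraction P" "diff_indep P T"
  shows "diff_indep P' T"
  using assms unfolding diff_indep_def by auto


section \<open>Renaming the indeterminates\<close>

text \<open>The automorphism of the polynomial ring that maps the variable \<open>v\<close> to \<open>u v\<close>, for a bijection
  \<open>u\<close>: both monomials and polynomials are functions of their indices and are pulled back.\<close>

definition rename_vars :: "('v \<Rightarrow> 'v) \<Rightarrow> (('v \<Rightarrow>\<^sub>0 nat) \<Rightarrow>\<^sub>0 'a) \<Rightarrow> (('v \<Rightarrow>\<^sub>0 nat) \<Rightarrow>\<^sub>0 'a::comm_ring_1)" where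
  "rename_vars u = Poly_Mapping.map_key (Poly_Mapping.map_key u)"

lemma inj_map_key:
  fixes u :: "'w \<Rightarrow> 'v"
  assumes u: "bij u"
  shows "inj (Poly_Mapping.map_key u :: ('v \<Rightarrow>\<^sub>0 nat) \<Rightarrow> _)"
proof (rule injI, rule poly_mapping_eqI)
  fix m m' :: "'v \<Rightarrow>\<^sub>0 nat" and v assume "Poly_Mapping.map_key u m = Poly_Mapping.map_key u m'"
  then have "Poly_Mapping.lookup (Poly_Mapping.map_key u m) (inv_into UNIV u v) =
      Poly_Mapping.lookup (Poly_Mapping.map_key u m') (inv_into UNIV u v)"
    by simp
  then show "Poly_Mapping.lookup m v = Poly_Mapping.lookup m' v"
    using bij_is_surj[OF u] by (simp add: map_key.rep_eq bij_is_inj[OF u] surj_f_inv_f)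
qed

context
  fixes u :: "'v \<Rightarrow> 'v"
  assumes u: "bij u"
begin

lemma lookup_rename_vars:
  "Poly_Mapping.lookup (rename_vars u f) m = Poly_Mapping.lookup f (Poly_Mapping.map_key u m)"
  unfolding rename_vars_def by (simp add: map_key.rep_eq inj_map_key[OF u])

lemma map_key_inv: "Poly_Mapping.map_key u (Poly_Mapping.map_key (inv_into UNIV u) m) = m"
  using u by (subst map_key_compose) (auto simp: bij_is_inj bij_imp_bij_inv map_key_id id_def)

lemma rename_vars_single:
  "rename_vars u (Poly_Mapping.single m c) = Poly_Mapping.single (Poly_Mapping.map_key (inv_into UNIV u) m) c"
  unfolding rename_vars_def
  by (subst map_key_inv[of m, symmetric]) (rule map_key_single[OF inj_map_key[OF u]])

lemma rename_vars_add: "rename_vars u (f + g) = rename_vars u f + rename_vars u g"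
  unfolding rename_vars_def by (rule map_key_plus[OF inj_map_key[OF u]])

lemma rename_vars_mult: "rename_vars u (f * g) = rename_vars u f * rename_vars u g"
proof (induction f rule: poly_mapping_add_induct)
  case (1 m c)
  show ?case
  proof (induction g rule: poly_mapping_add_induct)
    case (1 m' c')
    show ?case
      using u by (simp add: mult_single rename_vars_single map_key_plus bij_imp_bij_inv bij_is_inj)
  qed (simp add: rename_vars_add algebra_simps)
qed (simp add: rename_vars_add algebra_simps)

lemma rename_vars_const: "rename_vars u (Poly_Mapping.single 0 c) = Poly_Mapping.single 0 c"
  using u by (simp add: rename_vars_single bij_imp_bij_inv bij_is_inj)

lemma rename_vars_var: "rename_vars u (dpoly_var v) = dpoly_var (u v)"
proof -
  have "Poly_Mapping.map_key (inv_into UNIV u) (Poly_Mapping.single (inv_into UNIV u (u v)) (1::nat)) = Poly_Mapping.single (u v) 1"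
    using u by (intro map_key_single) (simp add: bij_imp_bij_inv bij_is_inj)
  then show ?thesis
    using u by (simp add: rename_vars_single bij_is_inj)
qed

lemma rename_vars_polys:
  fixes f :: "('v \<Rightarrow>\<^sub>0 nat) \<Rightarrow>\<^sub>0 'a::comm_ring_1"
  assumes "f \<in> polys V"
  shows "rename_vars u f \<in> polys (u ` V)"
  unfolding polys_def
proof (intro CollectI ballI subsetI)
  fix m v assume m: "m \<in> Poly_Mapping.keys (rename_vars u f)" and v: "v \<in> Poly_Mapping.keys m"
  have "Poly_Mapping.map_key u m \<in> Poly_Mapping.keys f"
    using m by (simp add: in_keys_iff lookup_rename_vars)
  moreover have "inv_into UNIV u v \<in> Poly_Mapping.keys (Poly_Mapping.map_key u m)"
    using v bij_is_surj[OF u] by (simp add: in_keys_iff map_key.rep_eq bij_is_inj[OF u] surj_f_inv_f)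
  ultimately have "inv_into UNIV u v \<in> V" using assms by (auto simp: polys_def)
  then show "v \<in> u ` V"
    using surj_f_inv_f[OF bij_is_surj[OF u], of v] by (intro image_eqI[of v u "inv_into UNIV u v"]) auto
qed

lemma coeff_ideal_rename_vars: "rename_vars u f \<in> coeff_ideal I \<longleftrightarrow> f \<in> coeff_ideal I"
proof -
  have "Poly_Mapping.lookup f k = Poly_Mapping.lookup (rename_vars u f) (Poly_Mapping.map_key (inv_into UNIV u) k)" for k
    by (simp only: lookup_rename_vars map_key_inv)
  then show ?thesis
    unfolding coeff_ideal_def mem_Collect_eq by (metis lookup_rename_vars)
qed

end

lemma rename_vars_inverse:
  fixes u :: "'v \<Rightarrow> 'v"
  assumes "bij u"
  shows "rename_vars u (rename_vars (inv_into UNIV u) f) = f"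
proof (rule poly_mapping_eqI)
  fix m :: "'v \<Rightarrow>\<^sub>0 nat"
  have "Poly_Mapping.map_key (inv_into UNIV u) (Poly_Mapping.map_key u m) = m"
    using map_key_inv[of "inv_into UNIV u" m] assms by (simp add: bij_imp_bij_inv inv_inv_eq)
  then show "Poly_Mapping.lookup (rename_vars u (rename_vars (inv_into UNIV u) f)) m = Poly_Mapping.lookup f m"
    using assms by (simp add: lookup_rename_vars bij_imp_bij_inv)
qed

lemma rename_vars_deriv:
  fixes D :: "'d::finite \<Rightarrow> 'a::comm_ring_1 \<Rightarrow> 'a"
  assumes D: "differential_ring ring_of_type_algebra D" and u: "bij u"
    and shift: "\<And>v. u (shift i v) = shift i (u v)"
  shows "dpoly_deriv D i (rename_vars u f) = rename_vars u (dpoly_deriv D i f)"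
proof (induction f rule: dpoly_induct)
  case (var v)
  show ?case
    by (simp add: rename_vars_var[OF u] dpoly_deriv_var[OF D] shift del: One_nat_def)
next
  case (mult f g)
  then show ?case
    by (simp add: rename_vars_mult[OF u] rename_vars_add[OF u] dpoly_deriv_mult[OF D])
qed (simp_all add: rename_vars_const[OF u] rename_vars_add[OF u] dpoly_deriv_const[OF D] dpoly_deriv_add[OF D])

lemma ex_permutation_image_atLeastAtMost:
  fixes T :: "nat set"
  assumes "finite T"
  obtains \<pi> :: "nat \<Rightarrow> nat" where "bij \<pi>" "\<pi> ` {1..card T} = T"
proof -
  let ?K = "{1..card T}"
  let ?S = "T \<union> ?K"
  have "card (?S - ?K) = card (?S - T)"
    using assms by (simp add: card_Diff_subset)
  then obtain f g where f: "bij_betw f ?K T" and g: "bij_betw g (?S - ?K) (?S - T)"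
    using assms by (metis finite_same_card_bij finite_Diff finite_UnI finite_atLeastAtMost card_atLeastAtMost diff_Suc_1)
  define \<pi> where "\<pi> x = (if x \<in> ?K then f x else if x \<in> ?S - ?K then g x else x)" for x
  have "bij_betw \<pi> ?K T" using f by (subst bij_betw_cong[of _ _ f]) (auto simp: \<pi>_def)
  moreover have "bij_betw \<pi> (?S - ?K) (?S - T)" using g by (subst bij_betw_cong[of _ _ g]) (auto simp: \<pi>_def)
  moreover have "bij_betw \<pi> (- ?S) (- ?S)" by (subst bij_betw_cong[of _ _ "\<lambda>x. x"]) (auto simp: \<pi>_def bij_betw_def)
  ultimately have "bij_betw \<pi> (?K \<union> (?S - ?K) \<union> - ?S) (T \<union> (?S - T) \<union> - ?S)"
    by (intro bij_betw_combine) auto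
  moreover have "?K \<union> (?S - ?K) \<union> - ?S = UNIV" "T \<union> (?S - T) \<union> - ?S = UNIV" by auto
  moreover have "\<pi> ` ?K = T" using \<open>bij_betw \<pi> ?K T\<close> by (rule bij_betw_imp_surj_on)
  ultimately show ?thesis using that by simp
qed


section \<open>Property S3 and differential independence\<close>

context
  fixes D :: "'d::finite \<Rightarrow> 'a::comm_ring_1 \<Rightarrow> 'a"
  assumes D: "differential_ring ring_of_type_algebra D"
begin

lemma contraction_in_diff_spec:
  assumes "P \<in> diff_spec (dpoly_ring n) (dpoly_deriv D)"
  shows "contraction P \<in> diff_spec ring_of_type_algebra D"
proof -
  have P: "prime_in (carrier (dpoly_ring n)) P" and d: "\<And>i f. f \<in> P \<Longrightarrow> dpoly_deriv D i f \<in> P"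
    using assms by (auto simp: diff_spec_dpoly_iff)
  have c: "Poly_Mapping.single 0 x \<in> (carrier (dpoly_ring n) :: ('a, 'd) dpoly set)" for x :: 'a
    unfolding carrier_dpoly_ring_polys by (rule const_in_polys)
  have m: "Poly_Mapping.single 0 (x * y) = Poly_Mapping.single 0 x * (Poly_Mapping.single 0 y :: ('a, 'd) dpoly)"
    for x y :: 'a by (simp add: mult_single)
  have "prime_in UNIV (contraction P)"
    unfolding prime_in_def contraction_def
    using prime_inD[OF P] c by (auto simp: single_add m)
  moreover have "D i x \<in> contraction P" if "x \<in> contraction P" for i x
    using d[of "Poly_Mapping.single 0 x" i] that by (simp add: contraction_def dpoly_deriv_const[OF D])
  ultimately show ?thesis by (simp add: diff_spec_type_iff)
qed

text \<open>If the indeterminates in \<open>T\<close> satisfied a relation modulo \<open>P'\<close>, the relations between them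
  would form a differential upper to the contraction of \<open>P'\<close>. They lie in the extension of the
  contraction of \<open>P\<close>, because \<open>T\<close> is independent modulo \<open>P\<close>, against property S3.\<close>

lemma diff_indep_antimono:
  assumes S3: "property_S3 D" and T: "T \<subseteq> {1..n}"
    and P: "P \<in> diff_spec (dpoly_ring n) (dpoly_deriv D)"
    and P': "P' \<in> diff_spec (dpoly_ring n) (dpoly_deriv D)"
    and sub: "P' \<subseteq> P" and ind: "diff_indep P T"
  shows "diff_indep P' T"
proof (cases "T = {} \<or> contraction P' = contraction P")
  case True
  then show ?thesis
    using diff_indep_empty P' diff_indep_antimono_same_contraction[OF sub _ ind]
    by (metis diff_spec_dpoly_iff prime_inD(2))
next
  case False
  have finT: "finite T" using T finite_subset by blast
  define k where "k = card T"
  have k: "k > 0" using False finT by (simp add: k_def card_gt_0_iff)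
  obtain \<pi> :: "nat \<Rightarrow> nat" where \<pi>: "bij \<pi>" "\<pi> ` {1..k} = T"
    using ex_permutation_image_atLeastAtMost[OF finT] unfolding k_def by blast
  define u :: "'d dvar \<Rightarrow> 'd dvar" where "u v = (\<pi> (fst v), snd v)" for v
  have u_eq: "u = map_prod \<pi> id" by (auto simp: u_def)
  have u: "bij u" unfolding u_eq bij_def using \<pi>(1) prod.inj_map[of \<pi> id] map_prod_surj[of \<pi> id]
    by (simp add: bij_is_inj bij_is_surj)
  have shift: "u (shift i v) = shift i (u v)" for i v by (simp add: u_def shift_def)
  have img: "u ` vars {1..k} = vars T"
    unfolding u_eq using \<pi>(2) by (force simp: image_iff)
  let ?Ck = "carrier (dpoly_ring k) :: ('a, 'd) dpoly set"
  let ?Cn = "carrier (dpoly_ring n) :: ('a, 'd) dpoly set"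
  have ren_T: "rename_vars u f \<in> polys (vars T)" if "f \<in> ?Ck" for f
    using rename_vars_polys[OF u] that unfolding carrier_dpoly_ring_polys img[symmetric] by blast
  have TC: "polys (vars T) \<subseteq> ?Cn"
    unfolding carrier_dpoly_ring_polys using T by (intro polys_mono) auto
  have p: "prime_in ?Cn P" and p': "prime_in ?Cn P'" and d': "\<And>i f. f \<in> P' \<Longrightarrow> dpoly_deriv D i f \<in> P'"
    using P P' by (auto simp: diff_spec_dpoly_iff)
  define Q where "Q = {f \<in> ?Ck. rename_vars u f \<in> P'}"
  have "prime_in ?Ck Q"
    unfolding prime_in_def
  proof (intro conjI ballI impI)
    have "rename_vars u (1 :: ('a, 'd) dpoly) = 1" "rename_vars u (0 :: ('a, 'd) dpoly) = 0"
      using rename_vars_const[OF u, of 1] rename_vars_const[OF u, of 0] by simp_all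
    then show "0 \<in> Q" "1 \<notin> Q"
      using prime_inD(2,3)[OF p'] subring_setD[OF subring_dpoly] by (auto simp: Q_def)
    show "f + g \<in> Q" if "f \<in> Q" "g \<in> Q" for f g
      using that prime_inD(4)[OF p'] subring_setD(3)[OF subring_dpoly]
      by (auto simp: Q_def rename_vars_add[OF u])
    show "f * g \<in> Q" if "f \<in> ?Ck" "g \<in> Q" for f g
      using that prime_inD(5)[OF p'] subring_setD(4)[OF subring_dpoly] TC[THEN subsetD, OF ren_T]
      by (auto simp: Q_def rename_vars_mult[OF u])
    show "f \<in> Q \<or> g \<in> Q" if "f \<in> ?Ck" "g \<in> ?Ck" "f * g \<in> Q" for f g
      using that prime_inD(7)[OF p', of "rename_vars u f" "rename_vars u g"] TC[THEN subsetD, OF ren_T]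
      by (auto simp: Q_def rename_vars_mult[OF u])
  qed (auto simp: Q_def)
  moreover have "dpoly_deriv D i f \<in> Q" if "f \<in> Q" for i f
  proof -
    have "dpoly_deriv D i (rename_vars u f) \<in> P'" using that d' by (simp add: Q_def)
    then have "rename_vars u (dpoly_deriv D i f) \<in> P'" by (simp only: rename_vars_deriv[OF D u shift])
    then show ?thesis using that dpoly_deriv_closed[OF D] by (simp add: Q_def)
  qed
  ultimately have Q: "Q \<in> diff_spec (dpoly_ring k) (dpoly_deriv D)"
    by (simp add: diff_spec_dpoly_iff)
  have cQ: "contraction Q = contraction P'"
    by (auto simp: contraction_def Q_def rename_vars_const[OF u] carrier_dpoly_ring_polys const_in_polys)
  have "Q \<subseteq> dpoly_ext k (contraction P)"
  proof
    fix f assume f: "f \<in> Q"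
    then have "rename_vars u f \<in> coeff_ideal (contraction P)"
      using ind sub ren_T unfolding Q_def diff_indep_def by blast
    then show "f \<in> dpoly_ext k (contraction P)"
      using f by (simp add: dpoly_ext_eq Q_def coeff_ideal_rename_vars[OF u])
  qed
  moreover have "contraction (dpoly_ext k (contraction P)) = contraction P"
    using prime_inD(2)[OF p]
    by (auto simp: contraction_def dpoly_ext_eq coeff_ideal_def carrier_dpoly_ring_polys const_in_polys
        lookup_single when_def)
  then have "Q \<noteq> dpoly_ext k (contraction P)"
    using cQ False by metis
  ultimately have "Q \<subset> dpoly_ext k (contraction P)" by blast
  moreover note Q
  moreover have "contraction P' \<subset> contraction P"
    using False contraction_mono[OF sub] by blast
  moreover have "contraction P' \<in> diff_spec ring_of_type_algebra D" "contraction P \<in> diff_spec ring_of_type_algebra D"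
    using contraction_in_diff_spec P P' by blast+
  moreover have upper: "diff_upper k D Q (contraction P')" if "Q \<noteq> dpoly_ext k (contraction P')"
    using that Q cQ contraction_in_diff_spec[OF P'] by (simp add: diff_upper_def)
  ultimately have "\<not> diff_upper k D Q (contraction P')"
    using S3[unfolded property_S3_def, rule_format, OF k] by blast
  then have Q_eq: "Q = dpoly_ext k (contraction P')"
    using upper by blast
  show ?thesis
    unfolding diff_indep_def
  proof
    fix g assume g: "g \<in> P' \<inter> polys (vars T)"
    have iu: "bij (inv_into UNIV u)" using u by (rule bij_imp_bij_inv)
    have "inv_into UNIV u ` vars T = vars {1..k}"
      unfolding img[symmetric] using u by (simp add: bij_is_inj image_inv_f_f)
    then have "rename_vars (inv_into UNIV u) g \<in> ?Ck"
      using rename_vars_polys[OF iu, of g "vars T"] g by (simp add: carrier_dpoly_ring_polys)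
    then have "rename_vars (inv_into UNIV u) g \<in> Q"
      using g by (simp add: Q_def rename_vars_inverse[OF u])
    then have "rename_vars (inv_into UNIV u) g \<in> coeff_ideal (contraction P')"
      unfolding Q_eq dpoly_ext_eq by blast
    then show "g \<in> coeff_ideal (contraction P')"
      by (rule iffD1[OF coeff_ideal_rename_vars[OF iu]])
  qed
qed

end


section \<open>Chains of differential primes with a common contraction\<close>

text \<open>With a single derivation the variables are the derivatives \<open>dvar j k\<close> of order \<open>k\<close> of the
  indeterminates \<open>z\<^sub>j\<close>. The index of that derivation is the only element of its type, hence equal
  to \<^const>\<open>undefined\<close>, where the order of a variable is read off.\<close>

definition dvar :: "nat \<Rightarrow> nat \<Rightarrow> 'd dvar" where
  "dvar j k = (j, \<lambda>_. k)"

definition dvar_order :: "'d dvar \<Rightarrow> nat" where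
  "dvar_order v = snd v undefined"

lemma dvar_simps [simp]: "fst (dvar j k) = j" "dvar_order (dvar j k) = k"
  by (simp_all add: dvar_def dvar_order_def)

definition vars_upto :: "nat set \<Rightarrow> nat \<Rightarrow> nat \<Rightarrow> 'd dvar set" where
  "vars_upto T j k = {v. fst v \<in> T \<or> fst v = j \<and> dvar_order v < k}"

text \<open>The variables preceding \<open>dvar j k\<close> when all derivatives of the indeterminates in \<open>T\<close> come
  first and the remaining variables are ordered by indeterminate, then by order.\<close>

definition preceding :: "nat \<Rightarrow> nat set \<Rightarrow> nat \<Rightarrow> nat \<Rightarrow> 'd dvar set" where
  "preceding n T j k =
     {v. fst v \<in> {1..n} \<and> (fst v \<in> T \<or> fst v < j \<or> fst v = j \<and> dvar_order v < k)}"

text \<open>If \<open>T\<close> is independent modulo \<open>P\<close>, these variables, given by indeterminate and order, form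
  together with the derivatives of the indeterminates in \<open>T\<close> the greedy transcendence basis
  modulo \<open>P\<close>.\<close>

definition transcendental_vars ::
    "nat \<Rightarrow> nat set \<Rightarrow> ('a::comm_ring_1, 'd) dpoly set \<Rightarrow> (nat \<times> nat) set" where
  "transcendental_vars n T P =
     {(j, k). j \<in> {1..n} - T \<and> \<not> algebraic_mod (polys (preceding n T j k)) P (dpoly_var (dvar j k))}"

lemma algebraic_mod_mono: "B \<subseteq> B' \<Longrightarrow> algebraic_mod B P x \<Longrightarrow> algebraic_mod B' P x"
  unfolding algebraic_mod_def coeffs_in_def by blast

lemma dpoly_deriv_polys:
  fixes D :: "'d::finite \<Rightarrow> 'a::comm_ring_1 \<Rightarrow> 'a"
  assumes f: "f \<in> polys V" and V: "V \<subseteq> W" "\<And>v. v \<in> V \<Longrightarrow> shift i v \<in> W"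
  shows "dpoly_deriv D i f \<in> polys W"
proof -
  have "(monom_deriv i m :: ('a, 'd) dpoly) \<in> polys W" if "Poly_Mapping.keys m \<subseteq> V" for m
    unfolding monom_deriv_def
  proof (intro subring_set_sum[OF subring_polys] single_in_polys subsetI)
    fix v w assume v: "v \<in> Poly_Mapping.keys m"
      and "w \<in> Poly_Mapping.keys (m - Poly_Mapping.single v 1 + Poly_Mapping.single (shift i v) 1)"
    then have "w \<in> Poly_Mapping.keys m \<or> w = shift i v"
      by (auto simp: in_keys_iff lookup_add lookup_minus lookup_single when_def split: if_splits)
    then show "w \<in> W" using v that V(1) V(2)[of v] by auto
  qed
  moreover have "Poly_Mapping.keys m \<subseteq> V" if "m \<in> Poly_Mapping.keys f" for m
    using f that by (auto simp: polys_def)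
  ultimately have "Poly_Mapping.single m (D i (Poly_Mapping.lookup f m)) +
      Poly_Mapping.single 0 (Poly_Mapping.lookup f m) * monom_deriv i m \<in> polys W"
    if "m \<in> Poly_Mapping.keys f" for m
    using V(1) that
    by (intro subring_setD(3,4)[OF subring_polys] const_in_polys single_in_polys) auto
  then show ?thesis
    unfolding dpoly_deriv_def by (rule subring_set_sum[OF subring_polys])
qed

context
  fixes D :: "'d::finite \<Rightarrow> 'a::comm_ring_1 \<Rightarrow> 'a"
  assumes D: "differential_ring ring_of_type_algebra D" and ordinary: "CARD('d) = 1"
begin

lemma eq_undefined: "(i::'d) = undefined"
  using ordinary by (metis (full_types) UNIV_I card_1_singletonE singletonD)

lemma dvar_eqI:
  assumes "fst v = j" "dvar_order v = k"
  shows "v = (dvar j k :: 'd dvar)"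
proof (rule prod_eqI)
  show "snd v = snd (dvar j k)"
  proof
    fix i show "snd v i = snd (dvar j k) i"
      unfolding eq_undefined[of i] using assms(2) by (simp add: dvar_def dvar_order_def)
  qed
qed (use assms(1) in simp)

lemma dvar_order_shift: "dvar_order (shift i (v :: 'd dvar)) = Suc (dvar_order v)"
  unfolding dvar_order_def shift_def eq_undefined[of i] by simp

lemma shift_dvar: "shift i (dvar j k) = (dvar j (Suc k) :: 'd dvar)"
  by (rule dvar_eqI) (simp_all add: dvar_order_shift, simp add: shift_def)

lemma vars_upto_Suc: "(vars_upto T j (Suc k) :: 'd dvar set) = insert (dvar j k) (vars_upto T j k)"
  unfolding vars_upto_def by (auto simp: less_Suc_eq intro: dvar_eqI)

lemma preceding_Suc:
  "j \<in> {1..n} \<Longrightarrow> (preceding n T j (Suc k) :: 'd dvar set) = insert (dvar j k) (preceding n T j k)"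
  unfolding preceding_def by (auto simp: less_Suc_eq intro: dvar_eqI)

lemma dpoly_deriv_vars_upto:
  "f \<in> polys (vars_upto T j k) \<Longrightarrow> dpoly_deriv D i f \<in> polys (vars_upto T j (Suc k))"
  by (rule dpoly_deriv_polys[of _ "vars_upto T j k"])
    (auto simp: vars_upto_def dvar_order_shift, auto simp: shift_def)

lemma vars_upto_mono: "k \<le> l \<Longrightarrow> polys (vars_upto T j k) \<subseteq> polys (vars_upto T j l)"
  by (intro polys_mono) (auto simp: vars_upto_def)

context
  fixes n :: nat and P :: "('a, 'd) dpoly set"
  assumes P: "P \<in> diff_spec (dpoly_ring n) (dpoly_deriv D)"
    and char0: "\<And>k. k > 0 \<Longrightarrow> of_nat k \<notin> P"
begin

lemma P_prime: "prime_in (carrier (dpoly_ring n)) P"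
  and P_deriv: "f \<in> P \<Longrightarrow> dpoly_deriv D i f \<in> P"
  using P by (auto simp: diff_spec_dpoly_iff)

text \<open>Differentiating a minimal relation of \<open>z\<^sub>j\<close> over \<open>T\<close> yields relations that are linear in
  the higher derivatives of \<open>z\<^sub>j\<close>, all with the separant as leading coefficient. So the order of
  any single relation bounds the orders of the transcendental derivatives of \<open>z\<^sub>j\<close>.\<close>

lemma algebraic_mod_above_relation_order:
  assumes T: "T \<subseteq> {1..n}" and j: "j \<in> {1..n}" and ind: "diff_indep P T"
    and f: "f \<in> P" "f \<in> polys (vars_upto T j r)" "f \<notin> coeff_ideal (contraction P)" and k: "k \<ge> r"
  shows "algebraic_mod (polys (preceding n T j k)) P (dpoly_var (dvar j k))"
proof -
  let ?V = "vars_upto T j :: nat \<Rightarrow> 'd dvar set"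
  let ?C = "carrier (dpoly_ring n) :: ('a, 'd) dpoly set"
  let ?x = "\<lambda>k. dpoly_var (dvar j k) :: ('a, 'd) dpoly"
  let ?\<delta> = "dpoly_deriv D undefined"
  define rel where "rel r \<longleftrightarrow> (\<exists>f. f \<in> P \<and> f \<in> polys (?V r) \<and> f \<notin> coeff_ideal (contraction P))" for r
  \<comment> \<open>The relation \<open>f\<close> need not have a separant outside \<open>P\<close>; one of least order and then least
    degree does.\<close>
  define r0 where "r0 = (LEAST r. rel r)"
  have "rel r" using f by (auto simp: rel_def)
  then have r0: "rel r0" "r0 \<le> r"
    unfolding r0_def by (rule LeastI, rule Least_le)
  have least: "\<not> rel s" if "s < r0" for s
    using that unfolding r0_def by (rule not_less_Least)
  have V0: "?V 0 = vars T" by (auto simp: vars_upto_def)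
  have "\<not> rel 0" using ind unfolding rel_def diff_indep_def V0 by blast
  then have "r0 \<noteq> 0" using r0(1) by metis
  then obtain s where s: "r0 = Suc s" using not0_implies_Suc by blast
  have q: "prime_in UNIV (contraction P)"
    using contraction_in_diff_spec[OF D P] by (simp add: diff_spec_type_iff)
  have VC: "polys (?V k) \<subseteq> ?C" for k
    unfolding carrier_dpoly_ring_polys using T j by (intro polys_mono) (auto simp: vars_upto_def)
  have xC: "?x k \<in> ?C" for k
    unfolding carrier_dpoly_ring_polys using j by (intro var_in_polys) auto
  have xV: "?x k \<in> polys (?V (Suc k))" for k
    by (intro var_in_polys) (auto simp: vars_upto_def)
  let ?B = "polys (?V s) :: ('a, 'd) dpoly set"
  note B = subring_polys[of "?V s"]
  obtain f0 where f0: "f0 \<in> P" "f0 \<in> polys (?V (Suc s))" "f0 \<notin> coeff_ideal (contraction P)"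
    using r0(1) unfolding rel_def s by blast
  have "f0 \<in> polys (insert (dvar j s) (?V s))"
    using f0(2) by (simp only: vars_upto_Suc)
  then obtain p where p: "coeffs_in ?B p" "poly p (?x s) = f0"
    by (rule ex_univariate_of_polys_insert)
  have "\<exists>i. cf p i \<notin> coeff_ideal (contraction P)"
  proof (rule ccontr)
    assume "\<nexists>i. cf p i \<notin> coeff_ideal (contraction P)"
    then have "f0 \<in> coeff_ideal (contraction P)"
      unfolding p(2)[symmetric] poly_altdef
      by (intro coeff_ideal_sum[OF q] coeff_ideal_mult[OF q]) auto
    then show False using f0(3) by blast
  qed
  \<comment> \<open>As \<open>r0\<close> is least, a coefficient outside the extension of the contraction is outside \<open>P\<close>.\<close>
  then have "algebraic_mod ?B P (?x s)"
    using p f0(1) least[of s] unfolding algebraic_mod_def rel_def s coeffs_in_def by blast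
  then obtain g where g: "coeffs_in ?B g" "poly g (?x s) \<in> P" "cf g (dg g) \<notin> P" "dg g > 0"
    and min: "\<And>h k. coeffs_in ?B h \<Longrightarrow> poly h (?x s) \<in> P \<Longrightarrow> dg h < dg g \<Longrightarrow> cf h k \<in> P"
    using minimal_relation[OF B subring_dpoly VC xC P_prime] by blast
  define S where "S = poly (formal_deriv g) (?x s)"
  have S: "S \<notin> P" and cS: "coeffs_in ?B (formal_deriv g)"
    using separant_nonzero[OF B subring_dpoly VC xC P_prime g(1,3,4) min char0]
    unfolding S_def by blast+
  have S1: "S \<in> polys (?V (Suc s))"
    unfolding S_def by (rule poly_closed[OF B cS vars_upto_mono subring_polys xV]) simp
  have linear: "\<exists>h. h \<in> polys (?V (Suc s + l)) \<and> S * ?x (Suc s + l) + h \<in> P" for l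
  proof (induction l)
    case 0
    let ?h = "\<Sum>i\<le>dg g. ?\<delta> (cf g i) * ?x s ^ i"
    have "?\<delta> (poly g (?x s)) = ?h + S * ?\<delta> (?x s)"
      unfolding S_def by (rule derivation_poly) (simp_all add: dpoly_deriv_add[OF D] dpoly_deriv_mult[OF D])
    also have "?\<delta> (?x s) = ?x (Suc s)"
      by (simp only: dpoly_deriv_var[OF D] shift_dvar)
    finally have "S * ?x (Suc s) + ?h \<in> P"
      using P_deriv[OF g(2), of undefined] by (simp add: add.commute)
    moreover have "?h \<in> polys (?V (Suc s))"
      using g(1) xV unfolding coeffs_in_def
      by (intro subring_set_sum[OF subring_polys] subring_setD(4)[OF subring_polys]
          subring_set_power[OF subring_polys] dpoly_deriv_vars_upto) auto
    ultimately show ?case by auto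
  next
    case (Suc l)
    then obtain h where h: "h \<in> polys (?V (Suc s + l))" "S * ?x (Suc s + l) + h \<in> P" by blast
    let ?h = "?\<delta> S * ?x (Suc s + l) + ?\<delta> h"
    have "?\<delta> (S * ?x (Suc s + l) + h) = S * ?\<delta> (?x (Suc s + l)) + ?h"
      by (simp only: dpoly_deriv_add[OF D] dpoly_deriv_mult[OF D] add.assoc)
    also have "?\<delta> (?x (Suc s + l)) = ?x (Suc s + Suc l)"
      by (simp only: dpoly_deriv_var[OF D] shift_dvar add_Suc_right)
    finally have "S * ?x (Suc s + Suc l) + ?h \<in> P"
      using P_deriv[OF h(2), of undefined] by simp
    moreover have "?h \<in> polys (?V (Suc s + Suc l))"
    proof -
      have "?\<delta> S \<in> polys (?V (Suc (Suc s)))" "?\<delta> h \<in> polys (?V (Suc (Suc s + l)))"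
        using dpoly_deriv_vars_upto S1 h(1) by blast+
      then show ?thesis
        using xV[of "Suc s + l"] vars_upto_mono[of "Suc (Suc s)" "Suc s + Suc l" T j]
        by (auto intro!: subring_setD(3,4)[OF subring_polys])
    qed
    ultimately show ?case by blast
  qed
  have sub: "polys (?V k) \<subseteq> polys (preceding n T j k)"
    using T j by (intro polys_mono) (auto simp: vars_upto_def preceding_def)
  obtain l where l: "k = Suc s + l"
    using k r0(2) s by (metis le_Suc_ex order_trans)
  obtain h where h: "h \<in> polys (?V k)" "S * ?x k + h \<in> P"
    using linear[of l] l by blast
  have "S \<in> polys (?V k)" using S1 vars_upto_mono[of "Suc s" k T j] l by auto
  moreover have "cf [:h, S:] 1 \<notin> P" using S by simp
  moreover have "poly [:h, S:] (?x k) \<in> P" using h(2) by (simp add: mult.commute add.commute)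
  moreover have "coeffs_in (polys (?V k)) [:h, S:]"
    using h(1) calculation(1) subring_setD(1)[OF subring_polys]
    by (auto simp: coeffs_in_def coeff_pCons split: nat.splits)
  ultimately have "algebraic_mod (polys (?V k)) P (?x k)"
    unfolding algebraic_mod_def by blast
  then show ?thesis using algebraic_mod_mono sub by blast
qed

end

text \<open>A polynomial lies in the ring of variables up to its greatest variable outside \<open>T\<close>, so it
  suffices to add one variable at a time. A variable that is transcendental modulo both primes
  adds nothing to either, and one that is algebraic modulo \<open>P'\<close> leaves no room for \<open>P\<close> to be
  larger.\<close>

lemma eq_if_same_transcendental_vars:
  assumes P: "P \<in> diff_spec (dpoly_ring n) (dpoly_deriv D)"
    and P': "P' \<in> diff_spec (dpoly_ring n) (dpoly_deriv D)"
    and sub: "P' \<subseteq> P" and con: "contraction P' = contraction P"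
    and T: "T \<subseteq> {1..n}" and ind: "diff_indep P T"
    and same: "transcendental_vars n T P = transcendental_vars n T P'"
  shows "P = P'"
proof -
  let ?C = "carrier (dpoly_ring n) :: ('a, 'd) dpoly set"
  let ?A = "\<lambda>j k. polys (preceding n T j k) :: ('a, 'd) dpoly set"
  let ?x = "\<lambda>j k. dpoly_var (dvar j k) :: ('a, 'd) dpoly"
  have p: "prime_in ?C P" and p': "prime_in ?C P'"
    using P P' by (auto simp: diff_spec_dpoly_iff)
  have AC: "?A j k \<subseteq> ?C" for j k
    unfolding carrier_dpoly_ring_polys by (intro polys_mono) (auto simp: preceding_def)
  have step: "f \<in> P'" if IH: "P \<inter> ?A j k \<subseteq> P'" and j: "j \<in> {1..n} - T" and f: "f \<in> P" "f \<in> ?A j (Suc k)"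
    for f j k
  proof -
    have "f \<in> polys (insert (dvar j k) (preceding n T j k))"
      using f(2) by (simp only: preceding_Suc[OF DiffD1[OF j]])
    then obtain g where g: "coeffs_in (?A j k) g" "poly g (?x j k) = f"
      by (rule ex_univariate_of_polys_insert)
    have xC: "?x j k \<in> ?C"
      unfolding carrier_dpoly_ring_polys using j by (intro var_in_polys) auto
    show ?thesis
    proof (cases "algebraic_mod (?A j k) P' (?x j k)")
      case True
      then show ?thesis
        using prime_eq_if_same_trace[OF subring_polys subring_dpoly AC xC p p' sub IH True g(1)] f(1)
        unfolding g(2) by blast
    next
      case False
      then have "(j, k) \<in> transcendental_vars n T P"
        unfolding same using j by (simp add: transcendental_vars_def)
      then have "\<not> algebraic_mod (?A j k) P (?x j k)"
        by (simp add: transcendental_vars_def)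
      then have "cf g i \<in> P" for i
        using g f(1) unfolding algebraic_mod_def by blast
      then have "cf g i \<in> P'" for i
        using IH g(1) unfolding coeffs_in_def by blast
      then show ?thesis
        using poly_mem_prime[OF subring_polys subring_dpoly AC xC p'] g(2) by metis
    qed
  qed
  have main: "f \<in> P'" if f: "f \<in> P" "f \<in> ?A j k" for f j k
    using f
  proof (induction "(j, k)" arbitrary: j k f rule: wf_induct_rule[OF wf_lex_prod[OF wf_less_than wf_less_than]])
    case (1 j k)
    obtain V where V: "finite V" "f \<in> polys V" "V \<subseteq> preceding n T j k"
    proof (rule that[of "\<Union> (Poly_Mapping.keys ` Poly_Mapping.keys f)"])
      show "\<Union> (Poly_Mapping.keys ` Poly_Mapping.keys f) \<subseteq> preceding n T j k"
        using 1(3) by (auto simp: polys_def)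
    qed (auto simp: polys_def)
    let ?W = "{v \<in> V. fst v \<notin> T}"
    show ?case
    proof (cases "?W = {}")
      case True
      then have "V \<subseteq> vars T" by blast
      then have "f \<in> polys (vars T)" using V(2) polys_mono by blast
      then have "f \<in> coeff_ideal (contraction P')"
        using ind 1(2) unfolding diff_indep_def con by blast
      then show ?thesis
        using coeff_ideal_contraction_subset[OF p'] AC 1(3) by blast
    next
      case False
      \<comment> \<open>The greatest variable outside \<open>T\<close> that occurs in \<open>f\<close> is \<open>dvar j' k'\<close>.\<close>
      define j' where "j' = Max (fst ` ?W)"
      define k' where "k' = Max (dvar_order ` {v \<in> ?W. fst v = j'})"
      have "j' \<in> fst ` ?W" unfolding j'_def using V(1) False by (intro Max_in) auto
      then obtain v0 where v0: "v0 \<in> ?W" "fst v0 = j'" by auto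
      have "dvar_order ` {v \<in> ?W. fst v = j'} \<noteq> {}" using v0 by blast
      then have "k' \<in> dvar_order ` {v \<in> ?W. fst v = j'}"
        unfolding k'_def using Max_in[OF finite_imageI] V(1) by simp
      then obtain v where v: "v \<in> V" "fst v \<notin> T" "fst v = j'" "dvar_order v = k'" by auto
      have j': "fst w \<le> j'" if "w \<in> ?W" for w unfolding j'_def using V(1) that by (intro Max_ge) auto
      have k': "dvar_order w \<le> k'" if "w \<in> ?W" "fst w = j'" for w
        unfolding k'_def using V(1) that by (intro Max_ge) auto
      have "V \<subseteq> preceding n T j' (Suc k')"
        using V(3) j' k' unfolding preceding_def by (fastforce simp: less_Suc_eq_le)
      then have "f \<in> ?A j' (Suc k')" using V(2) polys_mono by blast
      moreover have "v \<in> preceding n T j k" using v V(3) by blast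
      then have "((j', k'), (j, k)) \<in> less_than <*lex*> less_than" "j' \<in> {1..n} - T"
        using v by (auto simp: preceding_def)
      ultimately show ?thesis
        using step[of j' k' f] 1 by blast
    qed
  qed
  have "?C \<subseteq> ?A (Suc n) 0"
    unfolding carrier_dpoly_ring_polys by (intro polys_mono) (auto simp: preceding_def)
  then have "P \<subseteq> P'" using main prime_inD(1)[OF p] by blast
  then show ?thesis using sub by blast
qed

text \<open>Along a chain whose terms all contain a relation for every indeterminate outside \<open>T\<close>, the
  transcendental variables stay within a fixed finite set, so they repeat.\<close>

lemma no_desc_chain_of_bounded_order:
  assumes c: "\<And>i. c i \<in> diff_spec (dpoly_ring n) (dpoly_deriv D)" "\<And>i. c (Suc i) \<subset> c i"
    "\<And>i. contraction (c i) = q"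
    and char0: "\<And>k. k > 0 \<Longrightarrow> of_nat k \<notin> q"
    and T: "T \<subseteq> {1..n}" and ind: "diff_indep (c 0) T"
    and rel: "\<And>j. j \<in> {1..n} - T \<Longrightarrow>
      \<exists>f. (\<forall>i. f \<in> c i) \<and> f \<in> polys (vars (insert j T)) \<and> f \<notin> coeff_ideal q"
  shows False
proof -
  have anti: "c j \<subseteq> c i" if "i \<le> j" for i j
    using lift_Suc_antimono_le[of c i j] c(2) that by blast
  have char0': "of_nat k \<notin> c i" if "k > 0" for k i
    using char0[OF that] c(3)[of i] by (auto simp: contraction_def)
  have indi: "diff_indep (c i) T" for i
    using diff_indep_antimono_same_contraction[OF anti[of 0 i]] ind c(3) by auto
  have "\<exists>r. \<exists>f. (\<forall>i. f \<in> c i) \<and> f \<in> polys (vars_upto T j r) \<and> f \<notin> coeff_ideal q"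
    if j: "j \<in> {1..n} - T" for j
  proof -
    obtain f where f: "\<And>i. f \<in> c i" "f \<in> polys (vars (insert j T))" "f \<notin> coeff_ideal q"
      using rel[OF j] by blast
    define V where "V = \<Union> (Poly_Mapping.keys ` Poly_Mapping.keys f)"
    have V: "finite V" "f \<in> polys V" "V \<subseteq> vars (insert j T)"
      using f(2) unfolding V_def polys_def by auto
    have "V \<subseteq> vars_upto T j (Suc (Max (dvar_order ` V)))"
      using V(1,3) by (auto simp: vars_upto_def less_Suc_eq_le)
    then show ?thesis using f V(2) polys_mono by blast
  qed
  then obtain r where r: "\<And>j. j \<in> {1..n} - T \<Longrightarrow>
      \<exists>f. (\<forall>i. f \<in> c i) \<and> f \<in> polys (vars_upto T j (r j)) \<and> f \<notin> coeff_ideal q"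
    by metis
  have "transcendental_vars n T (c i) \<subseteq> (SIGMA j:{1..n}. {..<r j})" for i
  proof safe
    fix j k assume jk: "(j, k) \<in> transcendental_vars n T (c i)"
    then have j: "j \<in> {1..n} - T" by (simp add: transcendental_vars_def)
    then show "j \<in> {1..n}" by blast
    obtain f where f: "f \<in> c i" "f \<in> polys (vars_upto T j (r j))" "f \<notin> coeff_ideal q"
      using r[OF j] by blast
    have "algebraic_mod (polys (preceding n T j k)) (c i) (dpoly_var (dvar j k))" if "k \<ge> r j"
      using j f c(3) by (intro algebraic_mod_above_relation_order[OF c(1) char0' T _ indi _ _ _ that]) auto
    then show "k < r j"
      using jk by (auto simp: transcendental_vars_def not_less[symmetric])
  qed
  then have "range (\<lambda>i. transcendental_vars n T (c i)) \<subseteq> Pow (SIGMA j:{1..n}. {..<r j})" by blast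
  then have "finite (range (\<lambda>i. transcendental_vars n T (c i)))"
    by (rule finite_subset) auto
  then have "\<not> inj (\<lambda>i. transcendental_vars n T (c i))"
    using finite_imageD infinite_UNIV_nat by blast
  then obtain i l where il: "i < l" "transcendental_vars n T (c i) = transcendental_vars n T (c l)"
    unfolding inj_def by (metis linorder_neqE_nat)
  then have "c i = c l"
    using eq_if_same_transcendental_vars[OF c(1) c(1) anti[of i l] _ T indi] c(3) by auto
  then show False using anti[of "Suc i" l] c(2)[of i] il(1) by auto
qed

end


section \<open>Differential primes generated by variables\<close>

text \<open>The classical argument that a polynomial ring over a domain is a domain, with respect to a
  prime \<open>q\<close> of the coefficient ring and for the coefficients at the monomials in a face \<open>N\<close> of the
  monoid of monomials: the greatest monomials with coefficients outside \<open>q\<close> do not cancel.\<close>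

lemma coefficients_on_face_prime:
  fixes f g :: "'m::comm_monoid_add \<Rightarrow>\<^sub>0 'a::comm_ring_1"
    and \<phi> :: "'m \<Rightarrow> 'o::linordered_cancel_ab_semigroup_add"
  assumes inj: "inj \<phi>" and add: "\<And>a b. \<phi> (a + b) = \<phi> a + \<phi> b"
    and q: "prime_in UNIV q" and N: "\<And>a b. a + b \<in> N \<longleftrightarrow> a \<in> N \<and> b \<in> N"
    and fg: "\<And>m. m \<in> N \<Longrightarrow> Poly_Mapping.lookup (f * g) m \<in> q"
  shows "(\<forall>m\<in>N. Poly_Mapping.lookup f m \<in> q) \<or> (\<forall>m\<in>N. Poly_Mapping.lookup g m \<in> q)"
proof (rule ccontr)
  assume contra: "\<not> ?thesis"
  let ?l = "Poly_Mapping.lookup"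
  have top: "\<exists>a0\<in>N. ?l h a0 \<notin> q \<and> (\<forall>a\<in>N. ?l h a \<notin> q \<longrightarrow> \<phi> a \<le> \<phi> a0)"
    if "\<exists>m\<in>N. ?l h m \<notin> q" for h
  proof -
    let ?A = "{m \<in> N. ?l h m \<notin> q}"
    have "?A \<subseteq> Poly_Mapping.keys h" using prime_inD(2)[OF q] by (auto simp: in_keys_iff)
    then have fin: "finite ?A" using finite_keys finite_subset by blast
    have "Max (\<phi> ` ?A) \<in> \<phi> ` ?A" using that fin by (intro Max_in) auto
    then obtain a0 where a0: "a0 \<in> ?A" "\<phi> a0 = Max (\<phi> ` ?A)" by auto
    then have "\<phi> a \<le> \<phi> a0" if "a \<in> ?A" for a
      using fin that by (simp add: Max_ge)
    then show ?thesis using a0(1) by blast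
  qed
  obtain a0 where a0: "a0 \<in> N" "?l f a0 \<notin> q" "\<And>a. a \<in> N \<Longrightarrow> ?l f a \<notin> q \<Longrightarrow> \<phi> a \<le> \<phi> a0"
    using top[of f] contra by blast
  obtain b0 where b0: "b0 \<in> N" "?l g b0 \<notin> q" "\<And>b. b \<in> N \<Longrightarrow> ?l g b \<notin> q \<Longrightarrow> \<phi> b \<le> \<phi> b0"
    using top[of g] contra by blast
  let ?K = "Poly_Mapping.keys f \<times> Poly_Mapping.keys g"
  define t where "t p = (if fst p + snd p = a0 + b0 then ?l f (fst p) * ?l g (snd p) else 0)" for p
  have "(a0, b0) \<in> ?K"
    using a0(2) b0(2) prime_inD(2)[OF q] by (auto simp: in_keys_iff)
  then have "?l (f * g) (a0 + b0) = t (a0, b0) + sum t (?K - {(a0, b0)})"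
    unfolding lookup_mult_sum[of f g] sum.cartesian_product t_def by (subst sum.remove) (auto simp: case_prod_unfold)
  moreover have "sum t (?K - {(a0, b0)}) \<in> q"
  proof (rule prime_in_sum[OF q])
    fix p assume p: "p \<in> ?K - {(a0, b0)}"
    obtain a b where ab: "p = (a, b)" by (cases p)
    show "t p \<in> q"
    proof (cases "a + b = a0 + b0 \<and> ?l f a \<notin> q \<and> ?l g b \<notin> q")
      case True
      then have "a \<in> N" "b \<in> N" using a0(1) b0(1) N by metis+
      then have le: "\<phi> a \<le> \<phi> a0" "\<phi> b \<le> \<phi> b0" using True a0(3) b0(3) by auto
      have eq: "\<phi> a + \<phi> b = \<phi> a0 + \<phi> b0" using True add by metis
      have "\<phi> a = \<phi> a0" "\<phi> b = \<phi> b0"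
        using add_less_le_mono[of "\<phi> a" "\<phi> a0" "\<phi> b" "\<phi> b0"]
          add_le_less_mono[of "\<phi> a" "\<phi> a0" "\<phi> b" "\<phi> b0"] le eq by fastforce+
      then show ?thesis using p ab inj by (auto dest: injD)
    next
      case False
      then show ?thesis using prime_inD(2,5,6)[OF q] by (auto simp: t_def ab)
    qed
  qed
  ultimately have "?l f a0 * ?l g b0 + sum t (?K - {(a0, b0)}) \<in> q"
    using fg[of "a0 + b0"] a0(1) b0(1) N by (simp add: t_def)
  then have "(?l f a0 * ?l g b0 + sum t (?K - {(a0, b0)})) - sum t (?K - {(a0, b0)}) \<in> q"
    using \<open>sum t _ \<in> q\<close> by (intro prime_in_diff[OF _ q]) (auto simp: subring_set_def)
  then have "?l f a0 * ?l g b0 \<in> q" by simp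
  then show False using prime_inD(7)[OF q] a0(2) b0(2) by blast
qed

text \<open>The ideal generated by \<open>q\<close> and the variables in \<open>W\<close>: the only condition is on the
  coefficients at monomials without variables from \<open>W\<close>.\<close>

definition var_ideal :: "nat \<Rightarrow> 'a set \<Rightarrow> 'd dvar set \<Rightarrow> ('a::comm_ring_1, 'd) dpoly set" where
  "var_ideal n q W = {f \<in> carrier (dpoly_ring n).
     \<forall>m. Poly_Mapping.keys m \<inter> W = {} \<longrightarrow> Poly_Mapping.lookup f m \<in> q}"

lemma var_ideal_empty: "var_ideal n q {} = dpoly_ext n q"
  by (simp add: var_ideal_def dpoly_ext_def)

lemma var_ideal_mono: "q \<subseteq> q' \<Longrightarrow> W \<subseteq> W' \<Longrightarrow> var_ideal n q W \<subseteq> var_ideal n q' W'"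
  unfolding var_ideal_def by blast

lemma var_mem_var_ideal:
  assumes "prime_in UNIV q" "fst v \<in> {1..n}"
  shows "dpoly_var v \<in> var_ideal n q W \<longleftrightarrow> v \<in> W"
proof -
  have "dpoly_var v \<in> carrier (dpoly_ring n)"
    unfolding carrier_dpoly_ring_polys using assms(2) by (intro var_in_polys) simp
  then show ?thesis
    using prime_inD(2,3)[OF assms(1)]
    by (auto simp: var_ideal_def lookup_single when_def dest: spec[of _ "Poly_Mapping.single v 1"])
qed

lemma contraction_var_ideal:
  assumes "0 \<in> q"
  shows "contraction (var_ideal n q W) = q"
  using assms
  by (auto simp: contraction_def var_ideal_def carrier_dpoly_ring_polys const_in_polys lookup_single
      when_def dest: spec[of _ 0])

context
  fixes D :: "'d::finite \<Rightarrow> 'a::comm_ring_1 \<Rightarrow> 'a"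
  assumes D: "differential_ring ring_of_type_algebra D" and ordinary: "CARD('d) = 1"
begin

text \<open>There are countably many variables, and monomials in variables indexed by natural numbers are
  linearly ordered compatibly with multiplication.\<close>

lemma ex_additive_inj:
  "\<exists>\<phi> :: ('d dvar \<Rightarrow>\<^sub>0 nat) \<Rightarrow> (nat \<Rightarrow>\<^sub>0 nat). inj \<phi> \<and> (\<forall>a b. \<phi> (a + b) = \<phi> a + \<phi> b)"
proof -
  define e where "e x = (dvar (fst (prod_decode x)) (snd (prod_decode x)) :: 'd dvar)" for x
  have e: "bij e"
  proof (rule o_bij)
    define h where "h v = prod_encode (fst v, dvar_order v)" for v :: "'d dvar"
    show "h \<circ> e = id" by (auto simp: h_def e_def)
    show "e \<circ> h = id"
    proof
      fix v :: "'d dvar"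
      show "(e \<circ> h) v = id v"
        using dvar_eqI[OF D ordinary, of v, OF refl refl] by (simp add: h_def e_def)
    qed
  qed
  show ?thesis
    using inj_map_key[OF e] map_key_plus[OF bij_is_inj[OF e]] by blast
qed

text \<open>The residue ring is a polynomial ring over the domain \<open>R/q\<close> in the variables outside \<open>W\<close>.
  Here the monomials without variables from \<open>W\<close> form the face. The derivative of any other
  monomial consists of monomials that still contain a variable from \<open>W\<close>.\<close>

lemma var_ideal_in_diff_spec:
  assumes q: "q \<in> diff_spec ring_of_type_algebra D"
    and W: "\<And>i v. v \<in> W \<Longrightarrow> shift i v \<in> W"
  shows "var_ideal n q W \<in> diff_spec (dpoly_ring n) (dpoly_deriv D)"
proof -
  let ?C = "carrier (dpoly_ring n) :: ('a, 'd) dpoly set"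
  let ?l = "Poly_Mapping.lookup"
  have qp: "prime_in UNIV q" and qd: "\<And>i x. x \<in> q \<Longrightarrow> D i x \<in> q"
    using q by (auto simp: diff_spec_type_iff)
  have "subring_set ?C" by (rule subring_dpoly)
  note C = subring_setD[OF this]
  define N where "N = {m :: 'd dvar \<Rightarrow>\<^sub>0 nat. Poly_Mapping.keys m \<inter> W = {}}"
  have N: "a + b \<in> N \<longleftrightarrow> a \<in> N \<and> b \<in> N" for a b
    by (auto simp: N_def in_keys_iff lookup_add disjoint_iff)
  have mem: "f \<in> var_ideal n q W \<longleftrightarrow> f \<in> ?C \<and> (\<forall>m\<in>N. ?l f m \<in> q)" for f
    by (auto simp: var_ideal_def N_def)
  obtain \<phi> :: "('d dvar \<Rightarrow>\<^sub>0 nat) \<Rightarrow> (nat \<Rightarrow>\<^sub>0 nat)"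
    where \<phi>: "inj \<phi>" "\<And>a b. \<phi> (a + b) = \<phi> a + \<phi> b"
    using ex_additive_inj by blast
  have "prime_in ?C (var_ideal n q W)"
      unfolding prime_in_def
  proof (intro conjI ballI impI)
    have "0 \<in> N" by (simp add: N_def)
    then show "1 \<notin> var_ideal n q W"
      unfolding mem using prime_inD(3)[OF qp] by (metis lookup_one_zero)
    show "f * g \<in> var_ideal n q W" if "f \<in> ?C" "g \<in> var_ideal n q W" for f g
    proof -
      have "?l (f * g) m \<in> q" if "m \<in> N" for m
        unfolding lookup_mult_sum[of f g]
        using \<open>g \<in> _\<close> that N prime_inD(2,5)[OF qp] by (intro prime_in_sum[OF qp]) (auto simp: mem)
      then show ?thesis using that C(4) by (simp add: mem)
    qed
    show "f \<in> var_ideal n q W \<or> g \<in> var_ideal n q W"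
      if "f \<in> ?C" "g \<in> ?C" "f * g \<in> var_ideal n q W" for f g
      using coefficients_on_face_prime[OF \<phi> qp N, of f g] that unfolding mem by blast
    show "f + g \<in> var_ideal n q W" if "f \<in> var_ideal n q W" "g \<in> var_ideal n q W" for f g
      using that C(3) prime_inD(4)[OF qp] by (simp add: mem lookup_add)
  qed (use C(1) prime_inD(2)[OF qp] in \<open>auto simp: mem\<close>)
  moreover have "dpoly_deriv D i f \<in> var_ideal n q W" if "f \<in> var_ideal n q W" for i f
  proof -
    have f: "f \<in> ?C" "\<And>m. m \<in> N \<Longrightarrow> ?l f m \<in> q" using that mem by auto
    have "?l (Poly_Mapping.single m (D i (?l f m)) + Poly_Mapping.single 0 (?l f m) * monom_deriv i m) k \<in> q"
      if k: "k \<in> N" for m k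
    proof (cases "m \<in> N")
      case True
      have "Poly_Mapping.single 0 (?l f m) \<in> coeff_ideal q"
        using f(2)[OF True] prime_inD(2)[OF qp] by (auto simp: coeff_ideal_def lookup_single when_def)
      then have "Poly_Mapping.single 0 (?l f m) * monom_deriv i m \<in> coeff_ideal q"
        by (rule coeff_ideal_mult[OF qp])
      then show ?thesis
        using qd[OF f(2)[OF True]] prime_inD(2,4)[OF qp]
        by (auto simp: coeff_ideal_def lookup_add lookup_single when_def)
    next
      case False
      then obtain w where w: "w \<in> Poly_Mapping.keys m" "w \<in> W" by (auto simp: N_def)
      have "m - Poly_Mapping.single v 1 + Poly_Mapping.single (shift i v) 1 \<notin> N"
        if "v \<in> Poly_Mapping.keys m" for v
      proof -
        have "w \<noteq> v \<longrightarrow> w \<in> Poly_Mapping.keys (m - Poly_Mapping.single v 1 + Poly_Mapping.single (shift i v) 1)"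
          using w(1) by (auto simp: in_keys_iff lookup_add lookup_minus lookup_single when_def)
        moreover have "shift i v \<in> Poly_Mapping.keys (m - Poly_Mapping.single v 1 + Poly_Mapping.single (shift i v) 1)"
          by (auto simp: in_keys_iff lookup_add)
        ultimately show ?thesis using w(2) W unfolding N_def by blast
      qed
      then have "?l (Poly_Mapping.single 0 (?l f m) * monom_deriv i m) k = 0"
        using k unfolding monom_deriv_def sum_distrib_left mult_single lookup_sum
        by (intro sum.neutral) (auto simp: lookup_single when_def)
      then show ?thesis
        using False k prime_inD(2)[OF qp] by (auto simp: lookup_add lookup_single when_def)
    qed
    then have "?l (dpoly_deriv D i f) k \<in> q" if "k \<in> N" for k
      unfolding dpoly_deriv_def lookup_sum using that by (intro prime_in_sum[OF qp])
    then show ?thesis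
      unfolding mem using dpoly_deriv_closed[OF D f(1)] by blast
  qed
  ultimately show ?thesis
    by (simp add: diff_spec_dpoly_iff)
qed

lemma dpoly_ext_in_diff_spec:
  "q \<in> diff_spec ring_of_type_algebra D \<Longrightarrow> dpoly_ext n q \<in> diff_spec (dpoly_ring n) (dpoly_deriv D)"
  using var_ideal_in_diff_spec[of q "{}" n] by (simp add: var_ideal_empty)

lemma dpoly_ext_psubset:
  assumes "prime_in UNIV q" "prime_in UNIV q'" "q' \<subset> q"
  shows "dpoly_ext n q' \<subset> (dpoly_ext n q :: ('a, 'd) dpoly set)"
proof -
  have "contraction (dpoly_ext n r :: ('a, 'd) dpoly set) = r" if "prime_in UNIV r" for r
    using contraction_var_ideal[OF prime_inD(2)[OF that], of n "{}"] by (simp add: var_ideal_empty)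
  moreover have "dpoly_ext n q' \<subseteq> (dpoly_ext n q :: ('a, 'd) dpoly set)"
    using assms(3) by (auto simp: dpoly_ext_def)
  ultimately show ?thesis using assms by (metis psubsetE psubsetI subset_antisym)
qed

lemma gap_ge_dpoly_ext:
  assumes "gap_ge (diff_spec ring_of_type_algebra D) d q q'"
    and "q \<in> diff_spec ring_of_type_algebra D" "q' \<in> diff_spec ring_of_type_algebra D"
  shows "gap_ge (diff_spec (dpoly_ring n) (dpoly_deriv D)) d (dpoly_ext n q) (dpoly_ext n q')"
  using assms
proof (induction d arbitrary: q q')
  case (Suc d)
  obtain c where c: "desc_chain (diff_spec ring_of_type_algebra D) q q' c"
    "\<And>i. gap_ge (diff_spec ring_of_type_algebra D) d (c i) (c (Suc i))"
    using Suc.prems(1) by auto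
  have e: "desc_chain (diff_spec (dpoly_ring n) (dpoly_deriv D)) (dpoly_ext n q) (dpoly_ext n q')
      (\<lambda>i. dpoly_ext n (c i))"
    unfolding desc_chain_def
  proof (intro conjI allI)
    fix i
    have ci: "c i \<in> diff_spec ring_of_type_algebra D" "c (Suc i) \<in> diff_spec ring_of_type_algebra D"
      "c (Suc i) \<subset> c i" "q' \<subseteq> c i"
      using c(1) by (auto simp: desc_chain_def)
    show "dpoly_ext n (c i) \<in> diff_spec (dpoly_ring n) (dpoly_deriv D)"
      using dpoly_ext_in_diff_spec ci by blast
    show "dpoly_ext n (c (Suc i)) \<subset> (dpoly_ext n (c i) :: ('a, 'd) dpoly set)"
      using ci by (intro dpoly_ext_psubset) (auto simp: diff_spec_type_iff)
    show "dpoly_ext n q' \<subseteq> (dpoly_ext n (c i) :: ('a, 'd) dpoly set)"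
      using ci(4) by (auto simp: dpoly_ext_def)
  qed (use c(1) in \<open>simp add: desc_chain_def\<close>)
  moreover have "gap_ge (diff_spec (dpoly_ring n) (dpoly_deriv D)) d (dpoly_ext n (c i)) (dpoly_ext n (c (Suc i)))" for i
    using Suc.IH c unfolding desc_chain_def by blast
  ultimately show ?case
    using desc_chain_ne[OF e] unfolding gap_ge.simps by blast
qed simp

text \<open>Dropping the derivatives of the indeterminate with index \<open>j + 1\<close> from the generators one after
  the other, in increasing order, takes infinitely many steps.\<close>

lemma gap_ge_drop_indeterminate:
  assumes q: "q \<in> diff_spec ring_of_type_algebra D" and j: "Suc j \<le> n"
  shows "gap_ge (diff_spec (dpoly_ring n) (dpoly_deriv D)) 1
    (var_ideal n q (vars {1..Suc j})) (var_ideal n q (vars {1..j}))"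
proof -
  let ?W = "\<lambda>k. vars {1..j} \<union> {v :: 'd dvar. fst v = Suc j \<and> k \<le> dvar_order v}"
  have qp: "prime_in UNIV q" using q by (simp add: diff_spec_type_iff)
  have shift: "fst (shift i v) = fst v" for i and v :: "'d dvar" by (simp add: shift_def)
  have chain: "desc_chain (diff_spec (dpoly_ring n) (dpoly_deriv D))
    (var_ideal n q (vars {1..Suc j})) (var_ideal n q (vars {1..j})) (\<lambda>k. var_ideal n q (?W k))"
    unfolding desc_chain_def
  proof (intro conjI allI)
    have "?W 0 = vars {1..Suc j}" by auto
    then show "var_ideal n q (?W 0) = var_ideal n q (vars {1..Suc j})" by simp
    fix k
    show "var_ideal n q (?W k) \<in> diff_spec (dpoly_ring n) (dpoly_deriv D)"
      by (rule var_ideal_in_diff_spec[OF q]) (auto simp: shift dvar_order_shift[OF D ordinary])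
    have "dpoly_var (dvar (Suc j) k) \<in> var_ideal n q (?W k)"
      "dpoly_var (dvar (Suc j) k) \<notin> var_ideal n q (?W (Suc k))"
      using j by (subst var_mem_var_ideal[OF qp]; simp)+
    moreover have "var_ideal n q (?W (Suc k)) \<subseteq> var_ideal n q (?W k)"
      by (intro var_ideal_mono) auto
    ultimately show "var_ideal n q (?W (Suc k)) \<subset> var_ideal n q (?W k)" by blast
    show "var_ideal n q (vars {1..j}) \<subseteq> var_ideal n q (?W k)"
      by (intro var_ideal_mono) auto
  qed
  show ?thesis
    unfolding gap_ge_1_iff using chain by blast
qed

text \<open>Above the extension of the chain \<open>e\<close> there is room for \<open>n\<close> more steps: the primes generated by
  \<open>e 0\<close> and initial segments of the indeterminates.\<close>

lemma ex_gap_chain_dpoly: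
  assumes "gap_chain (diff_spec ring_of_type_algebra D) 1 d e"
  shows "\<exists>c. gap_chain (diff_spec (dpoly_ring n) (dpoly_deriv D)) 1 (n + d) c"
proof -
  let ?S = "diff_spec (dpoly_ring n) (dpoly_deriv D)"
  have e: "e i \<in> diff_spec ring_of_type_algebra D" if "i \<le> d" for i
    using assms that by (simp add: gap_chain_def)
  have shift: "fst (shift i v) = fst v" for i and v :: "'d dvar" by (simp add: shift_def)
  define c :: "nat \<Rightarrow> ('a, 'd) dpoly set" where "c i = (if i \<le> n then var_ideal n (e 0) (vars {1..n - i}) else dpoly_ext n (e (i - n)))" for i
  have c_late: "c i = dpoly_ext n (e (i - n))" if "i \<ge> n" for i
  proof (cases "i = n")
    case True
    have "vars {1..n - n} = ({} :: 'd dvar set)" by simp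
    then show ?thesis unfolding c_def True by (simp only: var_ideal_empty diff_self_eq_0 le_refl if_True)
  qed (use that in \<open>simp add: c_def\<close>)
  have in_S: "c i \<in> ?S" if "i \<le> n + d" for i
  proof (cases "i \<le> n")
    case True
    have "var_ideal n (e 0) (vars {1..n - i}) \<in> ?S"
      by (rule var_ideal_in_diff_spec[OF e]) (simp_all add: shift)
    then show ?thesis using True by (simp only: c_def if_True)
  next
    case False
    then show ?thesis using dpoly_ext_in_diff_spec e[of "i - n"] that by (simp add: c_def)
  qed
  have gap: "gap_ge ?S 1 (c i) (c (Suc i))" if "i < n + d" for i
  proof (cases "i < n")
    case True
    then have "c i = var_ideal n (e 0) (vars {1..Suc (n - Suc i)})"
      "c (Suc i) = var_ideal n (e 0) (vars {1..n - Suc i})"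
      by (simp_all add: c_def Suc_diff_Suc)
    then show ?thesis
      using gap_ge_drop_indeterminate[OF e[of 0], of "n - Suc i" n] True by (simp del: gap_ge.simps One_nat_def)
  next
    case False
    then have k: "i - n < d" "c (Suc i) = dpoly_ext n (e (Suc (i - n)))" "c i = dpoly_ext n (e (i - n))"
      using that c_late[of i] c_late[of "Suc i"] by (simp_all add: Suc_diff_le)
    have "gap_ge (diff_spec ring_of_type_algebra D) 1 (e (i - n)) (e (Suc (i - n)))"
      using assms k(1) unfolding gap_chain_def by blast
    then show ?thesis
      unfolding k(2,3) using e k(1) by (intro gap_ge_dpoly_ext) simp_all
  qed
  have "c (Suc i) \<subset> c i" if "i < n + d" for i
    by (rule gap_ge_Suc_imp_psubset[of ?S 0, folded One_nat_def, OF gap[OF that]])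
  then have "gap_chain ?S 1 (n + d) c"
    unfolding gap_chain_def using in_S gap by simp
  then show ?thesis by (rule exI[of _ c])
qed

lemma gap_chain_dpoly_ext:
  assumes "gap_chain (diff_spec ring_of_type_algebra D) t d e"
  shows "gap_chain (diff_spec (dpoly_ring n) (dpoly_deriv D)) t d (\<lambda>i. dpoly_ext n (e i))"
  unfolding gap_chain_def
proof (intro conjI allI impI)
  have e: "e i \<in> diff_spec ring_of_type_algebra D" if "i \<le> d" for i
    using assms that by (simp add: gap_chain_def)
  fix i
  show "dpoly_ext n (e i) \<in> diff_spec (dpoly_ring n) (dpoly_deriv D)" if "i \<le> d"
    using dpoly_ext_in_diff_spec e that by blast
  assume i: "i < d"
  show "dpoly_ext n (e (Suc i)) \<subset> (dpoly_ext n (e i) :: ('a, 'd) dpoly set)"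
    using assms i e[of i] e[of "Suc i"]
    by (intro dpoly_ext_psubset) (auto simp: gap_chain_def diff_spec_type_iff)
  show "gap_ge (diff_spec (dpoly_ring n) (dpoly_deriv D)) t (dpoly_ext n (e i)) (dpoly_ext n (e (Suc i)))"
    using assms i e[of i] e[of "Suc i"] by (intro gap_ge_dpoly_ext) (auto simp: gap_chain_def)
qed

end


section \<open>Characteristic zero\<close>

text \<open>An integer in \<open>P\<close> becomes zero in the residue field.\<close>

lemma of_nat_notin_if_char_zero_residue_field:
  fixes P :: "'a::comm_ring_1 set"
  assumes P: "primeideal P ring_of_type_algebra"
    and char: "char_zero (residue_field ring_of_type_algebra P)" and k: "k > 0"
  shows "of_nat k \<notin> P"
proof
  assume kP: "of_nat k \<in> P"
  let ?R = "ring_of_type_algebra :: 'a ring"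
  interpret P: primeideal P ?R by (rule P)
  define L where "L = localization ?R P"
  interpret L: cring L unfolding L_def by (rule P.cring_localization)
  define h where "h a = loc_frac ?R P a \<one>\<^bsub>?R\<^esub>" for a
  have hL: "h a \<in> carrier L" for a
    unfolding L_def h_def using P.one_compl by (intro P.frac_closed) (auto simp: ring_of_type_algebra_def)
  have sub: "h ` P \<subseteq> carrier L" using hL by blast
  define J where "J = Idl\<^bsub>L\<^esub> (h ` P)"
  interpret J: ideal J L unfolding J_def by (rule L.genideal_ideal[OF sub])
  have one: "\<one>\<^bsub>L\<^esub> = h 1"
    by (simp add: L_def h_def localization_def ring_of_type_algebra_def)
  have add: "h a \<oplus>\<^bsub>L\<^esub> h b = h (a + b)" for a b
    unfolding L_def h_def using P.localization_add[of a b "\<one>\<^bsub>?R\<^esub>" "\<one>\<^bsub>?R\<^esub>"] P.one_compl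
    by (simp add: ring_of_type_algebra_def)
  have zero: "\<zero>\<^bsub>L\<^esub> = h 0"
    by (simp add: L_def h_def localization_def ring_of_type_algebra_def)
  have pow: "add_pow L j \<one>\<^bsub>L\<^esub> = h (of_nat j)" for j :: nat
  proof (induction j)
    case (Suc j)
    then show ?case using add[of "of_nat j" 1] by (simp add: one add.commute)
  qed (simp add: zero)
  interpret Q: cring "L Quot J" by (rule J.quotient_is_cring[OF L.is_cring])
  have "add_pow (L Quot J) j \<one>\<^bsub>L Quot J\<^esub> = J +>\<^bsub>L\<^esub> (add_pow L j \<one>\<^bsub>L\<^esub>)" for j :: nat
  proof (induction j)
    case 0
    have "\<zero>\<^bsub>L\<^esub> \<in> J" by (rule additive_subgroup.zero_closed[OF J.additive_subgroup_axioms])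
    then have "J +>\<^bsub>L\<^esub> \<zero>\<^bsub>L\<^esub> = \<zero>\<^bsub>L Quot J\<^esub>" by (simp add: FactRing_def J.a_rcos_const)
    then show ?case by simp
  next
    case (Suc j)
    have "(J +>\<^bsub>L\<^esub> a) \<oplus>\<^bsub>L Quot J\<^esub> (J +>\<^bsub>L\<^esub> b) = J +>\<^bsub>L\<^esub> (a \<oplus>\<^bsub>L\<^esub> b)"
      if "a \<in> carrier L" "b \<in> carrier L" for a b
      using that by (simp add: FactRing_def J.a_rcos_sum)
    moreover have "\<one>\<^bsub>L Quot J\<^esub> = J +>\<^bsub>L\<^esub> \<one>\<^bsub>L\<^esub>" by (simp add: FactRing_def)
    ultimately show ?case
      using Suc by (simp only: Q.add.nat_pow_Suc L.add.nat_pow_Suc L.add.nat_pow_closed L.one_closed)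
  qed
  then have "add_pow (L Quot J) k \<one>\<^bsub>L Quot J\<^esub> = J +>\<^bsub>L\<^esub> h (of_nat k)"
    by (simp add: pow)
  also have "h (of_nat k) \<in> J" unfolding J_def using L.genideal_self[OF sub] kP by blast
  then have "J +>\<^bsub>L\<^esub> h (of_nat k) = \<zero>\<^bsub>L Quot J\<^esub>"
    by (simp add: FactRing_def J.a_rcos_const)
  finally show False
    using char k unfolding char_zero_def residue_field_def J_def L_def h_def by simp
qed


section \<open>Differential transcendence degree and gaps\<close>

text \<open>Defined through the indeterminates only, the degree inherits its monotonicity directly from that
  of independence, without an exchange argument.\<close>

definition diff_trdeg :: "nat \<Rightarrow> ('a::comm_ring_1, 'd) dpoly set \<Rightarrow> nat" where
  "diff_trdeg n P = Max (card ` {T. T \<subseteq> {1..n} \<and> diff_indep P T})"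

lemma finite_diff_indep_sets: "finite (card ` {T. T \<subseteq> {1..n} \<and> diff_indep P T})"
  by simp

lemma card_le_diff_trdeg: "T \<subseteq> {1..n} \<Longrightarrow> diff_indep P T \<Longrightarrow> card T \<le> diff_trdeg n P"
  unfolding diff_trdeg_def by (intro Max_ge finite_diff_indep_sets) blast

lemma diff_trdeg_attained:
  assumes "0 \<in> P"
  obtains T where "T \<subseteq> {1..n}" "diff_indep P T" "card T = diff_trdeg n P"
proof -
  have "card ` {T. T \<subseteq> {1..n} \<and> diff_indep P T} \<noteq> {}"
    using diff_indep_empty[OF assms] by blast
  then have "diff_trdeg n P \<in> card ` {T. T \<subseteq> {1..n} \<and> diff_indep P T}"
    unfolding diff_trdeg_def by (rule Max_in[OF finite_diff_indep_sets])
  then show ?thesis using that by auto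
qed

context
  fixes D :: "'d::finite \<Rightarrow> 'a::comm_ring_1 \<Rightarrow> 'a" and n :: nat
  assumes D: "differential_ring ring_of_type_algebra D" and ordinary: "CARD('d) = 1"
    and S3: "property_S3 D" and standard: "standard ring_of_type_algebra D"
begin

abbreviation (input) "RSpec \<equiv> diff_spec ring_of_type_algebra D"
abbreviation (input) "PSpec \<equiv> diff_spec (dpoly_ring n) (dpoly_deriv D)"

lemma PSpec_zero: "P \<in> PSpec \<Longrightarrow> 0 \<in> P"
  using prime_inD(2) by (auto simp: diff_spec_dpoly_iff)

lemma diff_trdeg_le: "P \<in> PSpec \<Longrightarrow> diff_trdeg n P \<le> n"
  by (metis PSpec_zero diff_trdeg_attained card_mono finite_atLeastAtMost card_atLeastAtMost diff_Suc_1)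

lemma diff_trdeg_antimono:
  assumes "P \<in> PSpec" "P' \<in> PSpec" "P' \<subseteq> P"
  shows "diff_trdeg n P \<le> diff_trdeg n P'"
proof -
  obtain T where T: "T \<subseteq> {1..n}" "diff_indep P T" "card T = diff_trdeg n P"
    by (rule diff_trdeg_attained[OF PSpec_zero[OF assms(1)]])
  then have "diff_indep P' T"
    using diff_indep_antimono[OF D S3 _ assms] by blast
  then show ?thesis using card_le_diff_trdeg T by metis
qed

lemma Inter_desc_chain_in_diff_spec:
  assumes c: "\<And>i. c i \<in> PSpec" "\<And>i. c (Suc i) \<subseteq> c i"
  shows "(\<Inter>i. c i) \<in> PSpec"
  unfolding diff_spec_dpoly_iff
proof (intro conjI allI ballI)
  let ?C = "carrier (dpoly_ring n) :: ('a, 'd) dpoly set"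
  have p: "prime_in ?C (c i)" and d: "f \<in> c i \<Longrightarrow> dpoly_deriv D k f \<in> c i" for i f k
    using c(1)[of i] by (auto simp: diff_spec_dpoly_iff)
  show "dpoly_deriv D k f \<in> (\<Inter>i. c i)" if "f \<in> (\<Inter>i. c i)" for k f
    using that d by simp
  have anti: "c j \<subseteq> c i" if "i \<le> j" for i j
    using lift_Suc_antimono_le[of c i j] c(2) that by blast
  show "prime_in ?C (\<Inter>i. c i)"
    unfolding prime_in_def
  proof (intro conjI ballI impI)
    show "(\<Inter>i. c i) \<subseteq> ?C" using prime_inD(1)[OF p[of 0]] by blast
    show "0 \<in> (\<Inter>i. c i)" "1 \<notin> (\<Inter>i. c i)" using prime_inD(2,3)[OF p] by auto
    show "f + g \<in> (\<Inter>i. c i)" if "f \<in> (\<Inter>i. c i)" "g \<in> (\<Inter>i. c i)" for f g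
      using that prime_inD(4)[OF p] by simp
    show "f * g \<in> (\<Inter>i. c i)" if "f \<in> ?C" "g \<in> (\<Inter>i. c i)" for f g
      using that prime_inD(5)[OF p] by simp
    show "f \<in> (\<Inter>i. c i) \<or> g \<in> (\<Inter>i. c i)" if "f \<in> ?C" "g \<in> ?C" "f * g \<in> (\<Inter>i. c i)" for f g
    proof (rule ccontr)
      assume "\<not> ?thesis"
      then obtain i j where ij: "f \<notin> c i" "g \<notin> c j" by blast
      then have "f \<notin> c (max i j)" "g \<notin> c (max i j)"
        using anti[of i "max i j"] anti[of j "max i j"] by auto
      then show False using prime_inD(7)[OF p that(1,2)] that(3) by blast
    qed
  qed
qed

text \<open>If the chain of contractions stabilizes at some \<open>q\<close>, the terms from there on and their
  intersection are primes over the same \<open>q\<close> whose differential transcendence degrees are squeezed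
  between those of \<open>P\<close> and \<open>P'\<close>. A set \<open>T\<close> of indeterminates that is maximally independent
  for all of them makes the other indeterminates differentially algebraic modulo the
  intersection, with relations that all terms of the chain share.\<close>

lemma ex_desc_chain_contraction:
  assumes P: "P \<in> PSpec" and P': "P' \<in> PSpec" and chain: "desc_chain PSpec P P' c"
    and trdeg: "diff_trdeg n P' \<le> diff_trdeg n P"
  shows "\<exists>e. desc_chain RSpec (contraction P) (contraction P') e"
proof (cases "\<forall>N. \<exists>i\<ge>N. contraction (c i) \<noteq> contraction (c N)")
  case True
  have c: "c 0 = P" "\<And>i. c i \<in> PSpec" "\<And>i. c (Suc i) \<subset> c i" "\<And>i. P' \<subseteq> c i"
    using chain unfolding desc_chain_def by simp_all
  have "\<exists>e. desc_chain RSpec (contraction (c 0)) (contraction P') e"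
  proof (rule ex_desc_chain_of_not_eventually_const[where c = "\<lambda>i. contraction (c i)"])
    show "contraction (c i) \<in> RSpec" for i by (rule contraction_in_diff_spec[OF D c(2)])
    show "contraction (c (Suc i)) \<subseteq> contraction (c i)" for i
      by (rule contraction_mono[OF psubset_imp_subset[OF c(3)]])
    show "contraction P' \<subseteq> contraction (c i)" for i by (rule contraction_mono[OF c(4)])
    show "\<exists>i\<ge>N. contraction (c i) \<noteq> contraction (c N)" for N by (rule True[rule_format])
  qed
  then show ?thesis unfolding c(1) .
next
  case False
  then obtain N where "\<not> (\<exists>i\<ge>N. contraction (c i) \<noteq> contraction (c N))"
    unfolding not_all by (rule exE)
  then have N: "contraction (c i) = contraction (c N)" if "i \<ge> N" for i using that by blast
  have c: "c 0 = P" "\<And>i. c i \<in> PSpec" "\<And>i. c (Suc i) \<subset> c i" "\<And>i. P' \<subseteq> c i"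
    using chain unfolding desc_chain_def by simp_all
  define b where "b i = c (N + i)" for i
  define q where "q = contraction (c N)"
  have b: "\<And>i. b i \<in> PSpec" "\<And>i. b (Suc i) \<subset> b i" "\<And>i. contraction (b i) = q"
    using c(2,3) unfolding b_def q_def by (simp, simp, intro N, simp)
  define I where "I = (\<Inter>i. b i)"
  have I: "I \<in> PSpec"
    unfolding I_def using b(1) psubset_imp_subset[OF b(2)] by (rule Inter_desc_chain_in_diff_spec)
  have cI: "contraction I = q"
    using b(3) unfolding I_def contraction_def by blast
  have "b 0 \<subseteq> P"
    using lift_Suc_antimono_le[of c 0 N] c(1,3) by (auto simp: b_def psubset_eq)
  then have "diff_trdeg n P \<le> diff_trdeg n (b 0)"
    using diff_trdeg_antimono P b(1) by blast
  moreover have "P' \<subseteq> I" unfolding I_def b_def using c(4) by blast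
  then have "diff_trdeg n I \<le> diff_trdeg n P'"
    using diff_trdeg_antimono I P' by blast
  ultimately have le: "diff_trdeg n I \<le> diff_trdeg n (b 0)" using trdeg by simp
  obtain T where T: "T \<subseteq> {1..n}" "diff_indep (b 0) T" "card T = diff_trdeg n (b 0)"
    by (rule diff_trdeg_attained[OF PSpec_zero[OF b(1)]])
  have finT: "finite T" using T(1) finite_subset by blast
  have q: "q \<in> RSpec" using contraction_in_diff_spec[OF D b(1)[of 0]] b(3) by simp
  have char0: "of_nat k \<notin> q" if "k > 0" for k
    using of_nat_notin_if_char_zero_residue_field[of q k] standard q that
    unfolding standard_def diff_spec_def by blast
  have "\<exists>f. (\<forall>i. f \<in> b i) \<and> f \<in> polys (vars (insert j T)) \<and> f \<notin> coeff_ideal q"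
    if j: "j \<in> {1..n} - T" for j
  proof (rule ccontr)
    assume "\<not> ?thesis"
    then have "diff_indep I (insert j T)"
      unfolding diff_indep_def cI by (auto simp: I_def)
    moreover have "insert j T \<subseteq> {1..n}" using j T(1) by blast
    ultimately have "card (insert j T) \<le> diff_trdeg n I" by (intro card_le_diff_trdeg)
    then show False using j finT T(3) le by simp
  qed
  then have False
    using no_desc_chain_of_bounded_order[OF D ordinary b char0 T(1,2)] by blast
  then show ?thesis ..
qed

text \<open>A gap in the polynomial ring that is not witnessed by an increase of the differential
  transcendence degree comes from an equally large gap in \<open>R\<close>. The degree increases at most \<open>n\<close>
  times along a chain, which gives the passage to larger gaps.\<close>

lemma gap_ge_contraction:
  assumes "gap_ge PSpec (Suc d) P P'" "P \<in> PSpec" "P' \<in> PSpec"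
  shows "gap_ge RSpec (Suc d) (contraction P) (contraction P') \<or>
    d = 0 \<and> diff_trdeg n P < diff_trdeg n P'"
  using assms
proof (induction d arbitrary: P P')
  case 0
  then obtain c where "desc_chain PSpec P P' c" by auto
  then have "diff_trdeg n P < diff_trdeg n P' \<or> (\<exists>e. desc_chain RSpec (contraction P) (contraction P') e)"
    using ex_desc_chain_contraction[OF 0(2,3)] not_less by blast
  then show ?case
    using gap_ge_1_iff[of RSpec "contraction P" "contraction P'"] by (simp only: One_nat_def) blast
next
  case (Suc d)
  obtain c where chain: "desc_chain PSpec P P' c" and gap: "\<And>i. gap_ge PSpec (Suc d) (c i) (c (Suc i))"
    using Suc.prems(1) unfolding gap_ge.simps(2)[of PSpec "Suc d"] by blast
  have c: "c 0 = P" "\<And>i. c i \<in> PSpec" "\<And>i. c (Suc i) \<subseteq> c i" "\<And>i. P' \<subseteq> c i"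
    using chain by (auto simp: desc_chain_def)
  let ?a = "\<lambda>i. diff_trdeg n (c i)"
  have a_le: "?a i \<le> ?a j" if "i \<le> j" for i j
    using diff_trdeg_antimono c(2) lift_Suc_antimono_le[of c i j] c(3) that by blast
  define M where "M = Max (range ?a)"
  have "range ?a \<subseteq> {..n}" using diff_trdeg_le c(2) by blast
  then have fin: "finite (range ?a)" using finite_subset by blast
  have "M \<in> range ?a" unfolding M_def using fin by (intro Max_in) auto
  then obtain N where N: "?a N = M" by auto
  have le_M: "?a i \<le> M" for i unfolding M_def using fin by (intro Max_ge) auto
  have tail: "gap_ge RSpec (Suc d) (contraction (c i)) (contraction (c (Suc i)))" if "i \<ge> N" for i
  proof -
    have "\<not> ?a i < ?a (Suc i)" using le_M[of "Suc i"] a_le[OF that] N by simp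
    then show ?thesis using Suc.IH[OF gap c(2) c(2)] by blast
  qed
  \<comment> \<open>From \<open>N\<close> on the degree is constant, so all gaps come from \<open>R\<close>.\<close>
  define e where "e i = contraction (c (N + i))" for i
  have "desc_chain RSpec (contraction (c N)) (contraction P') e"
    unfolding desc_chain_def
  proof (intro conjI allI)
    fix i
    show "e i \<in> RSpec" unfolding e_def using contraction_in_diff_spec[OF D c(2)] .
    show "e (Suc i) \<subset> e i"
      using gap_ge_Suc_imp_psubset[OF tail[of "N + i"]] by (simp add: e_def)
    show "contraction P' \<subseteq> e i" unfolding e_def by (rule contraction_mono[OF c(4)])
  qed (simp add: e_def)
  moreover have "gap_ge RSpec (Suc d) (e i) (e (Suc i))" for i
    using tail[of "N + i"] unfolding e_def by simp
  ultimately have "gap_ge RSpec (Suc (Suc d)) (contraction (c N)) (contraction P')"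
    unfolding gap_ge.simps(2)[of RSpec "Suc d"] using desc_chain_ne by blast
  moreover have "contraction (c N) \<subseteq> contraction P"
    using contraction_mono lift_Suc_antimono_le[of c 0 N] c(1,3) by auto
  ultimately show ?case
    using gap_ge_extend_top contraction_in_diff_spec[OF D Suc.prems(2)] by blast
qed

text \<open>Along a chain of gaps at least \<open>1\<close>, each step either raises the differential transcendence
  degree or can be charged to a chain in \<open>R\<close>. The contractions at other steps are merged into
  the next step of the chain in \<open>R\<close>.\<close>

lemma gap_chain_contraction:
  assumes "gap_chain PSpec 1 k c"
  shows "\<exists>l e. gap_chain RSpec 1 l e \<and> k + diff_trdeg n (c 0) \<le> l + diff_trdeg n (c k) \<and>
    contraction (c k) \<subseteq> e l"
  using assms
proof (induction k)
  case 0
  then have "c 0 \<in> PSpec" by (simp add: gap_chain_def)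
  then have "contraction (c 0) \<in> RSpec" by (rule contraction_in_diff_spec[OF D])
  then have "gap_chain RSpec 1 0 (\<lambda>_. contraction (c 0))" by (simp add: gap_chain_def)
  then show ?case by (intro exI[of _ 0] exI[of _ "\<lambda>_. contraction (c 0)"]) simp
next
  case (Suc k)
  have ck: "c k \<in> PSpec" "c (Suc k) \<in> PSpec" "c (Suc k) \<subset> c k" "gap_ge PSpec (Suc 0) (c k) (c (Suc k))"
    using Suc.prems by (simp_all add: gap_chain_def del: gap_ge.simps)
  have "gap_chain PSpec 1 k c" using Suc.prems unfolding gap_chain_def by simp
  then obtain l e where e: "gap_chain RSpec 1 l e"
    "k + diff_trdeg n (c 0) \<le> l + diff_trdeg n (c k)" "contraction (c k) \<subseteq> e l"
    using Suc.IH by blast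
  have le: "diff_trdeg n (c k) \<le> diff_trdeg n (c (Suc k))"
    using diff_trdeg_antimono ck by blast
  consider "gap_ge RSpec (Suc 0) (contraction (c k)) (contraction (c (Suc k)))" |
    "diff_trdeg n (c k) < diff_trdeg n (c (Suc k))"
    using gap_ge_contraction[OF ck(4,1,2)] by blast
  then show ?case
  proof cases
    case 1
    define e' where "e' = e(Suc l := contraction (c (Suc k)))"
    have el: "e l \<in> RSpec" using e(1) by (simp add: gap_chain_def)
    have gap: "gap_ge RSpec 1 (e l) (contraction (c (Suc k)))"
      unfolding One_nat_def by (rule gap_ge_extend_top[OF 1 e(3) el])
    have sub: "contraction (c (Suc k)) \<subset> e l"
      using gap unfolding One_nat_def by (rule gap_ge_Suc_imp_psubset)
    have "gap_chain RSpec 1 (Suc l) e'"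
      unfolding gap_chain_def
    proof (intro conjI allI impI)
      fix i
      show "e' i \<in> RSpec" if "i \<le> Suc l"
        using that e(1) contraction_in_diff_spec[OF D ck(2)] by (auto simp: gap_chain_def e'_def)
      assume "i < Suc l"
      then consider "i < l" | "i = l" by linarith
      note cs = this
      show "e' (Suc i) \<subset> e' i"
        using cs by cases (use e(1) sub in \<open>simp_all add: gap_chain_def e'_def\<close>)
      show "gap_ge RSpec 1 (e' i) (e' (Suc i))"
        using cs by cases (use e(1) gap in \<open>simp_all add: gap_chain_def e'_def del: gap_ge.simps One_nat_def\<close>)
    qed
    moreover have "Suc k + diff_trdeg n (c 0) \<le> Suc l + diff_trdeg n (c (Suc k))"
      using e(2) le by simp
    moreover have "contraction (c (Suc k)) \<subseteq> e' (Suc l)" by (simp add: e'_def)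
    ultimately show ?thesis by blast
  next
    case 2
    then have "Suc k + diff_trdeg n (c 0) \<le> l + diff_trdeg n (c (Suc k))"
      using e(2) by simp
    moreover have "contraction (c (Suc k)) \<subseteq> e l"
      using contraction_mono[of "c (Suc k)" "c k"] ck(3) e(3) by blast
    ultimately show ?thesis using e(1) by blast
  qed
qed

lemma gap_chain_contraction_length:
  assumes "gap_chain PSpec 1 k c"
  shows "\<exists>l e. gap_chain RSpec 1 l e \<and> k \<le> n + l"
proof -
  obtain l e where e: "gap_chain RSpec 1 l e" "k + diff_trdeg n (c 0) \<le> l + diff_trdeg n (c k)"
    using gap_chain_contraction[OF assms] by blast
  have "c k \<in> PSpec" using assms by (simp add: gap_chain_def)
  then have "k \<le> n + l" using diff_trdeg_le[of "c k"] e(2) by linarith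
  then show ?thesis using e(1) by blast
qed

lemma gap_chain_contraction_of_gap_gt_1:
  assumes "gap_chain PSpec t k c" "t > 1"
  shows "gap_chain RSpec t k (\<lambda>i. contraction (c i))"
proof -
  obtain d where t: "t = Suc (Suc d)" using assms(2) less_imp_Suc_add[of 1 t] by auto
  have c: "c i \<in> PSpec" if "i \<le> k" for i using assms(1) that by (simp add: gap_chain_def)
  have gap: "gap_ge RSpec t (contraction (c i)) (contraction (c (Suc i)))" if "i < k" for i
  proof -
    have "gap_ge PSpec (Suc (Suc d)) (c i) (c (Suc i))"
      using assms(1) that unfolding gap_chain_def t by (simp del: gap_ge.simps)
    moreover have "c i \<in> PSpec" "c (Suc i) \<in> PSpec" using that by (simp_all add: c)
    ultimately show ?thesis
      using gap_ge_contraction[of "Suc d" "c i" "c (Suc i)"] unfolding t by (simp del: gap_ge.simps)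
  qed
  have "contraction (c (Suc i)) \<subset> contraction (c i)" if "i < k" for i
    using gap[OF that] unfolding t by (rule gap_ge_Suc_imp_psubset)
  moreover have "contraction (c i) \<in> RSpec" if "i \<le> k" for i
    by (rule contraction_in_diff_spec[OF D c[OF that]])
  ultimately show ?thesis
    unfolding gap_chain_def using gap by simp
qed

section \<open>Differential type and dimension of the polynomial ring\<close>

lemma diff_type_dpoly_ring:
  assumes type: "diff_type ring_of_type_algebra D = enat t"
    and ne: "RSpec \<noteq> {}" and n: "n > 0"
  shows "diff_type (dpoly_ring n) (dpoly_deriv D) = enat (max t 1)"
proof (rule antisym)
  have "diff_type ring_of_type_algebra D \<le> enat (max t 1)" using type by simp
  then have no_gap: "\<not> gap_ge RSpec (Suc (max t 1)) q q'" if "q \<in> RSpec" "q' \<in> RSpec" "q' \<subseteq> q" for q q'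
    using that unfolding diff_type_le_iff by blast
  show "diff_type (dpoly_ring n) (dpoly_deriv D) \<le> enat (max t 1)"
    unfolding diff_type_le_iff
  proof (intro ballI impI notI)
    fix P P' assume P: "P \<in> PSpec" "P' \<in> PSpec" "P' \<subseteq> P" "gap_ge PSpec (Suc (max t 1)) P P'"
    then have "gap_ge RSpec (Suc (max t 1)) (contraction P) (contraction P')"
      using gap_ge_contraction[OF P(4,1,2)] by (simp del: gap_ge.simps)
    then show False
      using no_gap[OF contraction_in_diff_spec[OF D P(1)] contraction_in_diff_spec[OF D P(2)]
          contraction_mono[OF P(3)]] by blast
  qed
  have "enat t \<le> diff_type ring_of_type_algebra D" using type by simp
  then obtain q q' where q: "q \<in> RSpec" "q' \<in> RSpec" "q' \<subseteq> q" "gap_ge RSpec t q q'"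
    by (rule diff_type_geE[OF _ ne])
  have "enat t \<le> diff_type (dpoly_ring n) (dpoly_deriv D)"
  proof (rule diff_type_geI)
    show "dpoly_ext n q \<in> PSpec" "dpoly_ext n q' \<in> PSpec"
      by (rule dpoly_ext_in_diff_spec[OF D ordinary q(1)], rule dpoly_ext_in_diff_spec[OF D ordinary q(2)])
    show "dpoly_ext n q' \<subseteq> (dpoly_ext n q :: ('a, 'd) dpoly set)"
      using q(3) by (auto simp: dpoly_ext_def)
    show "gap_ge PSpec t (dpoly_ext n q) (dpoly_ext n q')"
      by (rule gap_ge_dpoly_ext[OF D ordinary q(4,1,2)])
  qed
  moreover have "gap_chain RSpec 1 0 (\<lambda>_. q)" using q(1) by (simp add: gap_chain_def)
  then obtain c where "gap_chain PSpec 1 (n + 0) c"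
    using ex_gap_chain_dpoly[OF D ordinary] by blast
  then have "c 0 \<in> PSpec" "c 1 \<in> PSpec" "c 1 \<subset> c 0" "gap_ge PSpec 1 (c 0) (c 1)"
    using n by (simp_all add: gap_chain_def Suc_le_eq del: gap_ge.simps)
  then have "enat 1 \<le> diff_type (dpoly_ring n) (dpoly_deriv D)"
    using diff_type_geI[of "c 0" _ _ "c 1" 1] psubset_imp_subset by blast
  ultimately show "enat (max t 1) \<le> diff_type (dpoly_ring n) (dpoly_deriv D)"
    by (simp add: max_def)
qed

lemma diff_dim_dpoly_ring_type_0:
  assumes type: "diff_type ring_of_type_algebra D = enat 0"
    and ne: "RSpec \<noteq> {}" and n: "n > 0"
  shows "diff_dim (dpoly_ring n) (dpoly_deriv D) = enat n"
proof (rule antisym)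
  have S: "diff_type (dpoly_ring n) (dpoly_deriv D) = enat 1"
    using diff_type_dpoly_ring[OF type ne n] by simp
  have no_gap: "\<not> gap_ge RSpec (Suc 0) q q'" if "q \<in> RSpec" "q' \<in> RSpec" "q' \<subseteq> q" for q q'
    using that type diff_type_le_iff[of ring_of_type_algebra D 0] by simp
  have l: "l = 0" if "gap_chain RSpec 1 l e" for l e
  proof (rule ccontr)
    assume "l \<noteq> 0"
    then have "e 0 \<in> RSpec" "e 1 \<in> RSpec" "e 1 \<subset> e 0" "gap_ge RSpec (Suc 0) (e 0) (e 1)"
      using that by (simp_all add: gap_chain_def Suc_le_eq del: gap_ge.simps)
    then show False using no_gap psubset_imp_subset by blast
  qed
  show "diff_dim (dpoly_ring n) (dpoly_deriv D) \<le> enat n"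
  proof (intro diff_dim_le[OF S])
    fix k c assume "gap_chain PSpec 1 k c"
    from gap_chain_contraction_length[OF this] obtain l e where le: "gap_chain RSpec 1 l e" "k \<le> n + l" by blast
    show "enat k \<le> enat n" using le(2) l[OF le(1)] by simp
  qed
  obtain q where "q \<in> RSpec" using ne by blast
  then have "gap_chain RSpec 1 0 (\<lambda>_. q)" by (simp add: gap_chain_def)
  then obtain c where "gap_chain PSpec 1 (n + 0) c"
    using ex_gap_chain_dpoly[OF D ordinary] by blast
  then show "enat n \<le> diff_dim (dpoly_ring n) (dpoly_deriv D)"
    using gap_chain_le_diff_dim[OF S] by simp
qed

lemma diff_dim_dpoly_ring_type_1:
  assumes type: "diff_type ring_of_type_algebra D = enat 1"
    and dim: "diff_dim ring_of_type_algebra D = enat d"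
    and ne: "RSpec \<noteq> {}" and n: "n > 0"
  shows "diff_dim (dpoly_ring n) (dpoly_deriv D) = enat (n + d)"
proof (rule antisym)
  have S: "diff_type (dpoly_ring n) (dpoly_deriv D) = enat 1"
    using diff_type_dpoly_ring[OF type ne n] by simp
  show "diff_dim (dpoly_ring n) (dpoly_deriv D) \<le> enat (n + d)"
  proof (intro diff_dim_le[OF S])
    fix k c assume "gap_chain PSpec 1 k c"
    from gap_chain_contraction_length[OF this] obtain l e where le: "gap_chain RSpec 1 l e" "k \<le> n + l" by blast
    show "enat k \<le> enat (n + d)" using le(2) gap_chain_le_diff_dim[OF type le(1)] dim by simp
  qed
  obtain e where "gap_chain RSpec 1 d e"
    by (rule diff_dim_attained[OF type dim ne])
  then obtain c where "gap_chain PSpec 1 (n + d) c"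
    using ex_gap_chain_dpoly[OF D ordinary] by blast
  then show "enat (n + d) \<le> diff_dim (dpoly_ring n) (dpoly_deriv D)"
    by (rule gap_chain_le_diff_dim[OF S])
qed

lemma diff_dim_dpoly_ring_type_gt_1:
  assumes type: "diff_type ring_of_type_algebra D = enat t" and t: "t > 1"
    and dim: "diff_dim ring_of_type_algebra D = enat d"
    and ne: "RSpec \<noteq> {}" and n: "n > 0"
  shows "diff_dim (dpoly_ring n) (dpoly_deriv D) = enat d"
proof (rule antisym)
  have S: "diff_type (dpoly_ring n) (dpoly_deriv D) = enat t"
    using diff_type_dpoly_ring[OF type ne n] t by (simp add: max_def)
  show "diff_dim (dpoly_ring n) (dpoly_deriv D) \<le> enat d"
  proof (intro diff_dim_le[OF S])
    fix k c assume "gap_chain PSpec t k c"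
    then show "enat k \<le> enat d"
      using gap_chain_le_diff_dim[OF type gap_chain_contraction_of_gap_gt_1[OF _ t]] dim by simp
  qed
  obtain e where "gap_chain RSpec t d e"
    by (rule diff_dim_attained[OF type dim ne])
  then have "gap_chain PSpec t d (\<lambda>i. dpoly_ext n (e i))"
    by (rule gap_chain_dpoly_ext[OF D ordinary])
  then show "enat d \<le> diff_dim (dpoly_ring n) (dpoly_deriv D)"
    by (rule gap_chain_le_diff_dim[OF S])
qed

end

theorem theorem43:
  fixes D :: "'d::finite \<Rightarrow> 'a::comm_ring_1 \<Rightarrow> 'a"
  assumes "differential_ring ring_of_type_algebra D"
    and "CARD('d) = 1"
    and "diff_spec ring_of_type_algebra D \<noteq> {}"
    and "standard ring_of_type_algebra D"
    and "diff_type ring_of_type_algebra D \<noteq> \<infinity>"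
    and "property_S3 D"
    and "diff_type ring_of_type_algebra D = 0 \<or> diff_dim ring_of_type_algebra D \<noteq> \<infinity>"
  shows "J_ring D"
proof -
  note ctxt = assms(1,2,6,4)
  obtain t where t: "diff_type ring_of_type_algebra D = enat t" using assms(5) by auto
  have type: "diff_type (dpoly_ring n) (dpoly_deriv D) = max (enat t) (enat 1)" if "n > 0" for n
    using diff_type_dpoly_ring[OF ctxt t assms(3) that] by (simp add: max_def)
  have dim: "(t < 1 \<longrightarrow> diff_dim (dpoly_ring n) (dpoly_deriv D) = enat n) \<and>
      (t = 1 \<longrightarrow> diff_dim ring_of_type_algebra D \<noteq> \<infinity> \<and>
        diff_dim (dpoly_ring n) (dpoly_deriv D) = enat n + diff_dim ring_of_type_algebra D) \<and>
      (t > 1 \<longrightarrow> diff_dim ring_of_type_algebra D \<noteq> \<infinity> \<and>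
        diff_dim (dpoly_ring n) (dpoly_deriv D) = diff_dim ring_of_type_algebra D)"
    if n: "n > 0" for n
  proof (cases "t = 0")
    case True
    then show ?thesis
      using diff_dim_dpoly_ring_type_0[OF ctxt t[unfolded True] assms(3) n] by simp
  next
    case False
    then obtain d where d: "diff_dim ring_of_type_algebra D = enat d"
      using assms(7) t by (auto simp: zero_enat_def)
    have "diff_dim (dpoly_ring n) (dpoly_deriv D) = enat (n + d)" if "t = 1"
      using diff_dim_dpoly_ring_type_1[OF ctxt t[unfolded that] d assms(3) n] .
    moreover have "diff_dim (dpoly_ring n) (dpoly_deriv D) = enat d" if "t > 1"
      using diff_dim_dpoly_ring_type_gt_1[OF ctxt t that d assms(3) n] .
    ultimately show ?thesis using False d by simp
  qed
  show ?thesis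
    unfolding J_ring_def Let_def t assms(2)
    using assms(1,3) type dim by (simp only: enat_ord_simps enat.inject) simp
qed

end
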